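(* Assume that $\mathbf G$ is quasi-simple over $L$ and $\mu\in X_*(T)^+$ is non-central. Let $K$ be a spherical subset of $\tilde{\mathbb S}$. Then $W_0=W_{\mathrm{pr}(K)}W_{\mathrm{short}}$ if and only if $K$ is maximal special or one of the following holds: - $\Sigma$ is of type $B_n$ and $K=\tilde{\mathbb S}-\{n\}$; - $\Sigma$ is of type $C_n$ and $K=\tilde{\mathbb S}-\{i\}$ for some $i\neq 0,n$; - $\Sigma$ is of type $F_4$ and $K=\tilde{\mathbb S}-\{4\}$; - $\Sigma$ is of type $G_2$ and $K=\tilde{\mathbb S}-\{2\}$.
   Context: $k$ is an algebraically closed field, $L=k((t))$, $\Gamma_0$ is the absolute Galois group of $L$, $\mathbf G$ is a connected reductive group over $L$. $S$ is a maximal $L$-split torus of $\mathbf G$, $T$ its centralizer (a maximal torus), $N_T$ the normalizer of $T$, $W_0=N_T(L)/T(L)$ the relative Weyl group, $V=X_*(T)_{\Gamma_0}\otimes\mathbb R$. Fix an alcove $\mathfrak a$ in the apartment of $S$, with Iwahori subgroup $\breve{\mathcal I}$; the Iwahori–Weyl group is $\tilde W=N_T(L)/(T(L)\cap\breve{\mathcal I})$. Choosing a special vertex of $\mathfrak a$ identifies the apartment with $V$ and gives $\tilde W\cong X_*(T)_{\Gamma_0}\rtimes W_0$; $\mathrm{pr}:\tilde W\to W_0$ is the projection. $\Sigma$ is the reduced root system in $V^*$ for which the affine root hyperplanes in $V$ are exactly $\{v\mid\langle v,\alpha\rangle=-m\}$, $\alpha\in\Sigma$, $m\in\mathbb Z$;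 the Weyl group of $\Sigma$ is $W_0$ and the affine Weyl group generated by the reflections in the walls of $\mathfrak a$ is the affine Weyl group of $\Sigma$. The dominant chamber is the Weyl chamber containing $\mathfrak a$; it determines $\Sigma^+$ and $X_*(T)^+$ (dominant cocharacters). $\tilde{\mathbb S}$ indexes the simple affine reflections $s_i$; $\mathbb S_0\subseteq\tilde{\mathbb S}$ indexes the simple reflections of $W_0$. When $\Sigma$ is irreducible of rank $n$, $\mathbb S_0=\{1,\dots,n\}$ with simple roots $\alpha_1,\dots,\alpha_n$, and $\tilde{\mathbb S}=\mathbb S_0\cup\{0\}$, where $\alpha_0=-\theta$ with $\theta$ the highest root of $\Sigma$. Labelling: type $B_n$ ($n\ge2$): $\alpha_i=\epsilon_i-\epsilon_{i+1}$ for $i<n$, $\alpha_n=\epsilon_n$; type $C_n$ ($n\ge2$): $\alpha_i=\epsilon_i-\epsilon_{i+1}$ for $i<n$, $\alpha_n=2\epsilon_n$; type $F_4$: Bourbaki labelling, i.e. the diagram is a chain $1,2,3,4$ with $\alpha_1,\alpha_2$ long and $\alpha_3,\alpha_4$ short; type $G_2$: $\alpha_1$ is the long simple root and $\alpha_2$ the short simple root. For $K\subseteq\tilde{\mathbb S}$, $W_K\subseteq\tilde W$ is generated by $s_i$, $i\in K$; $K$ is spherical if $W_K$ is finite; $W_{\mathrm{pr}(K)}=\mathrm{pr}(W_K)\subseteq W_0$. $K$ is (maximal) special if its complement in $\tilde{\mathbb S}$ consists of special vertices, exactly one from each irreducible component of $\Sigma$; equivalently $W_{\mathrm{pr}(K)}=W_0$.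 $W_{\mathrm{short}}$ is the subgroup of $W_0$ generated by the simple reflections associated with the short simple roots of $\Sigma$; if $\Sigma$ is simply-laced, $W_{\mathrm{short}}$ is the trivial group. *)

theory Defs
  imports
    "HOL-Analysis.Analysis"
    "HOL-Computational_Algebra.Computational_Algebra"
    "HOL-Algebra.Bij"
    "HOL-Algebra.Generated_Groups"
begin

section \<open>Root systems and affine reflections\<close>

text \<open>
  Root systems live in Euclidean spaces whose inner product is invariant under the reflections.
  The inner product identifies the space with its dual, so the pairing of a vector
  \<open>v\<close> with a root \<open>a\<close> is \<open>v \<bullet> a\<close>.
\<close>

definition coroot :: "'v::real_inner \<Rightarrow> 'v" where
  "coroot a = (2 / (a \<bullet> a)) *\<^sub>R a"

text \<open>The reflection in the hyperplane \<open>v \<bullet> a = - m\<close>, the zero locus of the affine function \<open>a + m\<close>.\<close>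

definition aff_refl :: "'v::real_inner \<Rightarrow> real \<Rightarrow> 'v \<Rightarrow> 'v" where
  "aff_refl a m v = v - (v \<bullet> a + m) *\<^sub>R coroot a"

abbreviation root_refl :: "'v::real_inner \<Rightarrow> 'v \<Rightarrow> 'v" where
  "root_refl a \<equiv> aff_refl a 0"

text \<open>The roots need not span the whole space.\<close>

definition root_system :: "'v::real_inner set \<Rightarrow> bool" where
  "root_system R \<longleftrightarrow> finite R \<and> 0 \<notin> R \<and> (\<forall>a\<in>R. root_refl a ` R = R) \<and>
     (\<forall>a\<in>R. \<forall>b\<in>R. b \<bullet> coroot a \<in> \<int>)"

definition reduced :: "'v::real_inner set \<Rightarrow> bool" where
  "reduced R \<longleftrightarrow> (\<forall>a\<in>R. \<forall>c. c *\<^sub>R a \<in> R \<longrightarrow> c = 1 \<or> c = -1)"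

definition root_hyperplanes :: "'v::real_inner set \<Rightarrow> 'v set set" where
  "root_hyperplanes R = {{v. v \<bullet> a = - of_int m} |a m. a \<in> R}"

definition full_lattice :: "'x::euclidean_space set \<Rightarrow> bool" where
  "full_lattice X \<longleftrightarrow> (\<exists>B. independent B \<and> span B = UNIV \<and>
     X = {\<Sum>b\<in>B. of_int (c b) *\<^sub>R b |c. True})"


section \<open>The absolute Galois group\<close>

definition field_embedding :: "('l::field \<Rightarrow> 's::field) \<Rightarrow> bool" where
  "field_embedding i \<longleftrightarrow> i 1 = 1 \<and> (\<forall>x y. i (x + y) = i x + i y) \<and> (\<forall>x y. i (x * y) = i x * i y)"

definition separable_closure :: "('l::field \<Rightarrow> 's::field) \<Rightarrow> bool" where
  "separable_closure i \<longleftrightarrow> field_embedding i \<and>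
     (\<forall>x. \<exists>p. coprime p (pderiv p) \<and> poly (map_poly i p) x = 0) \<and>
     (\<forall>q :: 's poly. degree q > 0 \<and> coprime q (pderiv q) \<longrightarrow> (\<exists>x. poly q x = 0))"

definition galois_group :: "('l::field \<Rightarrow> 's::field) \<Rightarrow> ('s \<Rightarrow> 's) set" where
  "galois_group i = {\<sigma>. bij \<sigma> \<and> field_embedding \<sigma> \<and> (\<forall>l. \<sigma> (i l) = i l)}"


section \<open>Reductive groups over $k((t))$ through their root data\<close>

text \<open>
  A connected reductive group \<open>G\<close> over \<open>L = k((t))\<close>, with \<open>k\<close> algebraically closed, is quasi-split
  (Steinberg), hence determined up to isomorphism by its root datum with the action of
  \<open>\<Gamma>\<^sub>0 = Gal(L\<^sup>s/L)\<close> on it. The data are: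
  \<^item> \<open>i\<close>: the embedding of \<open>L\<close> into a separable closure;
  \<^item> \<open>X\<close>: the cocharacter lattice \<open>X\<^sub>*(T)\<close>, inside \<open>'x = X\<^sub>*(T) \<otimes> \<real>\<close>;
  \<^item> \<open>\<Phi>\<close>: the absolute roots of \<open>(G, T)\<close>, regarded as vectors through an inner product on \<open>'x\<close>
    that is invariant under the absolute Weyl group and \<open>\<Gamma>\<^sub>0\<close>;
  \<^item> \<open>\<rho>\<close>: the action of \<open>\<Gamma>\<^sub>0\<close> on \<open>'x\<close>.
\<close>

definition galois_fixed ::
    "('k::alg_closed_field fls \<Rightarrow> 's::field) \<Rightarrow> (('s \<Rightarrow> 's) \<Rightarrow> 'x \<Rightarrow> 'x) \<Rightarrow> 'x set" where
  "galois_fixed i \<rho> = {x. \<forall>\<sigma>\<in>galois_group i. \<rho> \<sigma> x = x}"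

locale reductive_datum =
  fixes i :: "'k::alg_closed_field fls \<Rightarrow> 's::field"
    and X \<Phi> :: "'x::euclidean_space set"
    and \<rho> :: "('s \<Rightarrow> 's) \<Rightarrow> 'x \<Rightarrow> 'x"
  assumes sep_closure: "separable_closure i"
    and lattice: "full_lattice X"
    and abs_roots: "root_system \<Phi>" "reduced \<Phi>"
    and roots_integral: "\<And>a x. a \<in> \<Phi> \<Longrightarrow> x \<in> X \<Longrightarrow> x \<bullet> a \<in> \<int>"
    and coroots_in_lattice: "\<And>a. a \<in> \<Phi> \<Longrightarrow> coroot a \<in> X"
    and action_comp: "\<And>\<sigma> \<tau>. \<sigma> \<in> galois_group i \<Longrightarrow> \<tau> \<in> galois_group i \<Longrightarrow> \<rho> (\<sigma> \<circ> \<tau>) = \<rho> \<sigma> \<circ> \<rho> \<tau>"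
    and action_orthogonal: "\<And>\<sigma>. \<sigma> \<in> galois_group i \<Longrightarrow> orthogonal_transformation (\<rho> \<sigma>)"
    and action_lattice: "\<And>\<sigma>. \<sigma> \<in> galois_group i \<Longrightarrow> \<rho> \<sigma> ` X = X"
    and action_roots: "\<And>\<sigma>. \<sigma> \<in> galois_group i \<Longrightarrow> \<rho> \<sigma> ` \<Phi> = \<Phi>"
    \<comment> \<open>continuity for the Krull topology\<close>
    and action_continuous: "\<exists>F. finite F \<and> (\<forall>\<sigma>\<in>galois_group i. (\<forall>x\<in>F. \<sigma> x = x) \<longrightarrow> \<rho> \<sigma> = id)"
    \<comment> \<open>no root is trivial on \<open>S\<close>, where \<open>X\<^sub>*(S) = X\<^sub>*(T)\<^sup>\<Gamma>\<close>: the centralizer of \<open>S\<close> is \<open>T\<close>\<close>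
    and centralizer: "\<And>a. a \<in> \<Phi> \<Longrightarrow> \<exists>x\<in>galois_fixed i \<rho>. x \<bullet> a \<noteq> 0"

text \<open>
  \<open>G\<close> is semisimple and nontrivial, and its smallest nontrivial connected normal \<open>L\<close>-subgroup is
  \<open>G\<close> itself; such subgroups correspond to the \<open>\<Gamma>\<^sub>0\<close>-stable unions of components of \<open>\<Phi>\<close>.
\<close>

definition quasi_simple ::
    "('k::alg_closed_field fls \<Rightarrow> 's::field) \<Rightarrow> 'x::euclidean_space set \<Rightarrow>
     (('s \<Rightarrow> 's) \<Rightarrow> 'x \<Rightarrow> 'x) \<Rightarrow> bool" where
  "quasi_simple i \<Phi> \<rho> \<longleftrightarrow> \<Phi> \<noteq> {} \<and> span \<Phi> = UNIV \<and>
     (\<forall>\<Phi>'\<subseteq>\<Phi>. \<Phi>' \<noteq> {} \<and> (\<forall>\<sigma>\<in>galois_group i. \<rho> \<sigma> ` \<Phi>' = \<Phi>') \<and>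
        (\<forall>a\<in>\<Phi>'. \<forall>b\<in>\<Phi> - \<Phi>'. a \<bullet> b = 0) \<longrightarrow> \<Phi>' = \<Phi>)"


section \<open>The apartment\<close>

text \<open>
  \<open>'v\<close> is \<open>V = X\<^sub>*(T)\<^bsub>\<Gamma>\<^sub>0\<^esub> \<otimes> \<real>\<close>, with canonical map \<open>\<pi>\<close> from \<open>'x\<close>; it is identified with the apartment
  through a special vertex of the alcove \<open>\<aa>\<close>. \<open>\<Psi>\<close> is the set of affine roots: affine functions
  whose gradients are the relative roots, the restrictions of absolute roots
  along \<open>X\<^sub>*(S) \<otimes> \<real> \<cong> V\<close>.
\<close>

locale apartment = reductive_datum i X \<Phi> \<rho>
  for i :: "'k::alg_closed_field fls \<Rightarrow> 's::field"
    and X \<Phi> :: "'x::euclidean_space set"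
    and \<rho> :: "('s \<Rightarrow> 's) \<Rightarrow> 'x \<Rightarrow> 'x" +
  fixes \<pi> :: "'x \<Rightarrow> 'v::euclidean_space"
    and \<Psi> :: "('v \<Rightarrow> real) set"
    and R \<aa> :: "'v set"
  assumes proj_linear: "linear \<pi>"
    and proj_surj: "surj \<pi>"
    and proj_kernel: "{x. \<pi> x = 0} = span {\<rho> \<sigma> y - y |\<sigma> y. \<sigma> \<in> galois_group i}"
    and affine_root_gradient:
      "\<And>\<psi>. \<psi> \<in> \<Psi> \<Longrightarrow> \<exists>a\<in>\<Phi>. \<exists>r. \<forall>x\<in>galois_fixed i \<rho>. \<psi> (\<pi> x) = x \<bullet> a + r"
    and affine_root_exists:
      "\<And>a. a \<in> \<Phi> \<Longrightarrow> \<exists>\<psi>\<in>\<Psi>. \<exists>r. \<forall>x\<in>galois_fixed i \<rho>. \<psi> (\<pi> x) = x \<bullet> a + r"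
    and root_system_R: "root_system R" "reduced R"
    and affine_root_hyperplanes: "{{v. \<psi> v = 0} |\<psi>. \<psi> \<in> \<Psi>} = root_hyperplanes R"
    and alcove: "\<aa> \<in> components (- \<Union>(root_hyperplanes R))"
    and origin_vertex: "0 \<in> closure \<aa>"

text \<open>
  Below, \<open>R\<close> is the root system called \<open>\<Sigma>\<close> in the literature on Iwahori-Weyl groups.
  The dominant chamber is the one containing \<open>\<aa>\<close>.
\<close>

definition pos_roots :: "'v::euclidean_space set \<Rightarrow> 'v set \<Rightarrow> 'v set" where
  "pos_roots R \<aa> = {a\<in>R. \<forall>v\<in>\<aa>. v \<bullet> a > 0}"

definition simple_roots :: "'v::euclidean_space set \<Rightarrow> 'v set \<Rightarrow> 'v set" where
  "simple_roots R \<aa> =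
     pos_roots R \<aa> - {a + b |a b. a \<in> pos_roots R \<aa> \<and> b \<in> pos_roots R \<aa>}"

text \<open>Meaningful for irreducible \<open>R\<close> only, as is everything that depends on it.\<close>

definition highest_root :: "'v::euclidean_space set \<Rightarrow> 'v set \<Rightarrow> 'v" where
  "highest_root R \<aa> = (THE \<theta>. \<theta> \<in> R \<and>
     (\<forall>a\<in>R. \<exists>c :: 'v \<Rightarrow> nat. \<theta> - a = (\<Sum>b\<in>simple_roots R \<aa>. of_nat (c b) *\<^sub>R b)))"

text \<open>
  The index set of the simple affine reflections: a simple affine root is indexed by its gradient,
  a simple root (for the indices \<open>1,\<dots>,n\<close>) or \<open>- \<theta>\<close> (for the index \<open>0\<close>).
\<close>

definition affine_nodes :: "'v::euclidean_space set \<Rightarrow> 'v set \<Rightarrow> 'v set" where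
  "affine_nodes R \<aa> = insert (- highest_root R \<aa>) (simple_roots R \<aa>)"

text \<open>
  The constant term of the simple affine root with gradient \<open>b\<close>; these affine functions are
  positive on \<open>\<aa>\<close>.
\<close>

definition node_const :: "'v::euclidean_space set \<Rightarrow> 'v set \<Rightarrow> 'v \<Rightarrow> real" where
  "node_const R \<aa> b = (if b \<in> simple_roots R \<aa> then 0 else 1)"

definition simple_reflection :: "'v::euclidean_space set \<Rightarrow> 'v set \<Rightarrow> 'v \<Rightarrow> 'v \<Rightarrow> 'v" where
  "simple_reflection R \<aa> b = aff_refl b (node_const R \<aa> b)"


section \<open>Weyl groups\<close>

text \<open>\<open>W\<^sub>0\<close>, the Weyl group of \<open>R\<close>, acting on \<open>V\<close>.\<close>

definition weyl_group :: "'v::euclidean_space set \<Rightarrow> ('v \<Rightarrow> 'v) set" where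
  "weyl_group R = generate (BijGroup UNIV) (root_refl ` R)"

text \<open>
  The Iwahori-Weyl group \<open>X\<^sub>*(T)\<^bsub>\<Gamma>\<^sub>0\<^esub> \<rtimes> W\<^sub>0\<close> acts on \<open>V\<close> by affine transformations, and the affine Weyl
  group, which contains every \<open>W\<^sub>K\<close>, acts faithfully. So \<open>W\<^sub>K\<close> is formed inside the affine
  transformations of \<open>V\<close>, and the projection to \<open>W\<^sub>0\<close> takes the linear part.
\<close>

definition W_K :: "'v::euclidean_space set \<Rightarrow> 'v set \<Rightarrow> 'v set \<Rightarrow> ('v \<Rightarrow> 'v) set" where
  "W_K R \<aa> K = generate (BijGroup UNIV) (simple_reflection R \<aa> ` K)"

definition pr :: "('v::euclidean_space \<Rightarrow> 'v) \<Rightarrow> 'v \<Rightarrow> 'v" where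
  "pr g = (\<lambda>v. g v - g 0)"

definition W_pr :: "'v::euclidean_space set \<Rightarrow> 'v set \<Rightarrow> 'v set \<Rightarrow> ('v \<Rightarrow> 'v) set" where
  "W_pr R \<aa> K = pr ` W_K R \<aa> K"

definition spherical :: "'v::euclidean_space set \<Rightarrow> 'v set \<Rightarrow> 'v set \<Rightarrow> bool" where
  "spherical R \<aa> K \<longleftrightarrow> K \<subseteq> affine_nodes R \<aa> \<and> finite (W_K R \<aa> K)"

text \<open>For irreducible \<open>R\<close>. No root is short if all have the same length.\<close>

definition short_root :: "'v::euclidean_space set \<Rightarrow> 'v \<Rightarrow> bool" where
  "short_root R a \<longleftrightarrow> a \<in> R \<and> (\<exists>b\<in>R. norm a < norm b)"

definition W_short :: "'v::euclidean_space set \<Rightarrow> 'v set \<Rightarrow> ('v \<Rightarrow> 'v) set" where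
  "W_short R \<aa> = generate (BijGroup UNIV) (root_refl ` {a\<in>simple_roots R \<aa>. short_root R a})"

text \<open>
  The vertex of \<open>\<aa>\<close> attached to a node is the point on the walls of all other nodes. It is special
  if every root hyperplane is parallel to one through it.
\<close>

definition special_node :: "'v::euclidean_space set \<Rightarrow> 'v set \<Rightarrow> 'v \<Rightarrow> bool" where
  "special_node R \<aa> b \<longleftrightarrow> b \<in> affine_nodes R \<aa> \<and>
     (\<exists>v. (\<forall>c\<in>affine_nodes R \<aa> - {b}. v \<bullet> c + node_const R \<aa> c = 0) \<and> (\<forall>a\<in>R. v \<bullet> a \<in> \<int>))"

text \<open>For irreducible \<open>R\<close>.\<close>

definition maximal_special :: "'v::euclidean_space set \<Rightarrow> 'v set \<Rightarrow> 'v set \<Rightarrow> bool" where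
  "maximal_special R \<aa> K \<longleftrightarrow> (\<exists>b. special_node R \<aa> b \<and> K = affine_nodes R \<aa> - {b})"


section \<open>Dominant and central cocharacters\<close>

text \<open>
  The dominant absolute chamber is given by the absolute roots that are positive on \<open>\<aa>\<close>, after the
  identification of \<open>X\<^sub>*(S) \<otimes> \<real>\<close> with \<open>V\<close>.
\<close>

definition abs_pos_roots ::
    "('k::alg_closed_field fls \<Rightarrow> 's::field) \<Rightarrow> 'x::euclidean_space set \<Rightarrow>
     (('s \<Rightarrow> 's) \<Rightarrow> 'x \<Rightarrow> 'x) \<Rightarrow> ('x \<Rightarrow> 'v::euclidean_space) \<Rightarrow> 'v set \<Rightarrow> 'x set" where
  "abs_pos_roots i \<Phi> \<rho> \<pi> \<aa> = {a\<in>\<Phi>. \<forall>x\<in>galois_fixed i \<rho>. \<pi> x \<in> \<aa> \<longrightarrow> x \<bullet> a > 0}"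

definition dominant ::
    "('k::alg_closed_field fls \<Rightarrow> 's::field) \<Rightarrow> 'x::euclidean_space set \<Rightarrow>
     (('s \<Rightarrow> 's) \<Rightarrow> 'x \<Rightarrow> 'x) \<Rightarrow> ('x \<Rightarrow> 'v::euclidean_space) \<Rightarrow> 'v set \<Rightarrow> 'x \<Rightarrow> bool" where
  "dominant i \<Phi> \<rho> \<pi> \<aa> \<mu> \<longleftrightarrow> (\<forall>a\<in>abs_pos_roots i \<Phi> \<rho> \<pi> \<aa>. \<mu> \<bullet> a \<ge> 0)"

definition central :: "'x::euclidean_space set \<Rightarrow> 'x \<Rightarrow> bool" where
  "central \<Phi> \<mu> \<longleftrightarrow> (\<forall>a\<in>\<Phi>. \<mu> \<bullet> a = 0)"


section \<open>Non-simply-laced types with labelled simple roots\<close>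

text \<open>
  Each predicate says that the simple roots, enumerated as \<open>\<alpha> 1, \<dots>, \<alpha> n\<close>, are those of the
  standard root system of the type. Coordinate vectors are orthonormal only up to a common factor,
  as the invariant inner product is unique only up to scaling.
\<close>

definition coordinate_frame :: "nat \<Rightarrow> (nat \<Rightarrow> 'v::euclidean_space) \<Rightarrow> bool" where
  "coordinate_frame n \<epsilon> \<longleftrightarrow>
     (\<exists>c>0. \<forall>i\<in>{1..n}. \<forall>j\<in>{1..n}. \<epsilon> i \<bullet> \<epsilon> j = (if i = j then c else 0))"

definition type_B :: "'v::euclidean_space set \<Rightarrow> 'v set \<Rightarrow> nat \<Rightarrow> (nat \<Rightarrow> 'v) \<Rightarrow> bool" where
  "type_B R \<aa> n \<alpha> \<longleftrightarrow> n \<ge> 2 \<and> bij_betw \<alpha> {1..n} (simple_roots R \<aa>) \<and>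
     (\<exists>\<epsilon>. coordinate_frame n \<epsilon> \<and> (\<forall>i\<in>{1..<n}. \<alpha> i = \<epsilon> i - \<epsilon> (i + 1)) \<and> \<alpha> n = \<epsilon> n)"

definition type_C :: "'v::euclidean_space set \<Rightarrow> 'v set \<Rightarrow> nat \<Rightarrow> (nat \<Rightarrow> 'v) \<Rightarrow> bool" where
  "type_C R \<aa> n \<alpha> \<longleftrightarrow> n \<ge> 2 \<and> bij_betw \<alpha> {1..n} (simple_roots R \<aa>) \<and>
     (\<exists>\<epsilon>. coordinate_frame n \<epsilon> \<and> (\<forall>i\<in>{1..<n}. \<alpha> i = \<epsilon> i - \<epsilon> (i + 1)) \<and> \<alpha> n = 2 *\<^sub>R \<epsilon> n)"

definition type_F4 :: "'v::euclidean_space set \<Rightarrow> 'v set \<Rightarrow> (nat \<Rightarrow> 'v) \<Rightarrow> bool" where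
  "type_F4 R \<aa> \<alpha> \<longleftrightarrow> bij_betw \<alpha> {1..4} (simple_roots R \<aa>) \<and>
     (\<exists>\<epsilon>. coordinate_frame 4 \<epsilon> \<and> \<alpha> 1 = \<epsilon> 2 - \<epsilon> 3 \<and> \<alpha> 2 = \<epsilon> 3 - \<epsilon> 4 \<and> \<alpha> 3 = \<epsilon> 4 \<and>
        \<alpha> 4 = (1/2) *\<^sub>R (\<epsilon> 1 - \<epsilon> 2 - \<epsilon> 3 - \<epsilon> 4))"

text \<open>The Cartan integers of \<open>G\<^sub>2\<close>, with \<open>\<alpha> 1\<close> long and \<open>\<alpha> 2\<close> short (opposite to Bourbaki).\<close>

definition type_G2 :: "'v::euclidean_space set \<Rightarrow> 'v set \<Rightarrow> (nat \<Rightarrow> 'v) \<Rightarrow> bool" where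
  "type_G2 R \<aa> \<alpha> \<longleftrightarrow> bij_betw \<alpha> {1..2} (simple_roots R \<aa>) \<and>
     \<alpha> 1 \<bullet> coroot (\<alpha> 2) = -3 \<and> \<alpha> 2 \<bullet> coroot (\<alpha> 1) = -1"

end

theory Submission
  imports Defs
begin

text \<open>
  Let \<open>\<theta>\<close> be the highest root, and let the comark of a simple root \<open>b\<close> be the coefficient of its coroot
  in the coroot of \<open>\<theta>\<close>; the node \<open>- \<theta>\<close> gets comark 1. The theorem is the conjunction of two facts:
  the Weyl group factorizes through \<open>K\<close> if and only if \<open>K\<close> omits exactly one affine node and this
  node has comark 1, and the nodes of comark 1 are the special ones and those of the list.

  \<^bold>\<open>Comark one is sufficient.\<close> The reflections in long roots generate a normal subgroup, and
  together with the short simple reflections this subgroup gives the whole Weyl group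
  (\<open>weyl_long_short\<close>). The coroots of long roots are the shortest ones, so that their coefficients
  are bounded by the comarks. If \<open>K\<close> omits only a node \<open>j\<close> of comark 1, every long root is
  therefore, up to sign, a nonnegative combination of \<open>K\<close>, and the usual descent shows that its
  reflection lies in the group of \<open>K\<close> (\<open>cone_descent\<close>, \<open>long_reflection\<close>).

  \<^bold>\<open>Comark one is necessary.\<close> The short simple reflections fix the fundamental coweight of a long
  simple root \<open>l\<close>, so that a factorization forces the group of \<open>K\<close> to be transitive on the Weyl
  orbit of this coweight. If \<open>K\<close> omits two nodes, some nonzero vector is orthogonal to \<open>K\<close>, hence to
  all differences within the orbit, hence to the Weyl orbit of the coroot of \<open>l\<close>, which spans. If
  \<open>K\<close> omits one node \<open>j\<close> of comark \<open>m\<close>, these differences have coefficients divisible by \<open>m\<close> at the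
  coroot of \<open>j\<close>; but a difference of two coroots of long roots, or one such coroot, is the coroot
  of \<open>j\<close> up to sign, and so \<open>m = 1\<close> (\<open>factorization_necessary\<close>). That \<open>K\<close> omits a node at
  all follows from sphericity, as all nodes together generate translations.

  \<^bold>\<open>The nodes of comark one.\<close> The coefficient of a simple root in \<open>\<theta>\<close> is its comark times the ratio
  of the square lengths of \<open>\<theta>\<close> and the root. So for long simple roots comark 1 means that the
  node is special, and short simple roots are never special. If there is a short simple root, the
  affine diagram is found together with the comarks: these satisfy the linear equations that express
  the vanishing of the weighted sum of the coroots of all nodes, and along a shortest path from
  \<open>- \<theta>\<close> to the nearest short node this leaves room for the types B, C, F4 and G2 only
  (\<open>classify_short_neighbour\<close>, \<open>classify_long_neighbour\<close>). Conversely, in given coordinates the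
  comarks of the listed nodes are found from the fact that the coroot of \<open>\<theta>\<close> is an integral
  vector of minimal length (\<open>highest_coroot_coordinates\<close>).

  All this concerns an irreducible root system. That the relative root system of a quasi-simple
  group is irreducible is shown in \<open>relative_irreducible\<close>.
\<close>

section \<open>Reflections\<close>

lemma root_refl_eq: "root_refl a v = v - (v \<bullet> coroot a) *\<^sub>R a"
  by (simp add: aff_refl_def coroot_def algebra_simps)

lemma coroot_inner_self: "a \<noteq> 0 \<Longrightarrow> a \<bullet> coroot a = 2"
  by (simp add: coroot_def)

lemma coroot_eq_0_iff [simp]: "coroot a = 0 \<longleftrightarrow> a = 0"
  by (auto simp: coroot_def)

lemma coroot_uminus: "coroot (- a) = - coroot a"
  by (simp add: coroot_def)

lemma inner_coroot_pos_iff: "a \<noteq> 0 \<Longrightarrow> v \<bullet> coroot a > 0 \<longleftrightarrow> v \<bullet> a > 0"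
  using inner_ge_zero[of a] by (auto simp: coroot_def zero_less_divide_iff simp del: inner_ge_zero)

lemma inner_coroot_eq_0_iff: "a \<noteq> 0 \<Longrightarrow> v \<bullet> coroot a = 0 \<longleftrightarrow> v \<bullet> a = 0"
  by (simp add: coroot_def)

lemma inner_coroot_commute: "(v \<bullet> coroot a) * (a \<bullet> a) = 2 * (v \<bullet> a)"
  by (cases "a = 0") (simp_all add: coroot_def)

lemma coroot_inner_coroot: "a \<noteq> 0 \<Longrightarrow> coroot a \<bullet> coroot a = 4 / (a \<bullet> a)"
  by (simp add: coroot_def field_simps)

lemma aff_refl_involution: "aff_refl a m \<circ> aff_refl a m = id"
proof (cases "a = 0")
  case False
  then have "coroot a \<bullet> a = 2"
    by (simp add: coroot_inner_self inner_commute)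
  then show ?thesis
    by (auto simp: aff_refl_def fun_eq_iff inner_diff_left algebra_simps)
qed (auto simp: aff_refl_def coroot_def)

lemma orthogonal_root_refl: "orthogonal_transformation (root_refl a)"
proof (cases "a = 0")
  case True
  then have "root_refl a = id" by (auto simp: aff_refl_def)
  then show ?thesis by (simp add: id_def)
next
  case False
  have "linear (root_refl a)"
    by (auto simp: linear_iff aff_refl_def algebra_simps inner_add_left)
  moreover have "root_refl a v \<bullet> root_refl a w = v \<bullet> w" for v w
  proof -
    have "root_refl a v \<bullet> root_refl a w =
        v \<bullet> w - (w \<bullet> coroot a) * (v \<bullet> a) - (v \<bullet> coroot a) * (a \<bullet> w) + (v \<bullet> coroot a) * (w \<bullet> coroot a) * (a \<bullet> a)"
      by (simp add: root_refl_eq inner_diff_left inner_diff_right right_diff_distrib inner_commute[of a w])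
    also have "\<dots> = v \<bullet> w"
    proof -
      have "(w \<bullet> coroot a) * ((v \<bullet> coroot a) * (a \<bullet> a)) = (w \<bullet> coroot a) * (2 * (v \<bullet> a))"
        "(v \<bullet> coroot a) * ((w \<bullet> coroot a) * (a \<bullet> a)) = (v \<bullet> coroot a) * (2 * (a \<bullet> w))"
        by (simp_all only: inner_coroot_commute inner_commute[of w a])
      then show ?thesis by (simp only: ac_simps)
    qed
    finally show ?thesis .
  qed
  ultimately show ?thesis
    by (simp add: orthogonal_transformation_def)
qed

lemma coroot_orthogonal:
  "orthogonal_transformation g \<Longrightarrow> coroot (g a) = g (coroot a)"
  by (simp add: coroot_def orthogonal_transformation_def linear_scale)

lemma orthogonal_root_refl_conj:
  assumes "orthogonal_transformation g"
  shows "root_refl (g a) (g v) = g (root_refl a v)"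
  using assms coroot_orthogonal[OF assms, of a]
  by (simp add: aff_refl_def orthogonal_transformation_def linear_diff linear_scale)

section \<open>Groups generated by involutions\<close>

text \<open>
  A group generated by involutions consists of the products of generators, so that inverses need
  no separate treatment in inductions over the group.
\<close>

lemma BijGroup_UNIV_simps:
  "carrier (BijGroup UNIV) = {f. bij f}"
  "\<one>\<^bsub>BijGroup UNIV\<^esub> = id"
  "bij f \<Longrightarrow> bij g \<Longrightarrow> f \<otimes>\<^bsub>BijGroup UNIV\<^esub> g = f \<circ> g"
  by (auto simp: BijGroup_def Bij_def restrict_def compose_def fun_eq_iff)

lemma bij_involution: "t \<circ> t = id \<Longrightarrow> bij t"
  using o_bij by blast

lemma generate_bij:
  assumes "g \<in> generate (BijGroup UNIV) T" "\<And>t. t \<in> T \<Longrightarrow> bij t"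
  shows "bij g"
  using group.generate_in_carrier[OF group_BijGroup, of T UNIV g] assms
  by (auto simp: BijGroup_UNIV_simps)

lemma generate_comp:
  assumes "g \<in> generate (BijGroup UNIV) T" "h \<in> generate (BijGroup UNIV) T" "\<And>t. t \<in> T \<Longrightarrow> bij t"
  shows "g \<circ> h \<in> generate (BijGroup UNIV) T"
  using generate.eng[OF assms(1,2)] BijGroup_UNIV_simps(3)[of g h] generate_bij assms by metis

lemma generate_involutions_induct [consumes 1, case_names involution one step]:
  assumes g: "g \<in> generate (BijGroup UNIV) T" and inv: "\<And>t. t \<in> T \<Longrightarrow> t \<circ> t = id"
    and one: "P id"
    and step: "\<And>t h. t \<in> T \<Longrightarrow> h \<in> generate (BijGroup UNIV) T \<Longrightarrow> P h \<Longrightarrow> P (t \<circ> h)"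
  shows "P g"
proof -
  have bij: "\<And>t. t \<in> T \<Longrightarrow> bij t" using inv bij_involution by blast
  have "P (g \<circ> h)" if "h \<in> generate (BijGroup UNIV) T" "P h" for h
    using g that
  proof (induction arbitrary: h rule: generate.induct)
    case one
    then show ?case by (simp add: BijGroup_UNIV_simps)
  next
    case (incl t)
    then show ?case using step by blast
  next
    case (inv t)
    have "inv\<^bsub>BijGroup UNIV\<^esub> t = t"
      using assms(2)[OF inv(1)] bij[OF inv(1)]
      by (intro group.inv_equality[OF group_BijGroup]) (auto simp: BijGroup_UNIV_simps)
    then show ?case using step[OF inv(1,2,3)] by metis
  next
    case (eng g1 g2)
    have "g1 \<otimes>\<^bsub>BijGroup UNIV\<^esub> g2 \<circ> h = g1 \<circ> (g2 \<circ> h)"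
      using BijGroup_UNIV_simps(3)[of g1 g2] generate_bij[OF _ bij] eng.hyps by (simp add: comp_assoc)
    moreover have "g2 \<circ> h \<in> generate (BijGroup UNIV) T"
      using generate_comp[OF eng.hyps(2) eng.prems(1) bij] .
    ultimately show ?case using eng by metis
  qed
  from this[of id] one show ?thesis
    using generate.one[of "BijGroup UNIV" T] by (simp add: BijGroup_UNIV_simps)
qed

definition reflection_group :: "'v::real_inner set \<Rightarrow> ('v \<Rightarrow> 'v) set" where
  "reflection_group A = generate (BijGroup UNIV) (root_refl ` A)"

lemma reflection_group_induct [consumes 1, case_names one step]:
  assumes "g \<in> reflection_group A" "P id"
    and "\<And>a h. a \<in> A \<Longrightarrow> h \<in> reflection_group A \<Longrightarrow> P h \<Longrightarrow> P (root_refl a \<circ> h)"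
  shows "P g"
  using assms unfolding reflection_group_def
  by (induction rule: generate_involutions_induct) (auto simp: aff_refl_involution)

lemma reflection_group_id: "id \<in> reflection_group A"
  using generate.one[of "BijGroup UNIV"] by (simp add: reflection_group_def BijGroup_UNIV_simps)

lemma reflection_group_refl: "a \<in> A \<Longrightarrow> root_refl a \<in> reflection_group A"
  by (simp add: reflection_group_def generate.incl)

lemma reflection_group_comp:
  "g \<in> reflection_group A \<Longrightarrow> h \<in> reflection_group A \<Longrightarrow> g \<circ> h \<in> reflection_group A"
  unfolding reflection_group_def
  by (rule generate_comp) (auto intro: bij_involution aff_refl_involution)

lemma reflection_group_orthogonal:
  "g \<in> reflection_group A \<Longrightarrow> orthogonal_transformation g"
proof (induction rule: reflection_group_induct)
  case one
  then show ?case by (simp add: id_def)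
next
  case (step a h)
  then show ?case using orthogonal_transformation_compose[OF orthogonal_root_refl] by blast
qed

lemma reflection_group_inverse:
  assumes "g \<in> reflection_group A"
  obtains h where "h \<in> reflection_group A" "h \<circ> g = id" "g \<circ> h = id"
proof -
  have "\<exists>h\<in>reflection_group A. h \<circ> g = id \<and> g \<circ> h = id"
    using assms
  proof (induction rule: reflection_group_induct)
    case one
    show ?case by (rule bexI[OF _ reflection_group_id]) simp
  next
    case (step a g)
    then obtain h where h: "h \<in> reflection_group A" "h \<circ> g = id" "g \<circ> h = id" by blast
    have "(h \<circ> root_refl a) \<circ> (root_refl a \<circ> g) = id" "(root_refl a \<circ> g) \<circ> (h \<circ> root_refl a) = id"
      using h aff_refl_involution[of a 0] by (simp_all add: fun_eq_iff)
    then show ?case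
      using h step reflection_group_comp reflection_group_refl by blast
  qed
  then show ?thesis using that by blast
qed

lemma reflection_group_subset:
  assumes "\<And>a. a \<in> A \<Longrightarrow> root_refl a \<in> reflection_group B"
  shows "reflection_group A \<subseteq> reflection_group B"
proof
  fix g assume "g \<in> reflection_group A"
  then show "g \<in> reflection_group B"
    by (induction rule: reflection_group_induct)
       (simp_all only: reflection_group_id reflection_group_comp assms)
qed

text \<open>
  The reflection in \<open>a\<close> is the conjugate by \<open>g\<close> of the reflection in \<open>g a\<close>.
\<close>

lemma root_refl_conj_in_reflection_group:
  assumes g: "g \<in> reflection_group A" and a: "root_refl (g a) \<in> reflection_group A"
  shows "root_refl a \<in> reflection_group A"
proof -
  obtain h where h: "h \<in> reflection_group A" "h \<circ> g = id"
    using reflection_group_inverse[OF g] by blast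
  have "root_refl a = h \<circ> root_refl (g a) \<circ> g"
    using h(2) orthogonal_root_refl_conj[OF reflection_group_orthogonal[OF g]]
    by (auto simp: fun_eq_iff)
  then show ?thesis
    using reflection_group_comp g h a by metis
qed

lemma root_refl_uminus: "root_refl (- a) = root_refl a"
  by (auto simp: aff_refl_def coroot_def)

lemma reflection_group_subspace:
  assumes "g \<in> reflection_group A" "subspace U" "x \<in> U" "\<And>a. a \<in> A \<Longrightarrow> root_refl a ` U \<subseteq> U"
  shows "g x \<in> U"
  using assms(1,3) by (induction rule: reflection_group_induct) (use assms(4) in auto)

lemma reflection_group_image:
  assumes "g \<in> reflection_group A" "x \<in> L" "\<And>a. a \<in> A \<Longrightarrow> root_refl a ` L \<subseteq> L"
  shows "g x \<in> L"
  using assms(1,2) by (induction rule: reflection_group_induct) (use assms(3) in auto)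

lemma reflection_group_fixed:
  assumes "g \<in> reflection_group A" "\<And>a. a \<in> A \<Longrightarrow> v \<bullet> a = 0"
  shows "g v = v"
  using assms(1) by (induction rule: reflection_group_induct) (use assms(2) in \<open>auto simp: aff_refl_def\<close>)

section \<open>Pairs of roots\<close>

lemma root_systemD:
  assumes "root_system R"
  shows root_system_finite: "finite R"
    and root_system_nonzero: "a \<in> R \<Longrightarrow> a \<noteq> 0"
    and root_system_refl: "a \<in> R \<Longrightarrow> b \<in> R \<Longrightarrow> root_refl a b \<in> R"
    and root_system_integral: "a \<in> R \<Longrightarrow> b \<in> R \<Longrightarrow> b \<bullet> coroot a \<in> \<int>"
  using assms by (auto simp: root_system_def)

lemma root_system_uminus:
  assumes "root_system R" "a \<in> R" shows "- a \<in> R"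
proof -
  have "root_refl a a = - a"
    using root_systemD(2)[OF assms] coroot_inner_self[of a]
    by (simp add: root_refl_eq scaleR_2)
  then show ?thesis
    using root_systemD(3)[OF assms(1) assms(2,2)] by simp
qed

lemma cartan_integer_of_longer_root:
  assumes R: "root_system R" "reduced R" and ab: "a \<in> R" "b \<in> R" "a \<noteq> b" "a \<noteq> - b"
    and le: "norm a \<le> norm b"
  shows "\<bar>a \<bullet> coroot b\<bar> < 2" "a \<bullet> coroot b \<in> {-1, 0, 1}"
proof -
  have nz: "a \<noteq> 0" "b \<noteq> 0" using root_systemD(2)[OF R(1)] ab by auto
  have "\<bar>a \<bullet> b\<bar> \<noteq> norm a * norm b"
  proof
    assume "\<bar>a \<bullet> b\<bar> = norm a * norm b"
    then have "norm a *\<^sub>R b = norm b *\<^sub>R a \<or> norm a *\<^sub>R b = - norm b *\<^sub>R a"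
      using norm_cauchy_schwarz_abs_eq by blast
    then have "b = (norm b / norm a) *\<^sub>R a \<or> b = (- norm b / norm a) *\<^sub>R a"
      using nz by (smt (verit, best) divide_inverse_commute eq_vector_fraction_iff norm_eq_zero scaleR_scaleR)
    then obtain c where "b = c *\<^sub>R a" by blast
    then have "c = 1 \<or> c = -1" using R(2) ab unfolding reduced_def by blast
    then show False using \<open>b = c *\<^sub>R a\<close> ab by auto
  qed
  then have "\<bar>a \<bullet> b\<bar> < norm a * norm b"
    using Cauchy_Schwarz_ineq2[of a b] by linarith
  also have "\<dots> \<le> b \<bullet> b"
    using le by (simp add: dot_square_norm power2_eq_square mult_right_mono)
  finally show lt: "\<bar>a \<bullet> coroot b\<bar> < 2"
    using nz by (simp add: coroot_def abs_mult field_simps)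
  obtain k where "a \<bullet> coroot b = of_int k"
    using root_systemD(4)[OF R(1) ab(2,1)] Ints_cases by blast
  moreover then have "k \<in> {-1, 0, 1}" using lt by auto
  ultimately show "a \<bullet> coroot b \<in> {-1, 0, 1}" by auto
qed

text \<open>
  The Cartan integer of the shorter root against the coroot of the longer one is 1, so that the
  reflection of the shorter root subtracts the longer one exactly once.
\<close>

lemma root_diff:
  assumes R: "root_system R" "reduced R" and ab: "a \<in> R" "b \<in> R" "a \<noteq> b" "a \<bullet> b > 0"
  shows "a - b \<in> R"
proof -
  have nz: "a \<noteq> 0" "b \<noteq> 0" using root_systemD(2)[OF R(1)] ab by auto
  have "a \<noteq> - b" using ab(4) inner_gt_zero_iff[of b] by fastforce
  have *: "x - y \<in> R" if "x \<in> R" "y \<in> R" "x \<noteq> y" "x \<noteq> - y" "x \<bullet> y > 0" "norm x \<le> norm y" for x y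
  proof -
    have "x \<bullet> coroot y > 0"
      using that inner_coroot_pos_iff root_systemD(2)[OF R(1)] by blast
    then have "x \<bullet> coroot y = 1"
      using cartan_integer_of_longer_root(2)[OF R that(1-4,6)] by auto
    then show ?thesis
      using root_systemD(3)[OF R(1) that(2,1)] by (simp add: root_refl_eq)
  qed
  show ?thesis
  proof (cases "norm a \<le> norm b")
    case True
    then show ?thesis using * ab \<open>a \<noteq> - b\<close> by blast
  next
    case False
    then have "b - a \<in> R"
      using ab \<open>a \<noteq> - b\<close> by (intro *) (auto simp: inner_commute)
    then show ?thesis using root_system_uminus[OF R(1)] by fastforce
  qed
qed

section \<open>Simple roots\<close>

lemma independent_sum_unique:
  fixes u v :: "'v::real_vector \<Rightarrow> real"
  assumes "independent K" "finite K" "(\<Sum>b\<in>K. u b *\<^sub>R b) = (\<Sum>b\<in>K. v b *\<^sub>R b)" "b \<in> K"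
  shows "u b = v b"
proof -
  have "(\<Sum>b\<in>K. (u b - v b) *\<^sub>R b) = 0"
    using assms(3) by (simp add: scaleR_diff_left sum_subtractf)
  then have "u b - v b = 0"
    using independentD[OF assms(1,2) subset_refl, of "\<lambda>b. u b - v b"] assms(4) by simp
  then show ?thesis by simp
qed

lemma independent_dual_vector:
  fixes K :: "'v::euclidean_space set"
  assumes "independent K"
  shows "\<exists>x. \<forall>b\<in>K. x \<bullet> b = f b"
proof -
  obtain g :: "'v \<Rightarrow> real" where g: "linear g" "\<forall>b\<in>K. g b = f b"
    using linear_independent_extend[OF assms] by blast
  have "g y = (\<Sum>e\<in>Basis. g e *\<^sub>R e) \<bullet> y" for y
  proof -
    have "g y = g (\<Sum>e\<in>Basis. (y \<bullet> e) *\<^sub>R e)" by (simp add: euclidean_representation)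
    also have "\<dots> = (\<Sum>e\<in>Basis. (y \<bullet> e) * g e)"
      by (simp add: linear_sum[OF g(1)] linear_scale[OF g(1)])
    finally show ?thesis
      by (simp add: inner_sum_right inner_commute[of _ y] mult.commute)
  qed
  then show ?thesis using g(2) by metis
qed

text \<open>
  A linear relation splits into two equal sums with positive coefficients over disjoint sets of
  vectors; the square of this common value is nonpositive because the angles are obtuse, and then
  pairing with \<open>p\<close> shows that both sums are empty.
\<close>

lemma independent_if_obtuse:
  fixes S :: "'v::real_inner set"
  assumes fin: "finite S" and pos: "\<And>b. b \<in> S \<Longrightarrow> p \<bullet> b > 0"
    and obtuse: "\<And>a b. a \<in> S \<Longrightarrow> b \<in> S \<Longrightarrow> a \<noteq> b \<Longrightarrow> a \<bullet> b \<le> 0"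
  shows "independent S"
proof (rule independent_if_scalars_zero[OF fin])
  fix u x assume rel: "(\<Sum>x\<in>S. u x *\<^sub>R x) = 0" and x: "x \<in> S"
  define P where "P = {b\<in>S. u b > 0}"
  define M where "M = {b\<in>S. u b \<le> 0}"
  have PM: "finite P" "finite M" "S = P \<union> M" "P \<inter> M = {}"
    using fin by (auto simp: P_def M_def)
  define y where "y = (\<Sum>b\<in>P. u b *\<^sub>R b)"
  have "(\<Sum>x\<in>S. u x *\<^sub>R x) = y + (\<Sum>b\<in>M. u b *\<^sub>R b)"
    unfolding y_def using PM by (simp add: sum.union_disjoint)
  then have y: "y = - (\<Sum>b\<in>M. u b *\<^sub>R b)"
    using rel by (simp add: eq_neg_iff_add_eq_0)
  have "y \<bullet> y = (\<Sum>b\<in>P. u b *\<^sub>R b) \<bullet> (\<Sum>c\<in>M. (- u c) *\<^sub>R c)"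
    by (subst (2) y) (simp add: y_def sum_negf)
  also have "\<dots> = (\<Sum>b\<in>P. \<Sum>c\<in>M. u b * (- u c) * (b \<bullet> c))"
    unfolding inner_sum_left inner_sum_right inner_scaleR_left inner_scaleR_right sum_distrib_left
    by (subst sum.swap) (intro sum.cong refl, simp only: inner_commute ac_simps)
  also have "\<dots> \<le> 0"
  proof (intro sum_nonpos)
    fix b c assume bc: "b \<in> P" "c \<in> M"
    then have "b \<bullet> c \<le> 0" using PM by (intro obtuse) auto
    moreover have "u b * (- u c) \<ge> 0" using bc unfolding P_def M_def
      by (intro mult_nonneg_nonneg) auto
    ultimately show "u b * (- u c) * (b \<bullet> c) \<le> 0" by (rule mult_nonneg_nonpos[rotated])
  qed
  finally have "y \<bullet> y \<le> 0" .
  then have "y = 0" using inner_gt_zero_iff[of y] by linarith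
  have "(\<Sum>b\<in>P. u b * (p \<bullet> b)) = p \<bullet> y"
    by (simp add: y_def inner_sum_right)
  then have "\<forall>b\<in>P. u b * (p \<bullet> b) = 0"
    using \<open>y = 0\<close> PM(1) pos
    by (subst sum_nonneg_eq_0_iff[symmetric]) (auto simp: P_def less_imp_le)
  moreover have "(\<Sum>b\<in>M. (- u b) * (p \<bullet> b)) = p \<bullet> y"
    by (simp add: y inner_sum_right sum_negf)
  then have "\<forall>b\<in>M. (- u b) * (p \<bullet> b) = 0"
    using \<open>y = 0\<close> PM(2) pos
    by (subst sum_nonneg_eq_0_iff[symmetric]) (auto simp: M_def less_imp_le mult_nonpos_nonneg)
  ultimately show "u x = 0" using x pos[OF x] PM(3) by force
qed

definition cone_of :: "'v::real_vector set \<Rightarrow> 'v set" where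
  "cone_of K = {\<Sum>b\<in>K. c b *\<^sub>R b |c. \<forall>b\<in>K. c b \<ge> 0}"

lemma cone_ofI: "x = (\<Sum>b\<in>K. c b *\<^sub>R b) \<Longrightarrow> \<forall>b\<in>K. c b \<ge> 0 \<Longrightarrow> x \<in> cone_of K"
  unfolding cone_of_def by (intro CollectI exI[of _ c] conjI)

text \<open>
  Descent along a functional that is 1 on \<open>K\<close>: a root in the cone has positive inner product with
  some \<open>b \<in> K\<close>, and unless the root is \<open>b\<close> itself, the reflection in \<open>b\<close> keeps it in the cone: it
  changes the coefficient of \<open>b\<close> only, and by hypothesis the coefficients have one sign. The lemma
  serves both for simple roots and all of \<open>R\<close>, and for a subset of the affine nodes and the long
  roots.
\<close>

lemma cone_descent:
  fixes R :: "'v::euclidean_space set"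
  assumes R: "root_system R" "reduced R" and K: "K \<subseteq> R" "independent K" and L: "L \<subseteq> R"
    and stable: "\<And>a b. b \<in> K \<Longrightarrow> a \<in> L \<Longrightarrow> root_refl b a \<in> L"
    and signed: "\<And>a. a \<in> L \<Longrightarrow> a \<in> cone_of K \<or> - a \<in> cone_of K"
    and a: "a \<in> L"
  obtains g where "g \<in> reflection_group K" "g a \<in> K \<or> - g a \<in> K"
proof -
  have fin: "finite R" "finite K"
    using root_systemD(1)[OF R(1)] K(1) finite_subset by blast+
  obtain x where x: "\<forall>b\<in>K. x \<bullet> b = 1"
    using independent_dual_vector[OF K(2), of "\<lambda>_. 1"] by blast
  have pos: "\<exists>g\<in>reflection_group K. g a \<in> K"
    if "a \<in> L \<or> - a \<in> L" "a \<in> cone_of K" for a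
    using that
  proof (induction a rule: measure_induct_rule[where f = "\<lambda>a. card {r\<in>R. x \<bullet> r < x \<bullet> a}"])
    case (less a)
    obtain c where c: "a = (\<Sum>b\<in>K. c b *\<^sub>R b)" "\<forall>b\<in>K. c b \<ge> 0"
      using less.prems unfolding cone_of_def by blast
    have aR: "a \<in> R" using less.prems(1) L root_system_uminus[OF R(1)] by fastforce
    have "0 < a \<bullet> a" using root_systemD(2)[OF R(1) aR] by simp
    also have "a \<bullet> a = (\<Sum>b\<in>K. c b * (b \<bullet> a))"
      by (subst (1) c(1)) (simp add: inner_sum_left)
    finally have "\<not> (\<forall>b\<in>K. c b * (b \<bullet> a) \<le> 0)"
      using sum_nonpos[of K "\<lambda>b. c b * (b \<bullet> a)"] by force
    then obtain b where b: "b \<in> K" "c b * (b \<bullet> a) > 0" by force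
    then have ba: "b \<bullet> a > 0" "c b > 0"
      using c(2) by (smt (verit) mult_nonneg_nonpos zero_less_mult_iff)+
    have bR: "b \<in> R" "b \<noteq> 0" using b K root_systemD(2)[OF R(1)] by auto
    show ?case
    proof (cases "a = b")
      case True
      then have "id a \<in> K" using b by simp
      then show ?thesis using reflection_group_id by blast
    next
      case False
      define a' where "a' = root_refl b a"
      have a'_eq: "a' = a - (a \<bullet> coroot b) *\<^sub>R b" by (simp add: a'_def root_refl_eq)
      have gt: "a \<bullet> coroot b > 0"
        using inner_coroot_pos_iff[of b a] bR ba by (simp add: inner_commute)
      have a'L: "a' \<in> L \<or> - a' \<in> L"
      proof (cases "a \<in> L")
        case True
        then show ?thesis using stable[OF b(1)] by (simp add: a'_def)
      next
        case False
        then have "- a \<in> L" using less.prems by blast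
        moreover have "root_refl b (- a) = - a'" by (simp add: a'_def root_refl_eq)
        ultimately show ?thesis using stable[OF b(1)] by metis
      qed
      have smaller: "x \<bullet> a' < x \<bullet> a"
        using x b gt by (simp add: a'_eq inner_diff_right)
      have "a' \<in> R"
        using root_systemD(3)[OF R(1) bR(1) aR] by (simp add: a'_def)
      have "a' \<in> cone_of K"
      proof (rule ccontr)
        assume "a' \<notin> cone_of K"
        then have "- a' \<in> cone_of K" using a'L signed by fastforce
        then obtain d where d: "- a' = (\<Sum>b\<in>K. d b *\<^sub>R b)" "\<forall>b\<in>K. d b \<ge> 0"
          unfolding cone_of_def by blast
        have "(\<Sum>b'\<in>K. (c b' + d b') *\<^sub>R b') = a + (- a')"
          by (simp only: scaleR_add_left sum.distrib c(1)[symmetric] d(1)[symmetric])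
        also have "\<dots> = (a \<bullet> coroot b) *\<^sub>R b" by (simp add: a'_eq)
        also have "\<dots> = (\<Sum>b'\<in>K. (if b' = b then a \<bullet> coroot b else 0) *\<^sub>R b')"
          using b fin by (simp add: if_distrib[of "\<lambda>u. u *\<^sub>R _"] sum.delta cong: if_cong)
        finally have *: "c b' + d b' = (if b' = b then a \<bullet> coroot b else 0)" if "b' \<in> K" for b'
          using independent_sum_unique[OF K(2) fin(2), of "\<lambda>b'. c b' + d b'"
              "\<lambda>b'. if b' = b then a \<bullet> coroot b else 0"] that by blast
        \<comment> \<open>No coefficient other than that of \<open>b\<close> survives, so \<open>a\<close> would be a multiple of \<open>b\<close>.\<close>
        have "c b' = 0" if "b' \<in> K" "b' \<noteq> b" for b'
          using *[OF that(1)] that c(2) d(2) by (smt (verit))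
        then have "a = (\<Sum>b'\<in>K. if b' = b then c b *\<^sub>R b else 0)"
          unfolding c(1) by (intro sum.cong) auto
        then have "a = c b *\<^sub>R b" using b fin by simp
        then have "c b = 1 \<or> c b = -1"
          using R(2) bR aR unfolding reduced_def by blast
        then show False using \<open>a = c b *\<^sub>R b\<close> False ba by auto
      qed
      moreover have "card {r\<in>R. x \<bullet> r < x \<bullet> a'} < card {r\<in>R. x \<bullet> r < x \<bullet> a}"
      proof (rule psubset_card_mono)
        show "{r\<in>R. x \<bullet> r < x \<bullet> a'} \<subset> {r\<in>R. x \<bullet> r < x \<bullet> a}"
          using smaller \<open>a' \<in> R\<close> by force
      qed (use fin in auto)
      ultimately obtain g where g: "g \<in> reflection_group K" "g a' \<in> K"
        using less.IH[OF _ a'L] by blast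
      have "(g \<circ> root_refl b) a \<in> K" using g(2) by (simp add: a'_def)
      moreover have "g \<circ> root_refl b \<in> reflection_group K"
        using g b reflection_group_comp reflection_group_refl by blast
      ultimately show ?thesis by blast
    qed
  qed
  show ?thesis
  proof (cases "a \<in> cone_of K")
    case True
    then show ?thesis using pos a that by blast
  next
    case False
    then have "- a \<in> cone_of K" using signed a by blast
    then obtain g where g: "g \<in> reflection_group K" "g (- a) \<in> K"
      using pos[of "- a"] a by auto
    then have "- g a \<in> K"
      using reflection_group_orthogonal[OF g(1)]
      by (simp add: orthogonal_transformation_def linear_neg)
    then show ?thesis using that g by blast
  qed
qed

lemma finite_has_maximizer:
  fixes f :: "'a \<Rightarrow> real"
  assumes "finite A" "A \<noteq> {}"
  shows "\<exists>m\<in>A. \<forall>x\<in>A. f x \<le> f m"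
proof -
  have "Max (f ` A) \<in> f ` A" using assms by simp
  then obtain m where "m \<in> A" "Max (f ` A) = f m" by auto
  then show ?thesis using assms Max_ge[of "f ` A"] by (metis finite_imageI imageI)
qed

text \<open>
  The vector \<open>p\<close> stands for a point of the alcove; its signs on the roots are those of the whole alcove.
\<close>

locale irreducible_chamber =
  fixes R \<aa> :: "'v::euclidean_space set" and p :: 'v
  assumes root_system: "root_system R" and reduced: "reduced R"
    and nonempty: "R \<noteq> {}" and span_roots: "span R = UNIV"
    and irreducible: "\<And>R'. R' \<subseteq> R \<Longrightarrow> R' \<noteq> {} \<Longrightarrow>
      (\<And>a b. a \<in> R' \<Longrightarrow> b \<in> R - R' \<Longrightarrow> a \<bullet> b = 0) \<Longrightarrow> R' = R"
    and regular: "\<And>a. a \<in> R \<Longrightarrow> p \<bullet> a \<noteq> 0"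
    and pos_roots_eq: "pos_roots R \<aa> = {a\<in>R. p \<bullet> a > 0}"
begin

abbreviation "S \<equiv> simple_roots R \<aa>"

lemmas finite_roots = root_systemD(1)[OF root_system]
  and root_nonzero = root_systemD(2)[OF root_system]
  and root_refl_root = root_systemD(3)[OF root_system]
  and cartan_integral = root_systemD(4)[OF root_system]
  and root_uminus = root_system_uminus[OF root_system]

lemma simple_rootD: "b \<in> S \<Longrightarrow> b \<in> R" "b \<in> S \<Longrightarrow> p \<bullet> b > 0" "b \<in> S \<Longrightarrow> b \<noteq> 0"
  using root_nonzero unfolding simple_roots_def pos_roots_eq by blast+

lemma finite_simple: "finite S"
  using finite_roots simple_rootD(1) by (meson finite_subset subsetI)

lemma simple_indecomposable:
  "b \<in> S \<Longrightarrow> x \<in> R \<Longrightarrow> p \<bullet> x > 0 \<Longrightarrow> y \<in> R \<Longrightarrow> p \<bullet> y > 0 \<Longrightarrow> b \<noteq> x + y"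
  unfolding simple_roots_def pos_roots_eq by blast

lemma simple_obtuse:
  assumes "a \<in> S" "b \<in> S" "a \<noteq> b" shows "a \<bullet> b \<le> 0"
proof (rule ccontr)
  assume "\<not> a \<bullet> b \<le> 0"
  then have *: "a - b \<in> R" "b - a \<in> R"
    using assms root_diff[OF root_system reduced] simple_rootD(1) by (auto simp: inner_commute)
  have "a = b + (a - b)" "b = a + (b - a)" by auto
  moreover have "p \<bullet> (a - b) > 0 \<or> p \<bullet> (b - a) > 0"
    using regular[OF *(1)] by (simp add: inner_diff_right) linarith
  ultimately show False
    using simple_indecomposable[OF assms(1), of b "a - b"]
      simple_indecomposable[OF assms(2), of a "b - a"] * simple_rootD assms by auto
qed

lemma independent_simple: "independent S"
  using independent_if_obtuse[OF finite_simple, of p] simple_rootD simple_obtuse by blast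

lemma positive_root_sum:
  assumes "a \<in> R" "p \<bullet> a > 0"
  shows "\<exists>c::'v \<Rightarrow> nat. a = (\<Sum>b\<in>S. of_nat (c b) *\<^sub>R b)"
  using assms
proof (induction a rule: measure_induct_rule[where f = "\<lambda>a. card {r\<in>R. p \<bullet> r < p \<bullet> a}"])
  case (less a)
  show ?case
  proof (cases "a \<in> S")
    case True
    have "(\<Sum>b\<in>S. of_nat (if b = a then 1 else 0) *\<^sub>R b) = (\<Sum>b\<in>S. if b = a then a else 0)"
      by (intro sum.cong) auto
    also have "\<dots> = a" using True finite_simple by simp
    finally show ?thesis by (metis (no_types))
  next
    case False
    then obtain x y where xy: "a = x + y" "x \<in> R" "p \<bullet> x > 0" "y \<in> R" "p \<bullet> y > 0"
      using less.prems by (auto simp: simple_roots_def pos_roots_eq)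
    have "card {r\<in>R. p \<bullet> r < p \<bullet> z} < card {r\<in>R. p \<bullet> r < p \<bullet> a}"
      if "z \<in> R" "p \<bullet> z < p \<bullet> a" for z
    proof (rule psubset_card_mono)
      show "{r\<in>R. p \<bullet> r < p \<bullet> z} \<subset> {r\<in>R. p \<bullet> r < p \<bullet> a}" using that by force
    qed (use finite_roots in auto)
    then obtain c d :: "'v \<Rightarrow> nat" where
      "x = (\<Sum>b\<in>S. of_nat (c b) *\<^sub>R b)" "y = (\<Sum>b\<in>S. of_nat (d b) *\<^sub>R b)"
      using less.IH[of x] less.IH[of y] xy by (auto simp: inner_add_right)
    then have "a = (\<Sum>b\<in>S. of_nat (c b + d b) *\<^sub>R b)"
      using xy by (simp add: scaleR_add_left sum.distrib)
    then show ?thesis by (intro exI[of _ "\<lambda>b. c b + d b"])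
  qed
qed

lemma span_simple: "span S = UNIV"
proof -
  have "a \<in> span S" if "a \<in> R" "p \<bullet> a > 0" for a
    using positive_root_sum[OF that] span_base by (auto intro!: span_sum span_scale)
  moreover have "p \<bullet> a > 0 \<or> p \<bullet> (- a) > 0" if "a \<in> R" for a
    using regular[OF that] by (simp add: inner_minus_right) linarith
  ultimately have "R \<subseteq> span S"
    using root_uminus span_neg by (metis add.inverse_inverse subsetI)
  then show ?thesis using span_roots by (metis span_mono span_span top.extremum_unique)
qed

text \<open>The fundamental coweights.\<close>

definition \<omega> :: "'v \<Rightarrow> 'v" where
  "\<omega> b = (SOME w. \<forall>b'\<in>S. w \<bullet> b' = (if b' = b then 1 else 0))"

lemma fundamental_coweight: "b' \<in> S \<Longrightarrow> \<omega> b \<bullet> b' = (if b' = b then 1 else 0)"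
  using someI_ex[OF independent_dual_vector[OF independent_simple, of "\<lambda>b'. if b' = b then 1 else 0"]]
  unfolding \<omega>_def by blast

lemma fundamental_coweight_sum: "b \<in> S \<Longrightarrow> \<omega> b \<bullet> (\<Sum>b'\<in>S. u b' *\<^sub>R b') = u b"
proof -
  assume b: "b \<in> S"
  have "\<omega> b \<bullet> (\<Sum>b'\<in>S. u b' *\<^sub>R b') = (\<Sum>b'\<in>S. if b' = b then u b else 0)"
    unfolding inner_sum_right by (intro sum.cong) (auto simp: fundamental_coweight)
  then show ?thesis using b finite_simple by simp
qed

lemma simple_expansion: "(\<Sum>b\<in>S. (\<omega> b \<bullet> x) *\<^sub>R b) = x"
proof -
  have "x \<in> span S" by (simp add: span_simple)
  then obtain u where u: "x = (\<Sum>b\<in>S. u b *\<^sub>R b)"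
    using span_finite[OF finite_simple] by auto
  show ?thesis by (subst (2) u) (intro sum.cong, simp_all add: u fundamental_coweight_sum)
qed

lemma inner_expansion: "x \<bullet> y = (\<Sum>b\<in>S. (\<omega> b \<bullet> x) * (b \<bullet> y))"
  by (subst simple_expansion[of x, symmetric]) (simp add: inner_sum_left)

lemma simple_expansion_unique: "(\<And>b. b \<in> S \<Longrightarrow> \<omega> b \<bullet> x = \<omega> b \<bullet> y) \<Longrightarrow> x = y"
proof -
  assume "\<And>b. b \<in> S \<Longrightarrow> \<omega> b \<bullet> x = \<omega> b \<bullet> y"
  then have "(\<Sum>b\<in>S. (\<omega> b \<bullet> x) *\<^sub>R b) = (\<Sum>b\<in>S. (\<omega> b \<bullet> y) *\<^sub>R b)"
    by (intro sum.cong) auto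
  then show ?thesis by (simp only: simple_expansion)
qed

lemma coefficient_integral: "a \<in> R \<Longrightarrow> b \<in> S \<Longrightarrow> \<omega> b \<bullet> a \<in> \<int>"
  and coefficient_nonneg: "a \<in> R \<Longrightarrow> b \<in> S \<Longrightarrow> p \<bullet> a > 0 \<Longrightarrow> \<omega> b \<bullet> a \<ge> 0"
proof -
  have *: "\<omega> b \<bullet> a \<in> \<int> \<and> \<omega> b \<bullet> a \<ge> 0" if "a \<in> R" "b \<in> S" "p \<bullet> a > 0" for a
  proof -
    obtain c :: "'v \<Rightarrow> nat" where c: "a = (\<Sum>b\<in>S. of_nat (c b) *\<^sub>R b)"
      using positive_root_sum \<open>a \<in> R\<close> \<open>p \<bullet> a > 0\<close> by blast
    then have "\<omega> b \<bullet> a = of_nat (c b)"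
      using fundamental_coweight_sum[OF \<open>b \<in> S\<close>, of "\<lambda>b. of_nat (c b)"] by simp
    then show ?thesis by auto
  qed
  show "a \<in> R \<Longrightarrow> b \<in> S \<Longrightarrow> p \<bullet> a > 0 \<Longrightarrow> \<omega> b \<bullet> a \<ge> 0" using * by blast
  assume "a \<in> R" "b \<in> S"
  moreover have "p \<bullet> a > 0 \<or> p \<bullet> (- a) > 0"
    using regular[OF \<open>a \<in> R\<close>] by (simp add: inner_minus_right) linarith
  ultimately show "\<omega> b \<bullet> a \<in> \<int>"
    using *[of a] *[of "- a"] root_uminus[of a] by (metis Ints_minus add.inverse_inverse inner_minus_right)
qed

lemma one_signed:
  assumes "a \<in> R"
  shows "(\<forall>b\<in>S. \<omega> b \<bullet> a \<ge> 0) \<or> (\<forall>b\<in>S. \<omega> b \<bullet> a \<le> 0)"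
proof -
  have "p \<bullet> a > 0 \<or> p \<bullet> (- a) > 0"
    using regular[OF assms] by (simp add: inner_minus_right) linarith
  then show ?thesis
    using coefficient_nonneg[OF assms] coefficient_nonneg[OF root_uminus[OF assms]]
    by (fastforce simp: inner_minus_right)
qed

text \<open>
  Roots have coefficients of one sign with respect to the simple roots, as the descent requires.
\<close>

lemma conjugate_to_simple:
  assumes "a \<in> R"
  obtains g where "g \<in> reflection_group S" "g a \<in> S \<or> - g a \<in> S"
proof -
  have "x \<in> cone_of S \<or> - x \<in> cone_of S" if x: "x \<in> R" for x
  proof -
    have cone: "y \<in> cone_of S" if "\<forall>b\<in>S. \<omega> b \<bullet> y \<ge> 0" for y
      by (rule cone_ofI[of _ "\<lambda>b. \<omega> b \<bullet> y"]) (simp_all add: that simple_expansion)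
    show ?thesis
      using one_signed[OF x] cone[of x] cone[of "- x"] by auto
  qed
  then show ?thesis
    using cone_descent[OF root_system reduced _ independent_simple subset_refl _ _ assms]
      simple_rootD(1) root_refl_root that by blast
qed

lemma reflection_group_simple: "reflection_group S = reflection_group R"
proof
  show "reflection_group S \<subseteq> reflection_group R"
    using simple_rootD(1) by (intro reflection_group_subset reflection_group_refl)
  show "reflection_group R \<subseteq> reflection_group S"
  proof (rule reflection_group_subset)
    fix a assume "a \<in> R"
    then obtain g where g: "g \<in> reflection_group S" "g a \<in> S \<or> - g a \<in> S"
      using conjugate_to_simple by blast
    then have "root_refl (g a) \<in> reflection_group S"
      using reflection_group_refl root_refl_uminus by metis
    then show "root_refl a \<in> reflection_group S"
      using g(1) root_refl_conj_in_reflection_group by blast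
  qed
qed

lemma reflection_group_root: "g \<in> reflection_group R \<Longrightarrow> a \<in> R \<Longrightarrow> g a \<in> R"
  using reflection_group_image[of g R a R] root_refl_root by blast

text \<open>The irreducibility of \<open>R\<close> makes the reflection representation irreducible.\<close>

lemma invariant_subspace:
  assumes U: "subspace U" "u \<in> U" "u \<noteq> 0" and inv: "\<And>b. b \<in> S \<Longrightarrow> root_refl b ` U \<subseteq> U"
  shows "U = UNIV"
proof -
  have dich: "a \<in> U \<or> (\<forall>u\<in>U. u \<bullet> a = 0)" if a: "a \<in> R" for a
  proof (cases "a \<in> U")
    case False
    have "\<forall>u\<in>U. u \<bullet> a = 0"
    proof
      fix u assume u: "u \<in> U"
      have "root_refl a \<in> reflection_group S"
        using a reflection_group_refl reflection_group_simple by blast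
      then have "root_refl a u \<in> U"
        using reflection_group_subspace U(1) u inv by blast
      then have "u - root_refl a u \<in> U" using U(1) u by (simp add: subspace_diff)
      then have "(u \<bullet> coroot a) *\<^sub>R a \<in> U" by (simp add: root_refl_eq)
      then have "u \<bullet> coroot a = 0"
        using False U(1) by (metis scaleR_scaleR scaleR_one subspace_scale left_inverse)
      then show "u \<bullet> a = 0" using inner_coroot_eq_0_iff root_nonzero[OF a] by blast
    qed
    then show ?thesis by blast
  qed simp
  have "R \<inter> U \<noteq> {}"
  proof
    assume "R \<inter> U = {}"
    then have "\<forall>a\<in>R. orthogonal u a" using dich U(2) by (auto simp: orthogonal_def)
    then have "orthogonal u u"
      using orthogonal_to_span[of u R u] span_roots by (auto simp: orthogonal_commute)
    then show False using U(3) by (simp add: orthogonal_def)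
  qed
  moreover have "a \<bullet> b = 0" if "a \<in> R \<inter> U" "b \<in> R - R \<inter> U" for a b
    using that dich by blast
  ultimately have "R \<inter> U = R" by (intro irreducible) auto
  then have "span R \<subseteq> U" using U(1) by (intro span_minimal) auto
  then show ?thesis using span_roots by auto
qed

text \<open>
  The span of \<open>S'\<close> is invariant, since the simple roots outside \<open>S'\<close> are orthogonal to it.
\<close>

lemma simple_connected:
  assumes "S' \<subseteq> S" "S' \<noteq> {}" "\<And>a b. a \<in> S' \<Longrightarrow> b \<in> S - S' \<Longrightarrow> a \<bullet> b = 0"
  shows "S' = S"
proof (rule ccontr)
  assume "S' \<noteq> S"
  then obtain b where b: "b \<in> S - S'" using assms(1) by blast
  obtain a where a: "a \<in> S'" using assms(2) by blast
  have "span S' = UNIV"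
  proof (rule invariant_subspace)
    show "a \<in> span S'" "a \<noteq> 0" using a assms(1) simple_rootD(3) span_base by auto
    fix c assume c: "c \<in> S"
    show "root_refl c ` span S' \<subseteq> span S'"
    proof (cases "c \<in> S'")
      case True
      then show ?thesis
        using span_base[of c S'] by (auto simp: root_refl_eq intro!: span_diff span_scale)
    next
      case False
      then have "orthogonal c x" if "x \<in> span S'" for x
        using orthogonal_to_span[OF that, of c] assms(3) c
        by (auto simp: orthogonal_def inner_commute)
      then show ?thesis by (auto simp: root_refl_eq orthogonal_def coroot_def inner_commute)
    qed
  qed simp
  then have "orthogonal b b"
    using orthogonal_to_span[of b S' b] assms(3) b by (auto simp: orthogonal_def inner_commute)
  then show False using b simple_rootD(3) by (auto simp: orthogonal_def)
qed

section \<open>Coefficients of coroots\<close>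

text \<open>The fundamental weights, as the basis dual to the simple coroots.\<close>

definition \<eta> :: "'v \<Rightarrow> 'v" where
  "\<eta> b = ((b \<bullet> b) / 2) *\<^sub>R \<omega> b"

lemma coroot_coefficient: "b \<in> S \<Longrightarrow> b' \<in> S \<Longrightarrow> \<eta> b \<bullet> coroot b' = (if b' = b then 1 else 0)"
  using simple_rootD(3) by (auto simp: \<eta>_def coroot_def fundamental_coweight)

lemma coroot_expansion: "(\<Sum>b\<in>S. (\<eta> b \<bullet> x) *\<^sub>R coroot b) = x"
proof -
  have "(\<Sum>b\<in>S. (\<eta> b \<bullet> x) *\<^sub>R coroot b) = (\<Sum>b\<in>S. (\<omega> b \<bullet> x) *\<^sub>R b)"
    using simple_rootD(3) by (intro sum.cong) (auto simp: \<eta>_def coroot_def)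
  then show ?thesis by (simp add: simple_expansion)
qed

text \<open>
  Integral coefficients are known for roots only, and dividing by square lengths destroys
  integrality; but a coroot is conjugate to a simple one, and a simple reflection changes a coroot by
  an integral multiple of a simple coroot.
\<close>

lemma coroot_coefficient_integral:
  assumes "a \<in> R" "b \<in> S" shows "\<eta> b \<bullet> coroot a \<in> \<int>"
proof -
  let ?L = "{x\<in>R. \<forall>b\<in>S. \<eta> b \<bullet> coroot x \<in> \<int>}"
  obtain g where g: "g \<in> reflection_group S" "g a \<in> S \<or> - g a \<in> S"
    using conjugate_to_simple assms by blast
  obtain h where h: "h \<in> reflection_group S" "h \<circ> g = id"
    using reflection_group_inverse[OF g(1)] by blast
  have "x \<in> ?L" if "x \<in> S" for x
    using that simple_rootD(1) coroot_coefficient by auto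
  then have "g a \<in> ?L"
    using g(2) root_uminus[of "- g a"] by (force simp: coroot_uminus)
  moreover have "root_refl c ` ?L \<subseteq> ?L" if c: "c \<in> S" for c
  proof clarify
    fix x assume x: "x \<in> R" "\<forall>b\<in>S. \<eta> b \<bullet> coroot x \<in> \<int>"
    have "coroot (root_refl c x) = root_refl c (coroot x)"
      by (rule coroot_orthogonal[OF orthogonal_root_refl])
    also have "\<dots> = coroot x - (c \<bullet> coroot x) *\<^sub>R coroot c"
      by (simp add: aff_refl_def inner_commute)
    finally have "\<eta> b \<bullet> coroot (root_refl c x) = \<eta> b \<bullet> coroot x - (c \<bullet> coroot x) * (\<eta> b \<bullet> coroot c)" for b
      by (simp add: inner_diff_right)
    then show "root_refl c x \<in> R \<and> (\<forall>b\<in>S. \<eta> b \<bullet> coroot (root_refl c x) \<in> \<int>)"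
      using x c simple_rootD(1) root_refl_root cartan_integral coroot_coefficient
      by (auto intro!: Ints_diff Ints_mult)
  qed
  ultimately have "h (g a) \<in> ?L" by (rule reflection_group_image[OF h(1)])
  then show ?thesis using h(2) assms by (metis (no_types, lifting) comp_apply id_apply mem_Collect_eq)
qed

section \<open>The highest root\<close>

abbreviation "\<theta> \<equiv> highest_root R \<aa>"

definition maximal_root :: "'v \<Rightarrow> bool" where
  "maximal_root a \<longleftrightarrow> a \<in> R \<and> (\<forall>x\<in>R. (\<forall>b\<in>S. \<omega> b \<bullet> a \<le> \<omega> b \<bullet> x) \<longrightarrow> x = a)"

lemma root_below_maximal:
  assumes "a \<in> R"
  obtains a' where "maximal_root a'" "\<And>b. b \<in> S \<Longrightarrow> \<omega> b \<bullet> a \<le> \<omega> b \<bullet> a'"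
proof -
  let ?A = "{x\<in>R. \<forall>b\<in>S. \<omega> b \<bullet> a \<le> \<omega> b \<bullet> x}"
  have "finite ?A" "?A \<noteq> {}" using finite_roots assms by auto
  then obtain a' where a': "a' \<in> ?A" "\<And>x. x \<in> ?A \<Longrightarrow> p \<bullet> x \<le> p \<bullet> a'"
    using finite_has_maximizer[of ?A "(\<bullet>) p"] by blast
  have "x = a'" if x: "x \<in> R" "\<forall>b\<in>S. \<omega> b \<bullet> a' \<le> \<omega> b \<bullet> x" for x
  proof -
    have "x \<in> ?A" using x a'(1) by (force intro: order_trans)
    then have "p \<bullet> (x - a') \<le> 0" using a'(2) by (simp add: inner_diff_right)
    moreover have eq: "p \<bullet> (x - a') = (\<Sum>b\<in>S. (\<omega> b \<bullet> (x - a')) * (b \<bullet> p))"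
      by (subst inner_commute) (rule inner_expansion)
    moreover have ge: "(\<omega> b \<bullet> (x - a')) * (b \<bullet> p) \<ge> 0" if "b \<in> S" for b
      using that x simple_rootD(2)[OF that]
      by (intro mult_nonneg_nonneg) (simp_all add: inner_diff_right inner_commute[of b])
    ultimately have "(\<Sum>b\<in>S. (\<omega> b \<bullet> (x - a')) * (b \<bullet> p)) = 0"
      using sum_nonneg[of S "\<lambda>b. (\<omega> b \<bullet> (x - a')) * (b \<bullet> p)"] by force
    then have "\<forall>b\<in>S. (\<omega> b \<bullet> (x - a')) * (b \<bullet> p) = 0"
      using ge finite_simple by (subst (asm) sum_nonneg_eq_0_iff) auto
    then have "\<omega> b \<bullet> (x - a') = 0" if "b \<in> S" for b
      using that simple_rootD(2)[OF that] by (auto simp: inner_commute[of b])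
    then show "x = a'"
      by (intro simple_expansion_unique) (simp add: inner_diff_right)
  qed
  then show ?thesis using that[of a'] a'(1) unfolding maximal_root_def by auto
qed

text \<open>
  A root with a negative inner product with \<open>b\<close> can be raised by adding \<open>b\<close>.
\<close>

lemma maximal_root_dominant:
  assumes a: "maximal_root a" and b: "b \<in> S" shows "a \<bullet> b \<ge> 0"
proof (rule ccontr)
  assume neg: "\<not> a \<bullet> b \<ge> 0"
  have aR: "a \<in> R" and max: "\<And>x. x \<in> R \<Longrightarrow> (\<forall>b\<in>S. \<omega> b \<bullet> a \<le> \<omega> b \<bullet> x) \<Longrightarrow> x = a"
    using a by (auto simp: maximal_root_def)
  show False
  proof (cases "a = - b")
    case True
    then have "b = a"
      using b simple_rootD(1) by (intro max) (auto simp: fundamental_coweight)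
    then have "p \<bullet> b = - (p \<bullet> b)" using True by (metis inner_minus_right)
    then show False using simple_rootD(2)[OF b] by simp
  next
    case False
    then have "a + b \<in> R"
      using root_diff[OF root_system reduced aR root_uminus[OF simple_rootD(1)[OF b]]] neg by simp
    then have "a + b = a"
      by (rule max) (auto simp: inner_add_right fundamental_coweight[OF b])
    then show False using simple_rootD(3)[OF b] by simp
  qed
qed

text \<open>
  A simple root missing from a dominant root would be orthogonal to the simple roots that occur
  in it.
\<close>

lemma dominant_root_coefficient_pos:
  assumes a: "a \<in> R" "\<And>b. b \<in> S \<Longrightarrow> a \<bullet> b \<ge> 0" and b: "b \<in> S"
  shows "\<omega> b \<bullet> a > 0"
proof -
  have "0 < a \<bullet> a" using root_nonzero a by simp
  also have "a \<bullet> a = (\<Sum>b\<in>S. (\<omega> b \<bullet> a) * (b \<bullet> a))" by (rule inner_expansion)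
  finally have sum_pos: "0 < (\<Sum>b\<in>S. (\<omega> b \<bullet> a) * (b \<bullet> a))" .
  have "\<not> (\<forall>b\<in>S. \<omega> b \<bullet> a \<le> 0)"
  proof
    assume "\<forall>b\<in>S. \<omega> b \<bullet> a \<le> 0"
    then have "(\<Sum>b\<in>S. (\<omega> b \<bullet> a) * (b \<bullet> a)) \<le> 0"
      using a(2) by (intro sum_nonpos mult_nonpos_nonneg) (simp_all add: inner_commute)
    then show False using sum_pos by linarith
  qed
  then have nonneg: "\<forall>b\<in>S. \<omega> b \<bullet> a \<ge> 0" and ex: "\<exists>b\<in>S. \<omega> b \<bullet> a > 0"
    using one_signed[OF a(1)] by (auto simp: not_le)
  let ?S' = "{b\<in>S. \<omega> b \<bullet> a > 0}"
  have "?S' = S"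
  proof (rule simple_connected)
    fix c d assume c: "c \<in> ?S'" and d: "d \<in> S - ?S'"
    have d0: "\<omega> d \<bullet> a = 0" using d nonneg by force
    have le: "(\<omega> e \<bullet> a) * (e \<bullet> d) \<le> 0" if "e \<in> S" for e
    proof (cases "e = d")
      case False
      then have "e \<bullet> d \<le> 0" using simple_obtuse[of e d] that d by blast
      then show ?thesis using nonneg that mult_nonneg_nonpos by blast
    qed (simp add: d0)
    have "a \<bullet> d = (\<Sum>e\<in>S. (\<omega> e \<bullet> a) * (e \<bullet> d))" by (rule inner_expansion)
    moreover have "a \<bullet> d \<ge> 0" using a(2) d by blast
    ultimately have "(\<Sum>e\<in>S. - ((\<omega> e \<bullet> a) * (e \<bullet> d))) = 0"
      using sum_nonpos[of S "\<lambda>e. (\<omega> e \<bullet> a) * (e \<bullet> d)"] le by (simp add: sum_negf)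
    then have "\<forall>e\<in>S. - ((\<omega> e \<bullet> a) * (e \<bullet> d)) = 0"
      using le finite_simple by (subst (asm) sum_nonneg_eq_0_iff) auto
    then show "c \<bullet> d = 0" using c by force
  qed (use ex in auto)
  then show ?thesis using b by blast
qed

text \<open>
  Two maximal roots have positive inner product, because one of them has only positive coefficients
  and the other is dominant and nonzero. So their difference is a root, and its sign would make one
  of them larger than the other.
\<close>

lemma maximal_root_unique:
  assumes "maximal_root a" "maximal_root a'" shows "a = a'"
proof (rule ccontr)
  assume ne: "a \<noteq> a'"
  have R: "a \<in> R" "a' \<in> R" using assms by (auto simp: maximal_root_def)
  have dom: "\<And>b. b \<in> S \<Longrightarrow> a \<bullet> b \<ge> 0" "\<And>b. b \<in> S \<Longrightarrow> b \<bullet> a' \<ge> 0"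
    using maximal_root_dominant assms inner_commute by metis+
  have "\<exists>b\<in>S. b \<bullet> a' \<noteq> 0"
  proof (rule ccontr)
    assume "\<not> ?thesis"
    then have "a' \<bullet> a' = 0" by (subst inner_expansion) simp
    then show False using root_nonzero R by simp
  qed
  then obtain b where b: "b \<in> S" "b \<bullet> a' > 0" using dom(2) by force
  have pos: "\<omega> c \<bullet> a > 0" if "c \<in> S" for c
    using dominant_root_coefficient_pos R(1) dom(1) that by blast
  have "a \<bullet> a' = (\<Sum>b\<in>S. (\<omega> b \<bullet> a) * (b \<bullet> a'))" by (rule inner_expansion)
  also have "\<dots> > 0"
    using b pos dom(2) by (intro sum_pos2[OF finite_simple b(1)] mult_pos_pos mult_nonneg_nonneg) (simp_all add: less_imp_le)
  finally have "a - a' \<in> R" using root_diff[OF root_system reduced R ne] by simp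
  then have "(\<forall>b\<in>S. \<omega> b \<bullet> a' \<le> \<omega> b \<bullet> a) \<or> (\<forall>b\<in>S. \<omega> b \<bullet> a \<le> \<omega> b \<bullet> a')"
    using one_signed[of "a - a'"] by (simp add: inner_diff_right)
  then show False using assms R ne unfolding maximal_root_def by metis
qed

lemma highest_root_maximal: "maximal_root \<theta>"
  and highest_root_above: "a \<in> R \<Longrightarrow> b \<in> S \<Longrightarrow> \<omega> b \<bullet> a \<le> \<omega> b \<bullet> \<theta>"
proof -
  obtain t where t: "maximal_root t"
    using nonempty root_below_maximal by blast
  have above: "\<omega> b \<bullet> a \<le> \<omega> b \<bullet> t" if "a \<in> R" "b \<in> S" for a b
    using root_below_maximal[OF that(1)] maximal_root_unique[OF t] that(2) by metis
  have "\<theta> = t"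
    unfolding highest_root_def
  proof (rule the_equality)
    show "t \<in> R \<and> (\<forall>a\<in>R. \<exists>c :: 'v \<Rightarrow> nat. t - a = (\<Sum>b\<in>S. of_nat (c b) *\<^sub>R b))"
    proof (intro conjI ballI)
      show "t \<in> R" using t by (simp add: maximal_root_def)
      fix a assume a: "a \<in> R"
      have "\<exists>n::nat. \<omega> b \<bullet> (t - a) = of_nat n" if b: "b \<in> S" for b
      proof -
        have "\<omega> b \<bullet> (t - a) \<in> \<int>" "\<omega> b \<bullet> (t - a) \<ge> 0"
          using above[OF a b] coefficient_integral[OF _ b] a \<open>t \<in> R\<close>
          by (auto simp: inner_diff_right)
        then show ?thesis by (metis Ints_cases of_int_0_le_iff of_int_of_nat_eq zero_le_imp_eq_int)
      qed
      then obtain c :: "'v \<Rightarrow> nat" where "\<forall>b\<in>S. \<omega> b \<bullet> (t - a) = of_nat (c b)" by metis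
      then have "(\<Sum>b\<in>S. of_nat (c b) *\<^sub>R b) = (\<Sum>b\<in>S. (\<omega> b \<bullet> (t - a)) *\<^sub>R b)"
        by (intro sum.cong) auto
      then show "\<exists>c :: 'v \<Rightarrow> nat. t - a = (\<Sum>b\<in>S. of_nat (c b) *\<^sub>R b)"
        by (intro exI[of _ c]) (simp add: simple_expansion)
    qed
    fix t' assume t': "t' \<in> R \<and> (\<forall>a\<in>R. \<exists>c :: 'v \<Rightarrow> nat. t' - a = (\<Sum>b\<in>S. of_nat (c b) *\<^sub>R b))"
    then obtain c :: "'v \<Rightarrow> nat" where "t' - t = (\<Sum>b\<in>S. of_nat (c b) *\<^sub>R b)"
      using t by (auto simp: maximal_root_def)
    then have "\<omega> b \<bullet> (t' - t) = of_nat (c b)" if "b \<in> S" for b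
      using fundamental_coweight_sum[OF that, of "\<lambda>b. of_nat (c b)"] by simp
    then have "\<forall>b\<in>S. \<omega> b \<bullet> t \<le> \<omega> b \<bullet> t'" by (simp add: inner_diff_right) (metis diff_ge_0_iff_ge of_nat_0_le_iff)
    then show "t' = t" using t t' by (simp add: maximal_root_def)
  qed
  then show "maximal_root \<theta>" "a \<in> R \<Longrightarrow> b \<in> S \<Longrightarrow> \<omega> b \<bullet> a \<le> \<omega> b \<bullet> \<theta>"
    using t above by auto
qed

lemma highest_root: "\<theta> \<in> R" "\<theta> \<noteq> 0"
  and highest_root_dominant: "b \<in> S \<Longrightarrow> \<theta> \<bullet> b \<ge> 0"
  and highest_root_coefficient_pos: "b \<in> S \<Longrightarrow> \<omega> b \<bullet> \<theta> > 0"
  using highest_root_maximal maximal_root_dominant dominant_root_coefficient_pos root_nonzero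
  by (auto simp: maximal_root_def)

lemma highest_root_not_simple: "- \<theta> \<notin> S"
  using highest_root_coefficient_pos[of "- \<theta>"] fundamental_coweight[of "- \<theta>" "- \<theta>"] by force

text \<open>
  Among the roots of a given length there is a dominant one \<open>a\<close>, and
  \<open>\<theta> \<bullet> \<theta> - a \<bullet> a = (\<theta> - a) \<bullet> (\<theta> + a)\<close> is a product of a sum of simple roots and a dominant vector.
\<close>

lemma highest_root_long:
  assumes "a \<in> R" shows "norm a \<le> norm \<theta>"
proof -
  let ?A = "{x\<in>R. norm x = norm a}"
  have "finite ?A" "?A \<noteq> {}" using finite_roots assms by auto
  then obtain a' where a': "a' \<in> ?A" "\<And>x. x \<in> ?A \<Longrightarrow> p \<bullet> x \<le> p \<bullet> a'"
    using finite_has_maximizer[of ?A "(\<bullet>) p"] by blast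
  have dom: "a' \<bullet> b \<ge> 0" if b: "b \<in> S" for b
  proof (rule ccontr)
    assume "\<not> a' \<bullet> b \<ge> 0"
    then have "a' \<bullet> coroot b < 0" using simple_rootD(3)[OF b] by (simp add: coroot_def field_simps)
    then have "p \<bullet> root_refl b a' > p \<bullet> a'"
      using simple_rootD(2)[OF b] by (simp add: root_refl_eq inner_diff_right mult_neg_pos)
    moreover have "root_refl b a' \<in> ?A"
      using a'(1) b simple_rootD(1) root_refl_root
        orthogonal_transformation_norm[OF orthogonal_root_refl[of b], of a'] by auto
    ultimately show False using a'(2) by fastforce
  qed
  have "0 \<le> (\<Sum>b\<in>S. (\<omega> b \<bullet> (\<theta> - a')) * (b \<bullet> (\<theta> + a')))"
    using highest_root_above a'(1) dom highest_root_dominant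
    by (intro sum_nonneg mult_nonneg_nonneg) (auto simp: inner_diff_right inner_add_right inner_commute)
  also have "\<dots> = (\<theta> - a') \<bullet> (\<theta> + a')" by (rule inner_expansion[symmetric])
  also have "\<dots> = (norm \<theta>)\<^sup>2 - (norm a')\<^sup>2"
    by (simp add: power2_norm_eq_inner algebra_simps inner_commute)
  finally have "norm a' \<le> norm \<theta>" by (metis diff_ge_0_iff_ge norm_ge_zero power2_le_imp_le)
  then show ?thesis using a'(1) by simp
qed

text \<open>Conjugation by the group of the simple reflections preserves length.\<close>

lemma long_simple_exists: "\<exists>l\<in>S. norm l = norm \<theta>"
proof -
  obtain g where g: "g \<in> reflection_group S" "g \<theta> \<in> S \<or> - g \<theta> \<in> S"
    using conjugate_to_simple highest_root by blast
  then show ?thesis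
    using orthogonal_transformation_norm[OF reflection_group_orthogonal[OF g(1)], of \<theta>]
    by (metis norm_minus_cancel)
qed

lemma short_root_iff: "short_root R a \<longleftrightarrow> a \<in> R \<and> norm a \<noteq> norm \<theta>"
  using highest_root highest_root_long unfolding short_root_def
  by (metis order_less_le leD)

section \<open>Comarks of the affine nodes\<close>

abbreviation "N \<equiv> affine_nodes R \<aa>"

lemma nodes_eq: "N = insert (- \<theta>) S"
  by (simp add: affine_nodes_def)

lemma finite_nodes: "finite N"
  using finite_simple by (simp add: nodes_eq)

lemma node_root: "b \<in> N \<Longrightarrow> b \<in> R"
  using simple_rootD(1) root_uminus highest_root(1) by (auto simp: nodes_eq)

text \<open>
  The coefficients in the linear relation between the coroots of the affine nodes; the value at
  \<open>- \<theta>\<close> makes this relation \<open>(\<Sum>b\<in>N. comark b *\<^sub>R coroot b) = 0\<close>.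
\<close>

definition comark :: "'v \<Rightarrow> int" where
  "comark b = (if b \<in> S then \<lfloor>\<eta> b \<bullet> coroot \<theta>\<rfloor> else 1)"

lemma comark_simple: "b \<in> S \<Longrightarrow> of_int (comark b) = \<eta> b \<bullet> coroot \<theta>"
  using coroot_coefficient_integral[OF highest_root(1)] by (auto simp: comark_def elim: Ints_cases)

lemma comark_highest: "comark (- \<theta>) = 1"
  using highest_root_not_simple by (simp add: comark_def)

lemma coroot_coefficient_root: "\<eta> b \<bullet> coroot a = (b \<bullet> b) / (a \<bullet> a) * (\<omega> b \<bullet> a)"
  by (simp add: \<eta>_def coroot_def)

lemma comark_pos: "comark b \<ge> 1"
proof (cases "b \<in> S")
  case True
  have "\<eta> b \<bullet> coroot \<theta> > 0"
    using highest_root_coefficient_pos[OF True] simple_rootD(3)[OF True] highest_root(2)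
    by (simp add: coroot_coefficient_root)
  then have "real_of_int (comark b) > 0" by (simp add: comark_simple[OF True])
  then show ?thesis by linarith
qed (simp add: comark_def)

lemma comark_relation: "(\<Sum>b\<in>N. of_int (comark b) *\<^sub>R coroot b) = 0"
proof -
  have "(\<Sum>b\<in>S. of_int (comark b) *\<^sub>R coroot b) = (\<Sum>b\<in>S. (\<eta> b \<bullet> coroot \<theta>) *\<^sub>R coroot b)"
    by (intro sum.cong) (auto simp: comark_simple)
  then show ?thesis
    using highest_root_not_simple finite_simple
    by (simp add: nodes_eq comark_highest coroot_uminus coroot_expansion)
qed

section \<open>Long roots and the subgroup of an affine node of comark one\<close>

abbreviation "long a \<equiv> norm a = norm \<theta>"

text \<open>
  The coroot of a long root is a multiple of the root by the same factor as for \<open>\<theta>\<close>, so that its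
  coefficients are bounded by the comarks. At a node of comark one the coefficient is 0 or 1 for a
  positive long root \<open>a\<close>; in the first case \<open>a\<close> is a combination of the other simple roots, in the
  second \<open>\<theta> - a\<close> is.
\<close>

lemma long_root_in_node_cone:
  assumes j: "j \<in> S" "comark j = 1" and a: "a \<in> R" "long a"
  shows "a \<in> cone_of (N - {j}) \<or> - a \<in> cone_of (N - {j})"
proof -
  have nodes: "N - {j} = insert (- \<theta>) (S - {j})" "- \<theta> \<notin> S - {j}" "finite (S - {j})"
    using j highest_root_not_simple finite_simple by (auto simp: nodes_eq)
  have expand: "(\<Sum>b\<in>S - {j}. (\<omega> b \<bullet> x) *\<^sub>R b) = x" if "\<omega> j \<bullet> x = 0" for x
  proof -
    have "(\<Sum>b\<in>S. (\<omega> b \<bullet> x) *\<^sub>R b) = (\<omega> j \<bullet> x) *\<^sub>R j + (\<Sum>b\<in>S - {j}. (\<omega> b \<bullet> x) *\<^sub>R b)"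
      using sum.remove[OF finite_simple j(1)] by blast
    then show ?thesis using that by (simp add: simple_expansion)
  qed
  have pos: "a \<in> cone_of (N - {j}) \<or> - a \<in> cone_of (N - {j})" if a: "a \<in> R" "long a" "p \<bullet> a > 0" for a
  proof -
    have "a \<bullet> a = \<theta> \<bullet> \<theta>" using a(2) by (simp add: dot_square_norm)
    then have *: "\<eta> j \<bullet> coroot a = (j \<bullet> j) / (\<theta> \<bullet> \<theta>) * (\<omega> j \<bullet> a)"
      "1 = (j \<bullet> j) / (\<theta> \<bullet> \<theta>) * (\<omega> j \<bullet> \<theta>)"
      using comark_simple[OF j(1), unfolded j(2) coroot_coefficient_root]
      by (simp_all only: coroot_coefficient_root of_int_1)
    have scale: "(j \<bullet> j) / (\<theta> \<bullet> \<theta>) > 0"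
      using simple_rootD(3)[OF j(1)] highest_root(2) by simp
    have "\<omega> j \<bullet> a \<le> \<omega> j \<bullet> \<theta>" "\<omega> j \<bullet> a \<ge> 0"
      using highest_root_above[OF a(1) j(1)] coefficient_nonneg[OF a(1) j(1) a(3)] by auto
    then have "0 \<le> \<eta> j \<bullet> coroot a" "\<eta> j \<bullet> coroot a \<le> 1"
      using scale *(1) mult_left_mono[of "\<omega> j \<bullet> a" "\<omega> j \<bullet> \<theta>" "(j \<bullet> j) / (\<theta> \<bullet> \<theta>)"] *(2)
      by (simp_all only: zero_le_mult_iff) (auto simp: less_imp_le)
    moreover obtain k :: int where k: "\<eta> j \<bullet> coroot a = of_int k"
      using coroot_coefficient_integral[OF a(1) j(1)] Ints_cases by blast
    ultimately have "k = 0 \<or> k = 1" by auto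
    then have "(j \<bullet> j) / (\<theta> \<bullet> \<theta>) * (\<omega> j \<bullet> a) = 0 \<or>
        (j \<bullet> j) / (\<theta> \<bullet> \<theta>) * (\<omega> j \<bullet> a) = (j \<bullet> j) / (\<theta> \<bullet> \<theta>) * (\<omega> j \<bullet> \<theta>)"
      using k *(1,2) by auto
    then consider "\<omega> j \<bullet> a = 0" | "\<omega> j \<bullet> a = \<omega> j \<bullet> \<theta>"
      using scale by (metis mult_cancel_left mult_eq_0_iff less_irrefl)
    then show ?thesis
    proof cases
      case 1
      let ?c = "\<lambda>b. if b = - \<theta> then 0 else \<omega> b \<bullet> a"
      have "(\<Sum>b\<in>N - {j}. ?c b *\<^sub>R b) = (\<Sum>b\<in>S - {j}. (\<omega> b \<bullet> a) *\<^sub>R b)"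
        using nodes by (simp, intro sum.cong) auto
      then have "a = (\<Sum>b\<in>N - {j}. ?c b *\<^sub>R b)" using expand[OF 1] by simp
      moreover have "\<forall>b\<in>N - {j}. ?c b \<ge> 0"
        using nodes coefficient_nonneg[OF a(1) _ a(3)] by auto
      ultimately have "a \<in> cone_of (N - {j})" by (rule cone_ofI)
      then show ?thesis ..
    next
      case 2
      let ?c = "\<lambda>b. if b = - \<theta> then 1 else \<omega> b \<bullet> (\<theta> - a)"
      have "(\<Sum>b\<in>N - {j}. ?c b *\<^sub>R b) = - \<theta> + (\<Sum>b\<in>S - {j}. ?c b *\<^sub>R b)"
        using nodes by simp
      also have "(\<Sum>b\<in>S - {j}. ?c b *\<^sub>R b) = (\<Sum>b\<in>S - {j}. (\<omega> b \<bullet> (\<theta> - a)) *\<^sub>R b)"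
        using nodes(2) by (intro sum.cong) auto
      also have "\<dots> = \<theta> - a" using 2 by (intro expand) (simp add: inner_diff_right)
      finally have "- a = (\<Sum>b\<in>N - {j}. ?c b *\<^sub>R b)" by simp
      moreover have "\<forall>b\<in>N - {j}. ?c b \<ge> 0"
        using nodes highest_root_above[OF a(1)] by (auto simp: inner_diff_right)
      ultimately have "- a \<in> cone_of (N - {j})" by (rule cone_ofI)
      then show ?thesis ..
    qed
  qed
  show ?thesis
  proof (cases "p \<bullet> a > 0")
    case True
    then show ?thesis using pos a by blast
  next
    case False
    then have "p \<bullet> (- a) > 0" using regular[OF a(1)] by simp
    then show ?thesis using pos[of "- a"] a root_uminus by auto
  qed
qed

lemma independent_other_nodes:
  assumes j: "j \<in> S" shows "independent (N - {j})"
proof -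
  have "orthogonal (\<omega> j) x" if "x \<in> span (S - {j})" for x
    using that by (rule orthogonal_to_span) (auto simp: orthogonal_def fundamental_coweight)
  then have "\<theta> \<notin> span (S - {j})"
    using highest_root_coefficient_pos[OF j] by (force simp: orthogonal_def)
  then have "- \<theta> \<notin> span (S - {j})" using span_neg by force
  then have "independent (insert (- \<theta>) (S - {j}))"
    using independent_simple independent_mono by (intro independent_insertI) blast+
  moreover have "N - {j} = insert (- \<theta>) (S - {j})"
    using j highest_root_not_simple by (auto simp: nodes_eq)
  ultimately show ?thesis by simp
qed

lemma long_reflection:
  assumes j: "j \<in> N" "comark j = 1" and a: "a \<in> R" "long a"
  shows "root_refl a \<in> reflection_group (N - {j})"
proof (cases "j \<in> S")
  case False
  then have "N - {j} = S" using j highest_root_not_simple by (auto simp: nodes_eq)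
  then show ?thesis using a reflection_group_refl reflection_group_simple by simp
next
  case True
  let ?L = "{a\<in>R. long a}"
  have "root_refl b x \<in> ?L" if "b \<in> N - {j}" "x \<in> ?L" for x b
    using that node_root root_refl_root orthogonal_transformation_norm[OF orthogonal_root_refl[of b], of x]
    by auto
  then obtain g where g: "g \<in> reflection_group (N - {j})" "g a \<in> N - {j} \<or> - g a \<in> N - {j}"
    using cone_descent[OF root_system reduced _ independent_other_nodes[OF True], of ?L a]
      long_root_in_node_cone[OF True j(2)] node_root a by blast
  then have "root_refl (g a) \<in> reflection_group (N - {j})"
    using reflection_group_refl root_refl_uminus by metis
  then show ?thesis using g(1) root_refl_conj_in_reflection_group by blast
qed

abbreviation "S_short \<equiv> {a\<in>S. short_root R a}"

text \<open>
  Multiply a product \<open>u \<circ> s\<close> by a simple reflection from the left: a long one joins \<open>u\<close>, and a short one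
  can be moved past \<open>u\<close> because it permutes the long roots.
\<close>

lemma weyl_long_short:
  assumes "g \<in> reflection_group R"
  shows "\<exists>u\<in>reflection_group {a\<in>R. long a}. \<exists>s\<in>reflection_group S_short. g = u \<circ> s"
proof -
  let ?L = "{a\<in>R. long a}"
  have "g \<in> reflection_group S" using assms reflection_group_simple by simp
  then show ?thesis
  proof (induction rule: reflection_group_induct)
    case one
    show ?case
      by (intro bexI[OF _ reflection_group_id]) simp
  next
    case (step b h)
    then obtain u s where us: "u \<in> reflection_group ?L" "s \<in> reflection_group S_short" "h = u \<circ> s"
      by blast
    show ?case
    proof (cases "long b")
      case True
      then have "root_refl b \<circ> u \<in> reflection_group ?L"
        using us step.hyps simple_rootD(1) by (intro reflection_group_comp reflection_group_refl) auto
      moreover have "root_refl b \<circ> h = (root_refl b \<circ> u) \<circ> s" using us(3) by (simp only: comp_assoc)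
      ultimately show ?thesis using us(2) by blast
    next
      case False
      have "root_refl b \<circ> u \<circ> root_refl b \<in> reflection_group ?L"
        using us(1)
      proof (induction rule: reflection_group_induct)
        case one
        then show ?case using reflection_group_id[of ?L] aff_refl_involution[of b 0] by (simp only: comp_id)
      next
        case (step a v)
        have "root_refl b a \<in> ?L"
          using step.hyps \<open>b \<in> S\<close> simple_rootD(1) root_refl_root
            orthogonal_transformation_norm[OF orthogonal_root_refl[of b], of a] by auto
        then have "root_refl (root_refl b a) \<circ> (root_refl b \<circ> v \<circ> root_refl b) \<in> reflection_group ?L"
          by (intro reflection_group_comp[OF reflection_group_refl step.IH])
        moreover have "root_refl (root_refl b a) \<circ> (root_refl b \<circ> v \<circ> root_refl b) =
            root_refl b \<circ> (root_refl a \<circ> v) \<circ> root_refl b"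
          by (simp only: fun_eq_iff comp_apply orthogonal_root_refl_conj[OF orthogonal_root_refl] simp_thms)
        ultimately show ?case by metis
      qed
      moreover have "root_refl b \<circ> s \<in> reflection_group S_short"
        using us(2) False step.hyps simple_rootD(1)
        by (intro reflection_group_comp reflection_group_refl) (auto simp: short_root_iff)
      moreover have "root_refl b \<circ> h = (root_refl b \<circ> u \<circ> root_refl b) \<circ> (root_refl b \<circ> s)"
        using us(3) aff_refl_involution[of b 0] by (simp add: fun_eq_iff)
      ultimately show ?thesis by blast
    qed
  qed
qed

section \<open>Factorizations of the Weyl group\<close>

lemma factorization_sufficient:
  assumes j: "j \<in> N" "comark j = 1" and g: "g \<in> reflection_group R"
  shows "\<exists>w\<in>reflection_group (N - {j}). \<exists>s\<in>reflection_group S_short. g = w \<circ> s"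
proof -
  have "reflection_group {a\<in>R. long a} \<subseteq> reflection_group (N - {j})"
    using long_reflection[OF j] by (intro reflection_group_subset) blast
  then show ?thesis using weyl_long_short[OF g] by blast
qed

text \<open>The span of an orbit is an invariant subspace.\<close>

lemma orbit_spans:
  assumes "l \<in> R" "\<And>g. g \<in> reflection_group R \<Longrightarrow> u \<bullet> g l = 0"
  shows "u = 0"
proof -
  let ?O = "{g l |g. g \<in> reflection_group R}"
  have lO: "l \<in> ?O" using reflection_group_id[of R] by (metis (mono_tags, lifting) id_apply mem_Collect_eq)
  have "span ?O = UNIV"
  proof (rule invariant_subspace[of _ l])
    show "l \<in> span ?O" using lO by (rule span_base)
    show "l \<noteq> 0" using assms(1) root_nonzero by blast
    fix b assume "b \<in> S"
    then have "root_refl b \<in> reflection_group R" using simple_rootD(1) reflection_group_refl by blast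
    then have "root_refl b (g l) \<in> ?O" if "g \<in> reflection_group R" for g
      using reflection_group_comp[OF _ that, of "root_refl b"] by (metis (mono_tags, lifting) comp_apply mem_Collect_eq)
    then have "root_refl b ` ?O \<subseteq> ?O" by blast
    then have "root_refl b ` ?O \<subseteq> span ?O" using span_superset by (rule subset_trans)
    then have "span (root_refl b ` ?O) \<subseteq> span ?O" by (rule span_minimal) simp
    moreover have "span (root_refl b ` ?O) = root_refl b ` span ?O"
      using orthogonal_root_refl[of b] by (intro linear_span_image) (simp add: orthogonal_transformation_def)
    ultimately show "root_refl b ` span ?O \<subseteq> span ?O"
      by simp
  qed simp
  then have "orthogonal u u"
    using assms(2) by (intro orthogonal_to_span[of u ?O]) (auto simp: orthogonal_def)
  then show ?thesis by (simp add: orthogonal_def)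
qed

text \<open>
  A vector orthogonal to \<open>K\<close> is fixed by the group of \<open>K\<close>, and the differences within an orbit of
  this group on coweights lie in the span of the coroots of \<open>K\<close> over the integers. Both
  observations restrict the orbit of the fundamental coweight of a long simple root: the short
  simple reflections fix it, so that the group of \<open>K\<close> must move it through its whole orbit
  under the Weyl group.
\<close>

lemma factorization_necessary:
  assumes K: "K \<subseteq> N" "K \<noteq> N"
    and fact: "\<And>g. g \<in> reflection_group R \<Longrightarrow>
      \<exists>w\<in>reflection_group K. \<exists>s\<in>reflection_group S_short. g = w \<circ> s"
  obtains j where "j \<in> N" "comark j = 1" "K = N - {j}"
proof -
  have orbit: "\<exists>w\<in>reflection_group K. g (\<omega> l) = w (\<omega> l)"
    if "g \<in> reflection_group R" "l \<in> S" "long l" for g l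
  proof -
    obtain w s where ws: "w \<in> reflection_group K" "s \<in> reflection_group S_short" "g = w \<circ> s"
      using fact \<open>g \<in> reflection_group R\<close> by blast
    have "s (\<omega> l) = \<omega> l"
      using ws(2) by (rule reflection_group_fixed) (use that short_root_iff fundamental_coweight in auto)
    then show ?thesis using ws by auto
  qed
  have difference: "g (coroot l) = g (\<omega> l) - (g \<circ> root_refl l) (\<omega> l)"
    if "g \<in> reflection_group R" "l \<in> S" for g l
  proof -
    have "root_refl l (\<omega> l) = \<omega> l - coroot l"
      using that by (simp add: aff_refl_def fundamental_coweight)
    then show ?thesis
      using reflection_group_orthogonal[OF that(1)]
      by (simp add: orthogonal_transformation_def linear_diff)
  qed
  obtain l where l: "l \<in> S" "long l" using long_simple_exists by blast
  obtain j where j: "j \<in> N" "j \<notin> K" using K by blast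
  have K_eq: "K = N - {j}"
  proof (rule ccontr)
    assume "K \<noteq> N - {j}"
    then obtain j' where j': "j' \<in> N" "j' \<notin> K" "j' \<noteq> j" using K j by blast
    have "card N = Suc (card S)"
      using highest_root_not_simple finite_simple by (simp add: nodes_eq)
    also have "card S = DIM('v)"
      using independent_simple span_simple by (metis dim_UNIV dim_eq_card_independent dim_span)
    finally have "card (N - {j, j'}) < DIM('v)"
      using j j' finite_nodes by (simp add: card_Diff_subset)
    moreover have "K \<subseteq> N - {j, j'}" using K j j' by blast
    ultimately have "dim K < DIM('v)"
      using dim_le_card[of K "N - {j, j'}"] span_superset[of "N - {j, j'}"] finite_nodes
      by (meson finite_Diff order_trans le_less_trans)
    then have "span K \<noteq> UNIV" by (metis dim_UNIV dim_span less_irrefl)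
    then obtain u where u: "u \<noteq> 0" "\<forall>x\<in>span K. u \<bullet> x = 0"
      using span_not_UNIV_orthogonal by blast
    have "u \<bullet> w y = u \<bullet> y" if "w \<in> reflection_group K" for w y
      using that
    proof (induction rule: reflection_group_induct)
      case (step a h)
      then show ?case using u(2) span_base[of a K] by (simp add: root_refl_eq inner_diff_right)
    qed simp
    then have const: "u \<bullet> g (\<omega> l) = u \<bullet> \<omega> l" if "g \<in> reflection_group R" for g
      using orbit[OF that l] by metis
    have "u = 0"
    proof (rule orbit_spans[of l])
      fix g assume g: "g \<in> reflection_group R"
      then have "g \<circ> root_refl l \<in> reflection_group R"
        using l simple_rootD(1) by (intro reflection_group_comp reflection_group_refl) auto
      then have "u \<bullet> g (coroot l) = 0"
        unfolding difference[OF g l(1)] inner_diff_right using const[OF g] const[of "g \<circ> root_refl l"] by simp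
      then show "u \<bullet> g l = 0"
        using coroot_orthogonal[OF reflection_group_orthogonal[OF g], of l] inner_coroot_eq_0_iff
          reflection_group_root[OF g] root_nonzero simple_rootD(1)[OF l(1)] by metis
    qed (use l simple_rootD in auto)
    then show False using u by blast
  qed
  have "comark j = 1"
  proof (cases "j \<in> S")
    case False
    then show ?thesis by (simp add: comark_def)
  next
    case True
    define m where "m = comark j"
    have coeff: "\<exists>k::int. \<eta> j \<bullet> coroot c = of_int (k * m)" if "c \<in> K" for c
    proof (cases "c = - \<theta>")
      case True
      then have "\<eta> j \<bullet> coroot c = of_int (- 1 * m)"
        using comark_simple[OF \<open>j \<in> S\<close>] by (simp add: m_def coroot_uminus)
      then show ?thesis by blast
    next
      case False
      then have "\<eta> j \<bullet> coroot c = of_int (0 * m)"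
        using that K_eq coroot_coefficient[OF \<open>j \<in> S\<close>, of c] by (auto simp: nodes_eq)
      then show ?thesis by blast
    qed
    have lattice: "(\<forall>a\<in>R. w y \<bullet> a \<in> \<int>) \<and> (\<exists>k::int. \<eta> j \<bullet> (w y - y) = of_int (k * m))"
      if "w \<in> reflection_group K" "\<forall>a\<in>R. y \<bullet> a \<in> \<int>" for w y
      using that(1)
    proof (induction rule: reflection_group_induct)
      case one
      have "\<eta> j \<bullet> (id y - y) = of_int (0 * m)" by simp
      then show ?case using that(2) by (metis id_apply)
    next
      case (step c h)
      have c: "c \<in> R" using step.hyps(1) K node_root by blast
      have eq: "(root_refl c \<circ> h) y = h y - (h y \<bullet> c) *\<^sub>R coroot c" by (simp add: aff_refl_def)
      obtain n :: int where n: "h y \<bullet> c = of_int n" using step.IH c Ints_cases by blast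
      obtain k k' :: int where k: "\<eta> j \<bullet> (h y - y) = of_int (k * m)" "\<eta> j \<bullet> coroot c = of_int (k' * m)"
        using step coeff by blast
      have "\<eta> j \<bullet> ((root_refl c \<circ> h) y - y) = of_int ((k - n * k') * m)"
        unfolding eq using k n by (simp add: inner_diff_right algebra_simps)
      moreover have "(root_refl c \<circ> h) y \<bullet> a \<in> \<int>" if "a \<in> R" for a
        unfolding eq inner_diff_left inner_scaleR_left
        using step.IH that c cartan_integral[OF c that] by (intro Ints_diff Ints_mult) (auto simp: inner_commute)
      ultimately show ?case by blast
    qed
    have long_multiple: "\<exists>k::int. \<eta> j \<bullet> g (coroot l) = of_int (k * m)"
      if g: "g \<in> reflection_group R" and l: "l \<in> S" "long l" for g l
    proof -
      have "\<forall>a\<in>R. \<omega> l \<bullet> a \<in> \<int>" using coefficient_integral l by blast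
      then have *: "\<exists>k::int. \<eta> j \<bullet> (g (\<omega> l) - \<omega> l) = of_int (k * m)" if "g \<in> reflection_group R" for g
        using orbit[OF that l] lattice by metis
      have "g \<circ> root_refl l \<in> reflection_group R"
        using g l simple_rootD(1) by (intro reflection_group_comp reflection_group_refl) auto
      then obtain k k' :: int where "\<eta> j \<bullet> (g (\<omega> l) - \<omega> l) = of_int (k * m)"
        "\<eta> j \<bullet> ((g \<circ> root_refl l) (\<omega> l) - \<omega> l) = of_int (k' * m)"
        using *[OF g] * by blast
      then have "\<eta> j \<bullet> g (coroot l) = of_int ((k - k') * m)"
        unfolding difference[OF g l(1)] inner_diff_right by (simp add: algebra_simps)
      then show ?thesis by blast
    qed
    \<comment> \<open>It remains to reach the coroot of \<open>j\<close>, up to sign, from coroots of long roots.\<close>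
    have "\<exists>k::int. k * m = 1 \<or> k * m = -1"
    proof (cases "long j")
      case True
      obtain k :: int where "\<eta> j \<bullet> id (coroot j) = of_int (k * m)"
        using long_multiple[OF reflection_group_id \<open>j \<in> S\<close> True] by blast
      then have "k * m = 1" using coroot_coefficient[OF \<open>j \<in> S\<close> \<open>j \<in> S\<close>] by (simp del: of_int_mult)
      then show ?thesis by blast
    next
      case False
      have jR: "j \<in> R" "j \<noteq> 0" using \<open>j \<in> S\<close> simple_rootD by auto
      obtain g where g: "g \<in> reflection_group R" "j \<bullet> g l \<noteq> 0"
        using orbit_spans[of l j] l simple_rootD(1) jR by blast
      define x where "x = g l"
      have x: "x \<in> R" "long x"
        using reflection_group_root[OF g(1)] l simple_rootD(1)
          orthogonal_transformation_norm[OF reflection_group_orthogonal[OF g(1)]] by (auto simp: x_def)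
      have "norm j \<le> norm x" using highest_root_long[OF jR(1)] x by simp
      moreover have "j \<noteq> x" "j \<noteq> - x" using False x by auto
      ultimately have "j \<bullet> coroot x \<in> {-1, 0, 1}"
        using cartan_integer_of_longer_root[OF root_system reduced jR(1) x(1)] by blast
      moreover have "j \<bullet> coroot x \<noteq> 0"
        using g(2) inner_coroot_eq_0_iff[of x j] root_nonzero[OF x(1)] by (simp add: x_def)
      ultimately have unit: "j \<bullet> coroot x = -1 \<or> j \<bullet> coroot x = 1" by blast
      have "root_refl j \<circ> g \<in> reflection_group R"
        using g jR by (intro reflection_group_comp reflection_group_refl) auto
      then obtain k k' :: int where k: "\<eta> j \<bullet> g (coroot l) = of_int (k * m)"
          "\<eta> j \<bullet> (root_refl j \<circ> g) (coroot l) = of_int (k' * m)"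
        using long_multiple[OF g(1) l] long_multiple[of "root_refl j \<circ> g", OF _ l] by blast
      have "g (coroot l) = coroot x"
        using coroot_orthogonal[OF reflection_group_orthogonal[OF g(1)], of l] by (simp add: x_def)
      then have "\<eta> j \<bullet> (root_refl j \<circ> g) (coroot l) = of_int (k * m) - j \<bullet> coroot x"
        using k(1) coroot_coefficient[OF \<open>j \<in> S\<close> \<open>j \<in> S\<close>]
        by (simp add: aff_refl_def inner_diff_right inner_commute)
      then have "real_of_int ((k - k') * m) = j \<bullet> coroot x" using k(2) by (simp add: algebra_simps)
      then have "(k - k') * m = 1 \<or> (k - k') * m = -1" using unit by (metis of_int_1 of_int_eq_iff of_int_minus)
      then show ?thesis by blast
    qed
    then have "m dvd 1" by (metis dvd_minus_iff dvd_triv_right)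
    then show ?thesis using comark_pos[of j] by (simp add: m_def)
  qed
  then show ?thesis using that j K_eq by blast
qed

section \<open>The Cartan integers of the affine nodes\<close>

text \<open>The sign makes the integers for distinct affine nodes nonnegative.\<close>

definition cartan :: "'v \<Rightarrow> 'v \<Rightarrow> int" where
  "cartan a b = - \<lfloor>a \<bullet> coroot b\<rfloor>"

lemma cartan: "a \<in> R \<Longrightarrow> b \<in> R \<Longrightarrow> of_int (cartan a b) = - (a \<bullet> coroot b)"
  using cartan_integral[of b a] by (auto simp: cartan_def elim: Ints_cases)

lemma inner_cartan: "a \<in> R \<Longrightarrow> b \<in> R \<Longrightarrow> of_int (cartan a b) * (b \<bullet> b) = - 2 * (a \<bullet> b)"
  using inner_coroot_commute[of a b] by (simp add: cartan)

lemma cartan_eq_0_iff: "a \<in> R \<Longrightarrow> b \<in> R \<Longrightarrow> cartan a b = 0 \<longleftrightarrow> a \<bullet> b = 0"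
  using inner_cartan[of a b] root_nonzero[of b] by auto

lemma node_obtuse: "a \<in> N \<Longrightarrow> b \<in> N \<Longrightarrow> a \<noteq> b \<Longrightarrow> a \<bullet> b \<le> 0"
  using simple_obtuse highest_root_dominant by (auto simp: nodes_eq inner_commute)

lemma cartan_nonneg: "a \<in> N \<Longrightarrow> b \<in> N \<Longrightarrow> a \<noteq> b \<Longrightarrow> cartan a b \<ge> 0"
proof -
  assume *: "a \<in> N" "b \<in> N" "a \<noteq> b"
  then have "of_int (cartan a b) * (b \<bullet> b) \<ge> 0"
    using inner_cartan[of a b] node_obtuse[of a b] node_root by simp
  moreover have "b \<bullet> b > 0" using root_nonzero[OF node_root[OF *(2)]] by simp
  ultimately have "real_of_int (cartan a b) \<ge> 0" using zero_le_mult_iff[of "real_of_int (cartan a b)" "b \<bullet> b"] by linarith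
  then show ?thesis by simp
qed

lemma comark_balance:
  assumes a: "a \<in> N"
  shows "2 * comark a = (\<Sum>b\<in>N - {a}. comark b * cartan a b)"
proof -
  have "0 = a \<bullet> (\<Sum>b\<in>N. of_int (comark b) *\<^sub>R coroot b)" by (simp add: comark_relation)
  also have "\<dots> = of_int (comark a) * (a \<bullet> coroot a) + (\<Sum>b\<in>N - {a}. of_int (comark b) * (a \<bullet> coroot b))"
    unfolding inner_sum_right inner_scaleR_right by (rule sum.remove[OF finite_nodes a])
  also have "(\<Sum>b\<in>N - {a}. of_int (comark b) * (a \<bullet> coroot b)) =
      - of_int (\<Sum>b\<in>N - {a}. comark b * cartan a b)"
    unfolding of_int_sum of_int_mult sum_negf[symmetric]
    using a node_root by (intro sum.cong) (auto simp: cartan)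
  finally have "real_of_int (2 * comark a) = of_int (\<Sum>b\<in>N - {a}. comark b * cartan a b)"
    using coroot_inner_self[OF root_nonzero[OF node_root[OF a]]] by simp
  then show ?thesis by (simp only: of_int_eq_iff)
qed

text \<open>
  If \<open>\<theta>\<close> were simple, all other simple roots would have comark 0. The case \<open>\<theta> \<in> S\<close> has to be excluded
  because then the nodes \<open>\<theta>\<close> and \<open>- \<theta>\<close> would be parallel.
\<close>

lemma highest_root_not_simple_if_short:
  assumes "b \<in> S" "\<not> long b" shows "\<theta> \<notin> S"
proof
  assume "\<theta> \<in> S"
  then have "real_of_int (comark b) = 0"
    using assms comark_simple[OF assms(1)] coroot_coefficient[OF assms(1)] by auto
  then show False using comark_pos[of b] by simp
qed

end

section \<open>Labelled diagrams with a short node\<close>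

lemma mult_ge_factors:
  fixes x y :: int
  assumes "x \<ge> 1" "y \<ge> 1" shows "x \<le> x * y" "y \<le> x * y"
  using assms by (simp_all add: mult_le_cancel_left1 mult_le_cancel_right1)

text \<open>
  The distance from \<open>x\<close> to \<open>Q\<close> is attained by a path, and a repetition on it or an earlier visit to \<open>Q\<close>
  would allow a shorter one.
\<close>

lemma shortest_path:
  assumes conn: "\<forall>X'. X' \<subseteq> X \<longrightarrow> X' \<noteq> {} \<longrightarrow> (\<forall>a\<in>X'. \<forall>b\<in>X - X'. \<not> adj a b) \<longrightarrow> X' = X"
    and xy: "x \<in> X" "y \<in> X" "Q y"
  obtains n f where "f 0 = x" "Q (f n)" "\<And>k. k < n \<Longrightarrow> \<not> Q (f k)"
    "\<And>k. k < n \<Longrightarrow> adj (f k) (f (Suc k))" "\<And>k. k \<le> n \<Longrightarrow> f k \<in> X" "inj_on f {..n}"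
proof -
  define r where "r = {(a, b). a \<in> X \<and> b \<in> X \<and> adj a b}"
  have "{z\<in>X. (x, z) \<in> r\<^sup>*} = X"
  proof (rule conn[rule_format])
    fix a b assume a: "a \<in> {z\<in>X. (x, z) \<in> r\<^sup>*}" and b: "b \<in> X - {z\<in>X. (x, z) \<in> r\<^sup>*}"
    show "\<not> adj a b"
    proof
      assume "adj a b"
      then have "(a, b) \<in> r" using a b by (simp add: r_def)
      moreover have "(x, a) \<in> r\<^sup>*" using a by simp
      ultimately have "(x, b) \<in> r\<^sup>*" by (rule rtrancl.rtrancl_into_rtrancl[rotated])
      then show False using b by simp
    qed
  next
    have "x \<in> {z\<in>X. (x, z) \<in> r\<^sup>*}" using xy by simp
    then show "{z\<in>X. (x, z) \<in> r\<^sup>*} \<noteq> {}" by blast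
  qed simp
  then have "y \<in> {z\<in>X. (x, z) \<in> r\<^sup>*}" using xy by simp
  then have "(x, y) \<in> r\<^sup>*" by simp
  then have ex: "\<exists>n. \<exists>z\<in>X. Q z \<and> (x, z) \<in> r ^^ n" using xy rtrancl_imp_relpow by blast
  define n where "n = (LEAST n. \<exists>z\<in>X. Q z \<and> (x, z) \<in> r ^^ n)"
  obtain z where z: "z \<in> X" "Q z" "(x, z) \<in> r ^^ n"
    using LeastI_ex[OF ex] unfolding n_def by blast
  have least: "\<not> (z \<in> X \<and> Q z \<and> (x, z) \<in> r ^^ k)" if "k < n" for k z
    using not_less_Least[of k] that unfolding n_def by blast
  obtain f where f: "f 0 = x" "f n = z" "\<forall>i<n. (f i, f (Suc i)) \<in> r"
    using z(3) relpow_fun_conv[of x z n r] by auto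
  have fX: "f k \<in> X" if "k \<le> n" for k
  proof (cases k)
    case 0
    then show ?thesis using f xy by simp
  next
    case (Suc i)
    then show ?thesis using f(3) that unfolding r_def by auto
  qed
  have part: "(f i, f (i + k)) \<in> r ^^ k" if "i + k \<le> n" for i k
    unfolding relpow_fun_conv using f(3) that by (intro exI[of _ "\<lambda>j. f (i + j)"]) auto
  have "\<not> Q (f k)" if "k < n" for k
    using least[OF that, of "f k"] part[of 0 k] fX[of k] f(1) that by auto
  moreover have "inj_on f {..n}"
  proof (rule linorder_inj_onI)
    fix i j assume ij: "i < j" "i \<in> {..n}" "j \<in> {..n}"
    show "f i \<noteq> f j"
    proof
      assume eq: "f i = f j"
      have "(x, f i) \<in> r ^^ i" "(f j, z) \<in> r ^^ (n - j)"
        using part[of 0 i] part[of j "n - j"] f ij by auto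
      then have "(x, z) \<in> r ^^ (i + (n - j))"
        unfolding relpow_add using eq by auto
      moreover have "i + (n - j) < n" using ij by auto
      ultimately show False using least[of "i + (n - j)" z] z by blast
    qed
  qed auto
  ultimately show ?thesis using that[of f n] f z fX by (auto simp: r_def)
qed

text \<open>
  The affine nodes of an irreducible root system, with \<open>t\<close> the lowest root, \<open>m\<close> the comarks and
  \<open>c a b\<close> the negated Cartan integers. The balance equation expresses that the coroots of the
  nodes, weighted by \<open>m\<close>, add up to zero. The last two conditions reflect that the shorter of two
  nonproportional roots has Cartan integer 0, 1 or -1 with the longer one.
\<close>

locale labelled_diagram =
  fixes N :: "'a set" and t :: 'a and m :: "'a \<Rightarrow> int" and c :: "'a \<Rightarrow> 'a \<Rightarrow> int" and long :: "'a \<Rightarrow> bool"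
  assumes finite_N: "finite N" and t: "t \<in> N" "m t = 1" "long t"
    and m_pos: "a \<in> N \<Longrightarrow> m a \<ge> 1"
    and c_nonneg: "a \<in> N \<Longrightarrow> b \<in> N \<Longrightarrow> a \<noteq> b \<Longrightarrow> c a b \<ge> 0"
    and c_zero: "a \<in> N \<Longrightarrow> b \<in> N \<Longrightarrow> c a b = 0 \<Longrightarrow> c b a = 0"
    and balance: "a \<in> N \<Longrightarrow> 2 * m a = (\<Sum>b\<in>N - {a}. m b * c a b)"
    and connected: "X \<subseteq> N - {t} \<Longrightarrow> X \<noteq> {} \<Longrightarrow>
      (\<And>a b. a \<in> X \<Longrightarrow> b \<in> N - {t} - X \<Longrightarrow> c a b = 0) \<Longrightarrow> X = N - {t}"
    and long_exists: "\<exists>l\<in>N - {t}. long l"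
    and long_long: "a \<in> N \<Longrightarrow> b \<in> N \<Longrightarrow> a \<noteq> b \<Longrightarrow> long a \<Longrightarrow> long b \<Longrightarrow> c a b \<le> 1"
    and long_short: "a \<in> N \<Longrightarrow> b \<in> N \<Longrightarrow> long a \<Longrightarrow> \<not> long b \<Longrightarrow> c a b \<noteq> 0 \<Longrightarrow> c b a = 1 \<and> c a b \<ge> 2"
begin

lemma term_nonneg: "a \<in> N \<Longrightarrow> b \<in> N \<Longrightarrow> a \<noteq> b \<Longrightarrow> m b * c a b \<ge> 0"
  using m_pos[of b] c_nonneg[of a b] by simp

lemma adjacent_sym: "a \<in> N \<Longrightarrow> b \<in> N \<Longrightarrow> c a b \<noteq> 0 \<Longrightarrow> c b a \<noteq> 0"
  using c_zero by blast

lemma adjacent_ge1: "a \<in> N \<Longrightarrow> b \<in> N \<Longrightarrow> a \<noteq> b \<Longrightarrow> c a b \<noteq> 0 \<Longrightarrow> c a b \<ge> 1"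
  using c_nonneg[of a b] by linarith

lemma balance_split:
  assumes "a \<in> N" "F \<subseteq> N - {a}"
  shows "2 * m a = (\<Sum>b\<in>F. m b * c a b) + (\<Sum>b\<in>N - {a} - F. m b * c a b)"
  using balance[OF assms(1)] sum.subset_diff[OF assms(2), of "\<lambda>b. m b * c a b"] finite_N by simp

lemma balance_ge:
  assumes "a \<in> N" "F \<subseteq> N - {a}"
  shows "(\<Sum>b\<in>F. m b * c a b) \<le> 2 * m a"
proof -
  have "(\<Sum>b\<in>N - {a} - F. m b * c a b) \<ge> 0"
    using assms(1) by (intro sum_nonneg term_nonneg) auto
  then show ?thesis using balance_split[OF assms] by linarith
qed

text \<open>
  All terms of the balance equation are nonnegative, so that those over \<open>F\<close> leave nothing for other nodes.
\<close>

lemma balance_saturated: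
  assumes "a \<in> N" "F \<subseteq> N - {a}" "(\<Sum>b\<in>F. m b * c a b) = 2 * m a" "b \<in> N" "b \<noteq> a" "c a b \<noteq> 0"
  shows "b \<in> F"
proof (rule ccontr)
  assume "b \<notin> F"
  have "(\<Sum>b\<in>N - {a} - F. m b * c a b) = 0" using balance_split[OF assms(1,2)] assms(3) by simp
  then have "\<forall>b\<in>N - {a} - F. m b * c a b = 0"
    using term_nonneg assms(1) finite_N by (subst (asm) sum_nonneg_eq_0_iff) auto
  then have "m b * c a b = 0" using \<open>b \<notin> F\<close> assms(4,5) by blast
  then show False using assms(6) m_pos[OF assms(4)] by simp
qed

text \<open>A remainder of 1 is a single term, a product of two positive integers equal to 1.\<close>

lemma balance_one_left:
  assumes a: "a \<in> N" and F: "F \<subseteq> N - {a}" and sum: "(\<Sum>b\<in>F. m b * c a b) = 2 * m a - 1"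
  obtains z where "z \<in> N" "z \<noteq> a" "z \<notin> F" "m z = 1" "c a z = 1"
    "\<And>b. b \<in> N \<Longrightarrow> b \<noteq> a \<Longrightarrow> c a b \<noteq> 0 \<Longrightarrow> b \<in> insert z F"
proof -
  have one: "(\<Sum>b\<in>N - {a} - F. m b * c a b) = 1" using balance_split[OF a F] sum by simp
  then obtain z where z: "z \<in> N - {a} - F" "m z * c a z \<noteq> 0"
    using sum.neutral[of "N - {a} - F" "\<lambda>b. m b * c a b"] by fastforce
  have "F \<union> {z} \<subseteq> N - {a}" using F z by blast
  moreover have *: "(\<Sum>b\<in>insert z F. m b * c a b) = m z * c a z + 2 * m a - 1"
    using z(1) sum finite_subset[OF F] finite_N by simp
  ultimately have "m z * c a z \<le> 1" using balance_ge[OF a, of "insert z F"] by simp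
  then have mc: "m z * c a z = 1" proof -
    have "m z * c a z \<ge> 0" using a z(1) by (intro term_nonneg) auto
    then show ?thesis using z(2) \<open>m z * c a z \<le> 1\<close> by linarith
  qed
  have "m z = 1" "c a z = 1"
    using mc m_pos[of z] c_nonneg[OF a, of z] z(1) by (auto simp: zmult_eq_1_iff)
  moreover have "(\<Sum>b\<in>insert z F. m b * c a b) = 2 * m a" using * mc by simp
  then have "b \<in> insert z F" if "b \<in> N" "b \<noteq> a" "c a b \<noteq> 0" for b
    using balance_saturated[OF a, of "insert z F"] F z(1) that by blast
  ultimately show ?thesis using that[of z] z(1) by blast
qed

text \<open>
  The balance equation at \<open>t\<close> gives \<open>t\<close> a neighbour, and the other nodes are connected.
\<close>

lemma connected_all:
  assumes X: "X \<subseteq> N" "X \<noteq> {}" and closed: "\<And>a b. a \<in> X \<Longrightarrow> b \<in> N - X \<Longrightarrow> c a b = 0"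
  shows "X = N"
proof -
  have "\<exists>b\<in>N - {t}. c t b \<noteq> 0"
  proof (rule ccontr)
    assume "\<not> ?thesis"
    then have "(\<Sum>b\<in>N - {t}. m b * c t b) = 0" by simp
    then show False using balance[OF t(1)] t(2) by simp
  qed
  then obtain i where i: "i \<in> N" "i \<noteq> t" "c t i \<noteq> 0" by blast
  have "X \<noteq> {t}" using closed[of t i] i by blast
  then have "X - {t} \<noteq> {}" using X(2) by blast
  then have "X - {t} = N - {t}"
    using closed X(1) by (intro connected) blast+
  moreover have "t \<in> X"
  proof (rule ccontr)
    assume "t \<notin> X"
    then have "c i t = 0" using closed[of i t] i t(1) \<open>X - {t} = N - {t}\<close> by blast
    then show False using c_zero i t(1) by blast
  qed
  ultimately show ?thesis using t(1) by blast
qed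

lemma long_adjacent:
  assumes "a \<in> N" "b \<in> N" "a \<noteq> b" "long a" "long b" "c a b \<noteq> 0"
  shows "c a b = 1" "c b a = 1"
proof -
  show "c a b = 1" using assms adjacent_ge1[of a b] long_long[of a b] by force
  show "c b a = 1" using assms adjacent_sym[of a b] adjacent_ge1[of b a] long_long[of b a] by force
qed

text \<open>
  The Dynkin diagrams of types B and C: \<open>p = 2\<close> and \<open>q = 1\<close> for type B, where the last node is short, and
  \<open>p = 1\<close> and \<open>q = 2\<close> for type C, where it is long.
\<close>

definition chain :: "nat \<Rightarrow> (nat \<Rightarrow> 'a) \<Rightarrow> int \<Rightarrow> int \<Rightarrow> bool" where
  "chain n \<alpha> p q \<longleftrightarrow> bij_betw \<alpha> {1..n} (N - {t}) \<and>
     (\<forall>i\<in>{1..n}. \<forall>j\<in>{1..n}. Suc i < j \<longrightarrow> c (\<alpha> i) (\<alpha> j) = 0) \<and>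
     (\<forall>i. 1 \<le> i \<and> Suc i < n \<longrightarrow> c (\<alpha> i) (\<alpha> (Suc i)) = 1 \<and> c (\<alpha> (Suc i)) (\<alpha> i) = 1) \<and>
     c (\<alpha> (n - 1)) (\<alpha> n) = p \<and> c (\<alpha> n) (\<alpha> (n - 1)) = q"

text \<open>
  Nodes without neighbours outside the chain exhaust the connected set \<open>N - {t}\<close>.
\<close>

lemma chainI:
  assumes inj: "inj_on \<alpha> {1..n}" and n: "n \<ge> 1" and range: "\<And>i. i \<in> {1..n} \<Longrightarrow> \<alpha> i \<in> N - {t}"
    and nbr: "\<And>i b. i \<in> {1..n} \<Longrightarrow> b \<in> N - {t} \<Longrightarrow> b \<noteq> \<alpha> i \<Longrightarrow> c (\<alpha> i) b \<noteq> 0 \<Longrightarrow>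
      i \<ge> 2 \<and> b = \<alpha> (i - 1) \<or> i < n \<and> b = \<alpha> (Suc i)"
    and mid: "\<And>i. 1 \<le> i \<Longrightarrow> Suc i < n \<Longrightarrow> c (\<alpha> i) (\<alpha> (Suc i)) = 1 \<and> c (\<alpha> (Suc i)) (\<alpha> i) = 1"
    and last: "c (\<alpha> (n - 1)) (\<alpha> n) = p" "c (\<alpha> n) (\<alpha> (n - 1)) = q"
  shows "chain n \<alpha> p q"
proof -
  have "\<alpha> ` {1..n} = N - {t}"
  proof (rule connected)
    fix a b assume "a \<in> \<alpha> ` {1..n}" and b: "b \<in> N - {t} - \<alpha> ` {1..n}"
    then obtain i where i: "i \<in> {1..n}" "a = \<alpha> i" by blast
    have "b \<noteq> \<alpha> k" if "k \<in> {1..n}" for k using b that by blast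
    moreover have "i \<ge> 2 \<Longrightarrow> i - 1 \<in> {1..n}" "i < n \<Longrightarrow> Suc i \<in> {1..n}"
      using i(1) unfolding atLeastAtMost_iff by arith+
    ultimately have "b \<noteq> \<alpha> i" "i \<ge> 2 \<Longrightarrow> b \<noteq> \<alpha> (i - 1)" "i < n \<Longrightarrow> b \<noteq> \<alpha> (Suc i)"
      using i(1) by blast+
    then show "c a b = 0" using nbr[OF i(1), of b] b i(2) by blast
  next
    show "\<alpha> ` {1..n} \<subseteq> N - {t}" using range by blast
    show "\<alpha> ` {1..n} \<noteq> {}" using n by simp
  qed
  moreover have "c (\<alpha> i) (\<alpha> j) = 0" if ij: "i \<in> {1..n}" "j \<in> {1..n}" "Suc i < j" for i j
  proof (rule ccontr)
    have ne: "\<alpha> j \<noteq> \<alpha> k" if "k \<in> {1..n}" "k \<noteq> j" for k using inj_onD[OF inj] ij that by blast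
    assume "c (\<alpha> i) (\<alpha> j) \<noteq> 0"
    moreover have "i \<ge> 2 \<Longrightarrow> i - 1 \<in> {1..n} \<and> i - 1 \<noteq> j" "Suc i \<in> {1..n} \<and> Suc i \<noteq> j" "i \<noteq> j"
      using ij unfolding atLeastAtMost_iff by arith+
    ultimately show False using nbr[OF ij(1) range[OF ij(2)]] ne ij(1) by metis
  qed
  ultimately show ?thesis
    unfolding chain_def bij_betw_def using inj mid last by blast
qed

text \<open>
  If \<open>t\<close> has a short neighbour, then the labels stay 1 along the way from this neighbour to the next
  long node: each balance equation is exhausted by the two neighbours on the path.
\<close>

lemma classify_short_neighbour:
  assumes y: "y \<in> N" "\<not> long y" "c t y \<noteq> 0"
  obtains n \<alpha> where "n \<ge> 2" "chain n \<alpha> 1 2" "\<And>i. i \<in> {1..n} \<Longrightarrow> long (\<alpha> i) \<longleftrightarrow> i = n"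
proof -
  have yt: "y \<noteq> t" using y t(3) by blast
  have cy: "c y t = 1" "c t y \<ge> 2" using long_short[OF t(1) y(1) t(3) y(2,3)] by auto
  have "m y * c t y \<le> 2" using balance_ge[OF t(1), of "{y}"] y(1) yt t(2) by simp
  moreover have "m y * c t y \<ge> m y * 2" using cy(2) m_pos[OF y(1)] by (intro mult_left_mono) auto
  ultimately have my1: "m y = 1" using m_pos[OF y(1)] by linarith
  with \<open>m y * c t y \<le> 2\<close> cy(2) have my: "m y = 1" "c t y = 2" by auto
  obtain l where l: "l \<in> N - {t}" "long l" using long_exists by blast
  have conn: "\<forall>X'. X' \<subseteq> N - {t} \<longrightarrow> X' \<noteq> {} \<longrightarrow>
      (\<forall>a\<in>X'. \<forall>b\<in>N - {t} - X'. \<not> c a b \<noteq> 0) \<longrightarrow> X' = N - {t}"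
    using connected by blast
  obtain q g where g: "g 0 = y" "long (g q)" "\<And>k. k < q \<Longrightarrow> \<not> long (g k)"
    "\<And>k. k < q \<Longrightarrow> c (g k) (g (Suc k)) \<noteq> 0" "\<And>k. k \<le> q \<Longrightarrow> g k \<in> N - {t}" "inj_on g {..q}"
    using shortest_path[OF conn _ l(1), where x = y and Q = long] y(1) yt l(2) by blast
  have q: "q \<ge> 1" using g(1,2) y(2) by (cases q) auto
  have g_ne: "g i \<noteq> g j" if "i \<le> q" "j \<le> q" "i \<noteq> j" for i j
    using inj_onD[OF g(6)] that by auto
  \<comment> \<open>The path is preceded by \<open>t\<close>.\<close>
  define pred where "pred k = (case k of 0 \<Rightarrow> t | Suc i \<Rightarrow> g i)" for k
  have step: "c (g k) (pred k) = 1 \<and> c (g k) (g (Suc k)) = 1 \<and> m (g (Suc k)) = 1 \<and> 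
      (\<forall>b\<in>N. b \<noteq> g k \<longrightarrow> c (g k) b \<noteq> 0 \<longrightarrow> b = pred k \<or> b = g (Suc k))" if "k < q" for k
    using that
  proof (induction k)
    case 0
    have N: "g 0 \<in> N" "g (Suc 0) \<in> N" "g (Suc 0) \<noteq> g 0" "g (Suc 0) \<noteq> t"
      using g(5)[of 0] g(5)[of "Suc 0"] g_ne[of "Suc 0" 0] 0 by auto
    have F: "{t, g (Suc 0)} \<subseteq> N - {g 0}" using N t(1) g(1) yt by auto
    have "m (g (Suc 0)) * c (g 0) (g (Suc 0)) \<le> 1"
      using balance_ge[OF N(1) F] N(4) g(1) cy my t(2) by simp
    moreover have pos: "m (g (Suc 0)) \<ge> 1" "c (g 0) (g (Suc 0)) \<ge> 1"
      using m_pos N g(4)[OF 0] adjacent_ge1[OF N(1,2)] by auto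
    ultimately have *: "m (g (Suc 0)) = 1" "c (g 0) (g (Suc 0)) = 1"
      using mult_ge_factors[OF pos] by linarith+
    have "(\<Sum>b\<in>{t, g (Suc 0)}. m b * c (g 0) b) = 2 * m (g 0)"
      using N(4) * g(1) cy my t(2) by simp
    then have "\<forall>b\<in>N. b \<noteq> g 0 \<longrightarrow> c (g 0) b \<noteq> 0 \<longrightarrow> b = t \<or> b = g (Suc 0)"
      using balance_saturated[OF N(1) F] by blast
    then show ?case using * g(1) cy by (simp add: pred_def)
  next
    case (Suc k)
    then have IH: "c (g k) (g (Suc k)) = 1" "m (g (Suc k)) = 1" by auto
    let ?a = "g (Suc k)" and ?b = "g (Suc (Suc k))"
    have N: "g k \<in> N" "?a \<in> N" "?b \<in> N" "?b \<noteq> ?a" "?b \<noteq> g k" "g k \<noteq> ?a"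
      using g(5)[of k] g(5)[of "Suc k"] g(5)[of "Suc (Suc k)"] g_ne[of _ _] Suc.prems by auto
    have F: "{g k, ?b} \<subseteq> N - {?a}" using N by auto
    have "m (g k) * c ?a (g k) + m ?b * c ?a ?b \<le> 2"
      using balance_ge[OF N(2) F] N(5) IH by simp
    moreover have pos: "m (g k) \<ge> 1" "c ?a (g k) \<ge> 1" "m ?b \<ge> 1" "c ?a ?b \<ge> 1"
      using m_pos N g(4)[OF Suc.prems] adjacent_ge1[OF N(2,3)] adjacent_ge1[OF N(2,1)]
        adjacent_sym[OF N(1,2)] IH by auto
    moreover have "m (g k) * c ?a (g k) \<ge> m (g k)" "m (g k) * c ?a (g k) \<ge> c ?a (g k)"
      "m ?b * c ?a ?b \<ge> m ?b" "m ?b * c ?a ?b \<ge> c ?a ?b"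
      using pos by (simp_all add: mult_ge_factors)
    ultimately have *: "c ?a (g k) = 1" "m (g k) = 1" "m ?b = 1" "c ?a ?b = 1" by linarith+
    have "(\<Sum>b\<in>{g k, ?b}. m b * c ?a b) = 2 * m ?a"
      using N(5) * IH by simp
    then have "\<forall>b\<in>N. b \<noteq> ?a \<longrightarrow> c ?a b \<noteq> 0 \<longrightarrow> b = g k \<or> b = ?b"
      using balance_saturated[OF N(2) F] by blast
    then show ?case using * by (simp add: pred_def)
  qed
  obtain q' where q': "q = Suc q'" using q by (cases q) auto
  have N: "g q \<in> N" "g q' \<in> N" "g q \<noteq> g q'"
    using g(5)[of q] g(5)[of q'] g_ne[of q q'] q' by auto
  have "c (g q') (g q) \<noteq> 0" using g(4)[of q'] q' by simp
  then have last_bond: "c (g q) (g q') \<ge> 2"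
    using long_short[OF N(1,2) g(2)] g(3)[of q'] q' adjacent_sym[OF N(2,1)] by auto
  have mq: "m (g q) = 1" using step[of q'] q' by simp
  have mq': "m (g q') = 1" using step[of "q' - 1"] q' my(1) g(1) by (cases q') auto
  have "c (g q) (g q') \<le> 2" using balance_ge[OF N(1), of "{g q'}"] N mq mq' by simp
  then have bond: "c (g q) (g q') = 2" using last_bond by simp
  have q_nbr: "b = g q'" if "b \<in> N" "b \<noteq> g q" "c (g q) b \<noteq> 0" for b
    using balance_saturated[OF N(1), of "{g q'}" b] N mq mq' bond that by auto
  define \<alpha> where "\<alpha> i = g (i - 1)" for i
  show ?thesis
  proof (rule that)
    show "Suc q \<ge> 2" using q by simp
    show "chain (Suc q) \<alpha> 1 2"
    proof (rule chainI)
      show "inj_on \<alpha> {1..Suc q}"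
        unfolding \<alpha>_def by (rule inj_onI, rule ccontr) (use g_ne in fastforce)
      show "\<alpha> i \<in> N - {t}" if "i \<in> {1..Suc q}" for i
        unfolding \<alpha>_def using that by (intro g(5)) auto
      fix i b assume i: "i \<in> {1..Suc q}" and b: "b \<in> N - {t}" "b \<noteq> \<alpha> i" "c (\<alpha> i) b \<noteq> 0"
      show "i \<ge> 2 \<and> b = \<alpha> (i - 1) \<or> i < Suc q \<and> b = \<alpha> (Suc i)"
      proof (cases "i = Suc q")
        case True
        then show ?thesis using q_nbr[of b] b q' by (auto simp: \<alpha>_def)
      next
        case False
        then obtain k where k: "i = Suc k" "k < q" using i by (cases i) auto
        then have "b = pred k \<or> b = g (Suc k)" using step[of k] b by (auto simp: \<alpha>_def)
        then show ?thesis using b(1) k by (cases k) (auto simp: pred_def \<alpha>_def)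
      qed
    next
      fix i assume i: "1 \<le> i" "Suc i < Suc q"
      then obtain k where k: "i = Suc k" by (cases i) auto
      then show "c (\<alpha> i) (\<alpha> (Suc i)) = 1 \<and> c (\<alpha> (Suc i)) (\<alpha> i) = 1"
        using step[of k] step[of "Suc k"] i by (auto simp: \<alpha>_def pred_def)
    qed (use bond step[of q'] q' in \<open>auto simp: \<alpha>_def\<close>)
    show "long (\<alpha> i) \<longleftrightarrow> i = Suc q" if "i \<in> {1..Suc q}" for i
    proof (cases "i = Suc q")
      case False
      then have "\<not> long (g (i - 1))" using that by (intro g(3)) auto
      then show ?thesis using False by (simp add: \<alpha>_def)
    qed (use g(2) in \<open>simp add: \<alpha>_def\<close>)
  qed
qed

text \<open>
  If \<open>t\<close> has no short neighbour, the labels along a shortest path \<open>t = f 0, f 1, \<dots>, f n\<close> to a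
  short node form a concave sequence, whose first increment is at most 1 and whose last increment
  before the multiple bond is nonnegative. Hence all increments are 0 or 1. Each balance equation
  leaves room for at most one further neighbour, of label 1, and such a neighbour needs a node of
  label at most 2; this leaves few possibilities.
\<close>

lemma classify_long_neighbour:
  assumes y: "y \<in> N" "\<not> long y" and t_nbr: "\<forall>y\<in>N. \<not> long y \<longrightarrow> c t y = 0"
  shows "(\<exists>n \<alpha>. n \<ge> 3 \<and> chain n \<alpha> 2 1 \<and> (\<forall>i\<in>{1..n}. long (\<alpha> i) \<longleftrightarrow> i \<noteq> n)) \<or>
    (\<exists>x1 x2 x3 x4. distinct [x1, x2, x3, x4] \<and> N - {t} = {x1, x2, x3, x4} \<and>
       long x1 \<and> long x2 \<and> \<not> long x3 \<and> \<not> long x4 \<and> m x3 = 2 \<and>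
       c x1 x2 = 1 \<and> c x2 x3 = 2 \<and> c x3 x4 = 1 \<and> c x4 x3 = 1 \<and> c x1 x3 = 0 \<and> c x1 x4 = 0 \<and> c x2 x4 = 0) \<or>
    (\<exists>x1 x2. x1 \<noteq> x2 \<and> N - {t} = {x1, x2} \<and> long x1 \<and> \<not> long x2 \<and> c x1 x2 = 3 \<and> c x2 x1 = 1)"
    (is "?B \<or> ?F \<or> ?G")
proof -
  have conn: "\<forall>X'. X' \<subseteq> N \<longrightarrow> X' \<noteq> {} \<longrightarrow> (\<forall>a\<in>X'. \<forall>b\<in>N - X'. \<not> c a b \<noteq> 0) \<longrightarrow> X' = N"
    using connected_all by blast
  obtain n f where f: "f 0 = t" "\<not> long (f n)" "\<And>k. k < n \<Longrightarrow> \<not> \<not> long (f k)"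
    "\<And>k. k < n \<Longrightarrow> c (f k) (f (Suc k)) \<noteq> 0" "\<And>k. k \<le> n \<Longrightarrow> f k \<in> N" "inj_on f {..n}"
    using shortest_path[OF conn t(1) y(1), where Q = "\<lambda>a. \<not> long a"] y(2) by blast
  have flong: "long (f k)" if "k < n" for k using f(3)[OF that] by blast
  have f_ne: "f i \<noteq> f j" if "i \<le> n" "j \<le> n" "i \<noteq> j" for i j
    using inj_onD[OF f(6)] that by auto
  have n2: "n \<ge> 2"
  proof (rule ccontr)
    assume "\<not> n \<ge> 2"
    moreover have "n \<noteq> 0" using f(1,2) t(3) by (metis)
    ultimately have "n = 1" by simp
    then show False using f(1,2) f(4)[of 0] f(5)[of 1] t_nbr by auto
  qed
  then obtain n' where n': "n = Suc (Suc n')" by (metis add_2_eq_Suc le_Suc_ex)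
  \<comment> \<open>\<open>r\<close> is the multiplicity of the bond at which the path reaches the short node.\<close>
  define L where "L k = m (f k)" for k
  define r where "r = c (f (Suc n')) (f n)"
  have Lpos: "L k \<ge> 1" if "k \<le> n" for k using m_pos f(5) that by (simp add: L_def)
  have L0: "L 0 = 1" using f(1) t(2) by (simp add: L_def)
  have bond: "c (f k) (f (Suc k)) = 1" "c (f (Suc k)) (f k) = 1" if "k \<le> n'" for k
    using long_adjacent[of "f k" "f (Suc k)"] f(4,5) flong f_ne that n' by auto
  have last: "c (f n) (f (Suc n')) = 1" "r \<ge> 2"
    using long_short[of "f (Suc n')" "f n"] f(2,5) f(4)[of "Suc n'"] flong[of "Suc n'"] n' unfolding r_def by auto
  have sum2: "(\<Sum>b\<in>{f k, f (Suc (Suc k))}. m b * c (f (Suc k)) b) =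
      L k + (if k = n' then r * L n else L (Suc (Suc k)))" if "k \<le> n'" for k
  proof -
    have "f k \<noteq> f (Suc (Suc k))" using f_ne that n' by auto
    moreover have "c (f (Suc k)) (f (Suc (Suc k))) = (if k = n' then r else 1)"
      using bond(1)[of "Suc k"] that n' by (auto simp: r_def)
    ultimately show ?thesis using bond(2)[OF that] n' by (simp add: L_def)
  qed
  have F2: "f (Suc k) \<in> N" "{f k, f (Suc (Suc k))} \<subseteq> N - {f (Suc k)}" if "k \<le> n'" for k
    using f(5)[of k] f(5)[of "Suc k"] f(5)[of "Suc (Suc k)"] f_ne[of k "Suc k"] f_ne[of "Suc (Suc k)" "Suc k"]
      that n' by auto
  have concave: "L (Suc (Suc k)) - L (Suc k) \<le> L (Suc k) - L k" if "k < n'" for k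
    using balance_ge[OF F2[of k]] sum2[of k] that by (simp add: L_def)
  have end_ge: "L n' + r * L n \<le> 2 * L (Suc n')"
    using balance_ge[OF F2[of n']] sum2[of n'] by (simp add: L_def)
  have N_ends: "f 0 \<in> N" "{f 1} \<subseteq> N - {f 0}" "f n \<in> N" "{f (Suc n')} \<subseteq> N - {f n}"
    using f(5)[of 0] f(5)[of 1] f(5)[of n] f(5)[of "Suc n'"] f_ne[of 1 0] f_ne[of "Suc n'" n] n' by auto
  have L1: "L 1 \<le> 2"
    using balance_ge[OF N_ends(1,2)] bond(1)[of 0] L0 by (simp add: L_def)
  have Ln: "L (Suc n') \<le> 2 * L n"
    using balance_ge[OF N_ends(3,4)] last(1) by (simp add: L_def)
  have rLn: "r * L n \<ge> 2 * L n" using last(2) Lpos[of n] by (intro mult_right_mono) auto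
  have increment_ge: "L (Suc k) - L k \<ge> L (Suc n') - L n'" if "k \<le> n'" for k
    using that
  proof (induction rule: inc_induct)
    case (step k)
    then show ?case using concave[of k] by linarith
  qed simp
  have increment: "L (Suc k) - L k \<ge> 0" if "k \<le> n'" for k
    using increment_ge[OF that] end_ge rLn Ln by linarith
  have increment_le: "L (Suc k) - L k \<le> L (Suc j) - L j" if "j \<le> k" "k \<le> n'" for j k
    using that
  proof (induction rule: dec_induct)
    case (step k)
    then show ?case using concave[of k] by auto
  qed simp
  have L1: "L 1 = 2"
  proof (rule ccontr)
    assume "L 1 \<noteq> 2"
    then have "L 1 = 1" using L1 Lpos[of 1] n2 by linarith
    then have zero: "L (Suc k) = L k" if "k \<le> n'" for k
      using increment[OF that] increment_le[of 0 k] that L0 by auto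
    have "L k = 1" if "k \<le> Suc n'" for k
      using that by (induction k) (auto simp: L0 zero)
    then show False using end_ge rLn Lpos[of n] by (auto simp: n')
  qed
  have sat_mid: "b = f k \<or> b = f (Suc (Suc k))"
    if "k \<le> n'" "L k + (if k = n' then r * L n else L (Suc (Suc k))) = 2 * L (Suc k)"
      "b \<in> N" "b \<noteq> f (Suc k)" "c (f (Suc k)) b \<noteq> 0" for k b
    using balance_saturated[OF F2[OF that(1)] _ that(3-5)] sum2[OF that(1)] that(2) by (auto simp: L_def)
  have sat_end: "b = f (Suc n')" if "2 * L n = L (Suc n')" "b \<in> N" "b \<noteq> f n" "c (f n) b \<noteq> 0" for b
    using balance_saturated[OF N_ends(3,4) _ that(2-4)] last(1) that(1) by (simp add: L_def)
  \<comment> \<open>A leftover of 1 in a balance equation needs a label of at most 2, as the extra neighbour has label 1.\<close>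
  have extra: "c z a = 1 \<and> m a = 2 \<and> (\<forall>b\<in>N. b \<noteq> z \<longrightarrow> c z b \<noteq> 0 \<longrightarrow> b = a)"
    if z: "z \<in> N" "z \<noteq> a" "m z = 1" "c a z = 1" and a: "a \<in> N" "m a \<ge> 2" for a z
  proof -
    have az: "c z a \<ge> 1" using adjacent_ge1[of z a] adjacent_sym[of a z] z a by auto
    have "m a * c z a \<le> 2" using balance_ge[of z "{a}"] z a by simp
    moreover have "m a \<le> m a * c z a" using mult_ge_factors[of "m a" "c z a"] a az by simp
    ultimately have ma: "m a = 2" using a by linarith
    then have ca: "c z a = 1" using \<open>m a * c z a \<le> 2\<close> az by simp
    have "b = a" if "b \<in> N" "b \<noteq> z" "c z b \<noteq> 0" for b
      using balance_saturated[OF z(1), of "{a}" b] ma ca z(2,3) a(1) that by simp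
    then show ?thesis using ma ca by blast
  qed
  have extra_mid: False
    if k: "k \<le> n'" "L k + (if k = n' then r * L n else L (Suc (Suc k))) = 2 * L (Suc k) - 1"
      "L (Suc k) \<ge> 3" for k
  proof -
    obtain z where z: "z \<in> N" "z \<noteq> f (Suc k)" "m z = 1" "c (f (Suc k)) z = 1"
      using balance_one_left[OF F2[OF k(1)]] sum2[OF k(1)] k(2) by (auto simp: L_def)
    then have "m (f (Suc k)) = 2" using extra[OF z F2(1)[OF k(1)]] k(3) by (simp add: L_def)
    then show False using k(3) by (simp add: L_def)
  qed
  \<comment> \<open>Constant label 2 after \<open>t\<close>: the extra neighbour of \<open>f 1\<close> is the first simple root of type B.\<close>
  have B: ?B if flat: "\<And>k. 1 \<le> k \<Longrightarrow> k \<le> Suc n' \<Longrightarrow> L k = 2" and end1: "L n = 1" "r = 2"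
  proof -
    have slack: "L 0 + (if 0 = n' then r * L n else L (Suc (Suc 0))) = 2 * L (Suc 0) - 1"
      using L0 L1 flat[of 2] end1 by (auto simp: numeral_2_eq_2)
    obtain z where z: "z \<in> N" "z \<noteq> f 1" "z \<notin> {f 0, f (Suc (Suc 0))}" "m z = 1" "c (f 1) z = 1"
      "\<And>b. b \<in> N \<Longrightarrow> b \<noteq> f 1 \<Longrightarrow> c (f 1) b \<noteq> 0 \<Longrightarrow> b \<in> insert z {f 0, f (Suc (Suc 0))}"
      using balance_one_left[OF F2[of 0]] sum2[of 0] slack by (auto simp: L_def)
    have f1: "f 1 \<in> N" "long (f 1)" using f(5)[of 1] flong[of 1] n2 by auto
    have z_nbr: "c z (f 1) = 1" "\<And>b. b \<in> N \<Longrightarrow> b \<noteq> z \<Longrightarrow> c z b \<noteq> 0 \<Longrightarrow> b = f 1"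
      using extra[OF z(1,2,4,5) f1(1)] L1 by (auto simp: L_def)
    have z_long: "long z" using long_short[OF f1(1) z(1) f1(2)] z(5) by force
    have z_new: "z \<noteq> f k" if "k \<le> n" for k
    proof
      assume "z = f k"
      then have "k \<noteq> 0" "k \<noteq> n" using z(3) z_long f(2) by (metis insertI1)+
      then have "L k = 2" using flat[of k] that n' by auto
      then show False using z(4) \<open>z = f k\<close> by (simp add: L_def)
    qed
    have mid: "b = f k \<or> b = f (Suc (Suc k))"
      if "1 \<le> k" "k \<le> n'" "b \<in> N" "b \<noteq> f (Suc k)" "c (f (Suc k)) b \<noteq> 0" for k b
      using that flat[of k] flat[of "Suc k"] flat[of "Suc (Suc k)"] end1
      by (intro sat_mid) auto
    have fn: "b = f (Suc n')" if "b \<in> N" "b \<noteq> f n" "c (f n) b \<noteq> 0" for b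
      using sat_end flat[of "Suc n'"] end1 that by auto
    define \<alpha> where "\<alpha> i = (if i = 1 then z else f (i - 1))" for i :: nat
    have "chain (Suc n) \<alpha> 2 1"
    proof (rule chainI)
      show "inj_on \<alpha> {1..Suc n}"
      proof (rule inj_onI, rule ccontr)
        fix i j assume ij: "i \<in> {1..Suc n}" "j \<in> {1..Suc n}" "\<alpha> i = \<alpha> j" "i \<noteq> j"
        have "i - 1 \<le> n" "j - 1 \<le> n" using ij by auto
        then have "z \<noteq> f (i - 1)" "z \<noteq> f (j - 1)" "i - 1 \<noteq> j - 1 \<Longrightarrow> f (i - 1) \<noteq> f (j - 1)"
          using z_new f_ne by blast+
        moreover have "i - 1 = j - 1 \<Longrightarrow> i = 1 \<or> j = 1" using ij by auto
        ultimately show False using ij(3,4) by (auto simp: \<alpha>_def split: if_splits)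
      qed
      show "\<alpha> i \<in> N - {t}" if "i \<in> {1..Suc n}" for i
      proof (cases "i = 1")
        case False
        then have "i - 1 \<le> n" "i - 1 \<noteq> 0" using that by auto
        then show ?thesis using False f(1) f(5)[of "i - 1"] f_ne[of "i - 1" 0] by (simp add: \<alpha>_def)
      qed (use f(1) z(1,3) in \<open>simp add: \<alpha>_def\<close>)
      fix i b assume i: "i \<in> {1..Suc n}" and b: "b \<in> N - {t}" "b \<noteq> \<alpha> i" "c (\<alpha> i) b \<noteq> 0"
      consider "i = 1" | "i = 2" | "i = Suc n" "i \<noteq> 2" | "3 \<le> i" "i \<le> n" using i by fastforce
      then show "i \<ge> 2 \<and> b = \<alpha> (i - 1) \<or> i < Suc n \<and> b = \<alpha> (Suc i)"
      proof cases
        case 1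
        then show ?thesis using z_nbr(2)[of b] b n2 by (auto simp: \<alpha>_def)
      next
        case 2
        then show ?thesis using z(6)[of b] b f(1) n2 by (auto simp: \<alpha>_def numeral_2_eq_2)
      next
        case 3
        then show ?thesis using fn[of b] b n' by (auto simp: \<alpha>_def)
      next
        case 4
        define k where "k = i - 2"
        have "i = Suc (Suc k)" "1 \<le> k" "k \<le> n'" using 4 n' unfolding k_def by arith+
        then show ?thesis using mid[of k b] b n' by (auto simp: \<alpha>_def)
      qed
    next
      fix i assume i: "1 \<le> i" "Suc i < Suc n"
      show "c (\<alpha> i) (\<alpha> (Suc i)) = 1 \<and> c (\<alpha> (Suc i)) (\<alpha> i) = 1"
      proof (cases "i = 1")
        case True
        then show ?thesis using z(5) z_nbr(1) by (simp add: \<alpha>_def)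
      next
        case False
        then show ?thesis using bond[of "i - 1"] i n' by (simp add: \<alpha>_def)
      qed
    next
      show "c (\<alpha> (Suc n - 1)) (\<alpha> (Suc n)) = 2" "c (\<alpha> (Suc n)) (\<alpha> (Suc n - 1)) = 1"
        using last end1(2) n' by (auto simp: \<alpha>_def r_def)
    qed simp
    moreover have "\<forall>i\<in>{1..Suc n}. long (\<alpha> i) \<longleftrightarrow> i \<noteq> Suc n"
      using z_long flong f(2) n2 by (auto simp: \<alpha>_def)
    ultimately show ?B using n2 by (intro exI[of _ "Suc n"] exI[of _ \<alpha>]) auto
  qed
  show ?thesis
  proof (cases "n' = 0")
    case True
    then have n: "n = 2" using n' by simp
    have "r * L 2 \<le> 3" using end_ge L0 L1 True n by simp
    moreover have "2 * L 2 \<le> r * L 2" "L 2 \<ge> 1" using rLn Lpos[of 2] n by simp_all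
    ultimately have "L 2 = 1" by linarith
    then have "r = 2 \<or> r = 3" using \<open>r * L 2 \<le> 3\<close> last(2) by auto
    then show ?thesis
    proof (elim disjE)
      assume "r = 2"
      have "L k = 2" if "1 \<le> k" "k \<le> Suc n'" for k
        using that True L1 by (cases "k = 1") auto
      then show ?thesis using B \<open>L 2 = 1\<close> \<open>r = 2\<close> n by blast
    next
      assume r3: "r = 3"
      have f1: "f 1 \<in> N" "f 1 \<noteq> t" "f 2 \<in> N" "f 2 \<noteq> t" "f 1 \<noteq> f 2"
        using f(5)[of 1] f(5)[of 2] f_ne[of 1 0] f_ne[of 2 0] f_ne[of 1 2] f(1) n by auto
      have nbr1: "b = t \<or> b = f 2" if "b \<in> N" "b \<noteq> f 1" "c (f 1) b \<noteq> 0" for b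
        using sat_mid[of 0 b] that True r3 \<open>L 2 = 1\<close> L0 L1 n f(1) by (auto simp: numeral_2_eq_2)
      have nbr2: "b = f 1" if "b \<in> N" "b \<noteq> f 2" "c (f 2) b \<noteq> 0" for b
        using sat_end[of b] that True \<open>L 2 = 1\<close> L1 n by auto
      have "{f 1, f 2} = N - {t}"
        by (rule connected) (use nbr1 nbr2 f1 in blast)+
      then have "N - {t} = {f 1, f 2}" by simp
      moreover have "c (f 1) (f 2) = 3" "c (f 2) (f 1) = 1" "long (f 1)" "\<not> long (f 2)"
        using r3 last(1) flong[of 1] f(2) n True by (auto simp: r_def)
      ultimately have ?G using f1 by blast
      then show ?thesis by blast
    qed
  next
    case False
    then have n3: "n' \<ge> 1" "n \<ge> 3" using n' by auto
    have "L 2 \<le> 3" "L 2 \<ge> 2"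
      using concave[of 0] increment[of 1] n3 L0 L1 by (auto simp: numeral_2_eq_2)
    then consider "L 2 = 2" | "L 2 = 3" by linarith
    then show ?thesis
    proof cases
      case 1
      have zero: "L (Suc k) = L k" if "1 \<le> k" "k \<le> n'" for k
        using increment[of k] increment_le[of 1 k] that 1 L1 by (auto simp: numeral_2_eq_2)
      have flat: "L k = 2" if "1 \<le> k" "k \<le> Suc n'" for k
        using that by (induction k rule: dec_induct) (auto simp: L1[simplified] zero)
      have "L n' = 2" "L (Suc n') = 2" using flat[of n'] flat[of "Suc n'"] n3 by auto
      then have "r * L n \<le> 2" using end_ge by simp
      then have "L n = 1" using rLn Lpos[of n] by linarith
      then have "r = 2" using \<open>r * L n \<le> 2\<close> last(2) by simp
      then show ?thesis using B flat \<open>L n = 1\<close> by blast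
    next
      case 2
      \<comment> \<open>Once the increments stop, a node of label at least 3 would have an extra neighbour.\<close>
      have climb: "L k = int k + 1" if "k \<le> Suc n'" for k
        using that
      proof (induction k rule: less_induct)
        case (less k)
        consider "k = 0" | "k = 1" | "k = 2" | j where "k = Suc (Suc j)" "j \<ge> 1"
          by (metis One_nat_def Suc_1 gr0_conv_Suc less_one linorder_not_le not0_implies_Suc)
        then show ?case
        proof cases
          case 4
          then have IH: "L j = int j + 1" "L (Suc j) = int j + 2" and j: "j < n'"
            using less by auto
          have "L k - L (Suc j) \<le> 1" "L k - L (Suc j) \<ge> 0"
            using increment_le[of 0 "Suc j"] increment[of "Suc j"] L0 L1 4 j by auto
          moreover have "L k \<noteq> L (Suc j)"
            using extra_mid[of j] IH j 4 by auto
          ultimately show ?thesis using IH 4 by auto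
        qed (use L0 L1 2 in auto)
      qed
      have ends: "L n' = int n' + 1" "L (Suc n') = int n' + 2" using climb by auto
      have rLn': "r * L n \<le> int n' + 3" using end_ge ends by simp
      have r2: "r = 2"
      proof (rule ccontr)
        assume "r \<noteq> 2"
        then have "r * L n \<ge> 3 * L n" using last(2) Lpos[of n] by (intro mult_right_mono) auto
        then show False using rLn' Ln ends n3(1) by linarith
      qed
      then have "2 * L n = int n' + 2 \<or> 2 * L n = int n' + 3" using rLn' Ln ends by auto
      moreover have "2 * L n \<noteq> int n' + 2"
        using extra_mid[of n'] ends n3(1) r2 by auto
      ultimately have Ln3: "2 * L n = int n' + 3" by blast
      then obtain z where z: "z \<in> N" "z \<noteq> f n" "z \<notin> {f (Suc n')}" "m z = 1" "c (f n) z = 1"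
        "\<And>b. b \<in> N \<Longrightarrow> b \<noteq> f n \<Longrightarrow> c (f n) b \<noteq> 0 \<Longrightarrow> b \<in> insert z {f (Suc n')}"
        using balance_one_left[OF N_ends(3,4)] last(1) ends by (auto simp: L_def)
      have "m (f n) \<ge> 2" using Ln3 n3(1) by (simp add: L_def)
      note z_extra = extra[OF z(1,2,4,5) N_ends(3) this]
      then have "L n = 2" by (simp add: L_def)
      then have n: "n' = 1" "n = 3" using Ln3 n' by auto
      have fs: "f 1 \<in> N" "f 2 \<in> N" "f 3 \<in> N" "f 1 \<noteq> t" "f 2 \<noteq> t" "f 3 \<noteq> t"
        "f 1 \<noteq> f 2" "f 1 \<noteq> f 3" "f 2 \<noteq> f 3"
        using f(5) f_ne[of 1 0] f_ne[of 2 0] f_ne[of 3 0] f_ne[of 1 2] f_ne[of 1 3] f_ne[of 2 3] f(1) n by auto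
      have z_nbr: "c z (f 3) = 1" "\<And>b. b \<in> N \<Longrightarrow> b \<noteq> z \<Longrightarrow> c z b \<noteq> 0 \<Longrightarrow> b = f 3"
        using z_extra n by auto
      have nbr1: "b = t \<or> b = f 2" if "b \<in> N" "b \<noteq> f 1" "c (f 1) b \<noteq> 0" for b
        using sat_mid[of 0 b] that n L0 L1 2 f(1) by (auto simp: numeral_2_eq_2)
      have nbr2: "b = f 1 \<or> b = f 3" if "b \<in> N" "b \<noteq> f 2" "c (f 2) b \<noteq> 0" for b
        using sat_mid[of 1 b] that n L1 2 r2 \<open>L n = 2\<close> by (auto simp: numeral_2_eq_2 numeral_3_eq_3)
      have nbr3: "b = f 2 \<or> b = z" if "b \<in> N" "b \<noteq> f 3" "c (f 3) b \<noteq> 0" for b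
        using z(6)[of b] that n by (auto simp: numeral_2_eq_2)
      have z_short: "\<not> long z"
        using long_short[of z "f 3"] z(1) z_nbr(1) f(2) fs n by auto
      have long12: "long (f 1)" "long (f 2)" using flong n by auto
      have z_ne: "z \<noteq> t" "z \<noteq> f 1" "z \<noteq> f 2" "z \<noteq> f 3"
        using z_short long12 t(3) z(2) n by auto
      have "{f 1, f 2, f 3, z} = N - {t}"
      proof (rule connected)
        fix a b assume "a \<in> {f 1, f 2, f 3, z}" "b \<in> N - {t} - {f 1, f 2, f 3, z}"
        then show "c a b = 0" using nbr1[of b] nbr2[of b] nbr3[of b] z_nbr(2)[of b] by blast
      qed (use fs z(1) z_ne in auto)
      then have "N - {t} = {f 1, f 2, f 3, z}" by simp
      moreover have "c (f 1) (f 2) = 1" "c (f 2) (f 3) = 2" "c (f 3) z = 1"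
        using bond(1)[of 1] r2 z(5) n by (auto simp: r_def numeral_2_eq_2 numeral_3_eq_3)
      moreover have "c (f 1) (f 3) = 0" "c (f 1) z = 0" "c (f 2) z = 0"
        using nbr1[of "f 3"] nbr1[of z] nbr2[of z] fs z(1) z_ne by auto
      moreover have "m (f 3) = 2" "\<not> long (f 3)" using \<open>L n = 2\<close> f(2) n by (auto simp: L_def)
      ultimately have ?F
        using fs z_ne z_short long12 z_nbr(1)
        by (intro exI[of _ "f 1"] exI[of _ "f 2"] exI[of _ "f 3"] exI[of _ z]) simp
      then show ?thesis by blast
    qed
  qed
qed

end

section \<open>Coordinates for the non-simply-laced types\<close>

text \<open>Bessel's inequality.\<close>

lemma coordinate_frame_bessel:
  fixes \<epsilon> :: "nat \<Rightarrow> 'v::real_inner"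
  assumes frame: "\<forall>i\<in>{1..n}. \<forall>j\<in>{1..n}. \<epsilon> i \<bullet> \<epsilon> j = (if i = j then c else 0)" and c: "c > 0"
    and I: "I \<subseteq> {1..n}"
  shows "(\<Sum>i\<in>I. (\<epsilon> i \<bullet> y)\<^sup>2) \<le> c * (y \<bullet> y)"
proof -
  have fin: "finite I" using I by (rule finite_subset) simp
  define z where "z = (\<Sum>i\<in>I. (\<epsilon> i \<bullet> y) *\<^sub>R \<epsilon> i)"
  have zy: "z \<bullet> y = (\<Sum>i\<in>I. (\<epsilon> i \<bullet> y)\<^sup>2)"
    by (simp add: z_def inner_sum_left power2_eq_square)
  have ez: "\<epsilon> i \<bullet> z = c * (\<epsilon> i \<bullet> y)" if "i \<in> I" for i
  proof -
    have "\<epsilon> i \<bullet> z = (\<Sum>j\<in>I. if j = i then c * (\<epsilon> i \<bullet> y) else 0)"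
      unfolding z_def inner_sum_right inner_scaleR_right
      using frame I that by (intro sum.cong) (auto simp: subset_iff)
    then show ?thesis using fin that by simp
  qed
  have "z \<bullet> z = (\<Sum>i\<in>I. (\<epsilon> i \<bullet> y) * (\<epsilon> i \<bullet> z))"
    by (subst (1) z_def) (simp add: inner_sum_left)
  also have "\<dots> = (\<Sum>i\<in>I. c * (\<epsilon> i \<bullet> y)\<^sup>2)"
    by (intro sum.cong) (auto simp: ez power2_eq_square)
  finally have zz: "z \<bullet> z = c * (z \<bullet> y)" by (simp add: zy sum_distrib_left)
  have "0 \<le> (c *\<^sub>R y - z) \<bullet> (c *\<^sub>R y - z)" by simp
  also have "\<dots> = c * (c * (y \<bullet> y) - z \<bullet> y)"
    by (simp add: inner_diff_left inner_diff_right zz inner_commute[of y z] algebra_simps)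
  finally show ?thesis using c zy by (simp add: zero_le_mult_iff)
qed

text \<open>
  The Gram matrix is that of the simple roots of type B with a short root of square length \<open>c\<close>; the
  coordinate vectors are the sums of the final segments of \<open>\<beta>\<close>.
\<close>

lemma coordinate_frame_of_gram:
  fixes \<beta> :: "nat \<Rightarrow> 'v::euclidean_space"
  assumes c: "c > 0"
    and diag: "\<And>i. 1 \<le> i \<Longrightarrow> i < n \<Longrightarrow> \<beta> i \<bullet> \<beta> i = 2 * c" "\<beta> n \<bullet> \<beta> n = c"
    and adj: "\<And>i. 1 \<le> i \<Longrightarrow> i < n \<Longrightarrow> \<beta> i \<bullet> \<beta> (Suc i) = - c"
    and far: "\<And>i j. 1 \<le> i \<Longrightarrow> j \<le> n \<Longrightarrow> Suc i < j \<Longrightarrow> \<beta> i \<bullet> \<beta> j = 0"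
  obtains \<epsilon> where "coordinate_frame n \<epsilon>" "\<And>i. i \<in> {1..<n} \<Longrightarrow> \<beta> i = \<epsilon> i - \<epsilon> (i + 1)" "\<beta> n = \<epsilon> n"
proof -
  define \<epsilon> where "\<epsilon> i = (\<Sum>k=i..n. \<beta> k)" for i
  have step: "\<epsilon> i = \<beta> i + \<epsilon> (Suc i)" if "i < n" for i
    using that by (simp add: \<epsilon>_def sum.atLeast_Suc_atMost)
  have \<epsilon>\<beta>: "\<epsilon> i \<bullet> \<beta> j = (if j = i then c else if Suc j = i then - c else 0)"
    if i: "1 \<le> i" "i \<le> n" and j: "1 \<le> j" "j \<le> n" for i j
    using i(2,1)
  proof (induction i rule: inc_induct)
    case base
    consider "j = n" | "Suc j = n" | "Suc j < n" using j by linarith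
    then show ?case
    proof cases
      case 3
      then show ?thesis using far[of j n] j by (simp add: \<epsilon>_def inner_commute)
    qed (use diag(2) adj[of j] j in \<open>auto simp: \<epsilon>_def inner_commute\<close>)
  next
    case (step i)
    have "\<epsilon> i \<bullet> \<beta> j = \<beta> i \<bullet> \<beta> j + \<epsilon> (Suc i) \<bullet> \<beta> j"
      using step.hyps \<open>\<And>i. i < n \<Longrightarrow> \<epsilon> i = \<beta> i + \<epsilon> (Suc i)\<close> by (simp add: inner_add_left)
    also have "\<epsilon> (Suc i) \<bullet> \<beta> j = (if j = Suc i then c else if j = i then - c else 0)"
      using step by auto
    also have "\<beta> i \<bullet> \<beta> j = (if j = i then 2 * c else if j = Suc i \<or> Suc j = i then - c else 0)"
    proof -
      consider "j = i" | "j = Suc i" | "Suc j = i" | "Suc i < j" | "Suc j < i" by linarith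
      then show ?thesis
      proof cases
        case 3
        then show ?thesis using adj[of j] j step.hyps step.prems by (auto simp: inner_commute)
      next
        case 5
        then show ?thesis using far[of j i] j step.hyps step.prems by (auto simp: inner_commute)
      qed (use diag adj[of i] far[of i j] j step.hyps step.prems in auto)
    qed
    finally show ?case by auto
  qed
  have "\<epsilon> i \<bullet> \<epsilon> j = (if i = j then c else 0)" if "i \<in> {1..n}" "j \<in> {1..n}" for i j
  proof -
    have "\<epsilon> i \<bullet> \<epsilon> j = (\<Sum>k=j..n. \<epsilon> i \<bullet> \<beta> k)"
      by (subst (2) \<epsilon>_def) (rule inner_sum_right)
    also have "\<dots> = (\<Sum>k=j..n. (if k = i then c else 0) + (if k = i - 1 \<and> i \<ge> 2 then - c else 0))"
      using that by (intro sum.cong) (auto simp: \<epsilon>\<beta>)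
    also have "\<dots> = (if j \<le> i then c else 0) + (\<Sum>k=j..n. (if k = i - 1 \<and> i \<ge> 2 then - c else 0))"
      using that by (simp add: sum.distrib)
    also have "(\<Sum>k=j..n. (if k = i - 1 \<and> i \<ge> 2 then - c else 0)) = (if j < i then - c else 0)"
    proof (cases "i \<ge> 2")
      case True
      then have "(\<Sum>k=j..n. (if k = i - 1 \<and> i \<ge> 2 then - c else 0)) = (\<Sum>k=j..n. (if k = i - 1 then - c else 0))"
        by (intro sum.cong) auto
      then show ?thesis using that True by auto
    next
      case False
      then show ?thesis using that by auto
    qed
    finally show ?thesis by auto
  qed
  then have "coordinate_frame n \<epsilon>" unfolding coordinate_frame_def using c by blast
  moreover have "\<beta> n = \<epsilon> n" by (simp add: \<epsilon>_def)
  ultimately show ?thesis using that[of \<epsilon>] step by auto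
qed

context irreducible_chamber
begin

text \<open>
  A short simple root excludes rank one, so that distinct nodes are not parallel and the bounds for
  Cartan integers of nonproportional roots apply.
\<close>

lemma labelled_diagram_nodes:
  assumes s: "s \<in> S" "\<not> long s"
  shows "labelled_diagram N (- \<theta>) comark cartan long"
proof -
  have simple: "N - {- \<theta>} = S" using highest_root_not_simple by (auto simp: nodes_eq)
  have not_neg: "a \<noteq> - b" if "a \<in> N" "b \<in> N" for a b
  proof
    assume eq: "a = - b"
    have "\<theta> \<notin> S" using highest_root_not_simple_if_short[OF s] .
    moreover have "p \<bullet> a = - (p \<bullet> b)" "p \<bullet> (- \<theta>) \<noteq> 0"
      using eq regular[OF root_uminus[OF highest_root(1)]] by simp_all
    moreover have "a = - \<theta> \<Longrightarrow> b = \<theta>" "b = - \<theta> \<Longrightarrow> a = \<theta>" using eq by simp_all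
    moreover have "a = - \<theta> \<or> a \<in> S" "b = - \<theta> \<or> b \<in> S" using that by (auto simp: nodes_eq)
    ultimately show False
      using simple_rootD(2)[of a] simple_rootD(2)[of b] by auto
  qed
  show ?thesis
  proof
    show "cartan b a = 0" if "a \<in> N" "b \<in> N" "cartan a b = 0" for a b
      using that node_root cartan_eq_0_iff[of a b] cartan_eq_0_iff[of b a] by (simp add: inner_commute)
    show "X = N - {- \<theta>}" if X: "X \<subseteq> N - {- \<theta>}" "X \<noteq> {}"
      "\<And>a b. a \<in> X \<Longrightarrow> b \<in> N - {- \<theta>} - X \<Longrightarrow> cartan a b = 0" for X
      unfolding simple
    proof (rule simple_connected)
      fix a b assume "a \<in> X" "b \<in> S - X"
      then show "a \<bullet> b = 0"
        using X cartan_eq_0_iff[of a b] simple_rootD(1) unfolding simple by blast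
    qed (use X simple in auto)
    show "cartan a b \<le> 1" if ab: "a \<in> N" "b \<in> N" "a \<noteq> b" "long a" "long b" for a b
    proof -
      have "a \<bullet> coroot b \<in> {-1, 0, 1}"
        using cartan_integer_of_longer_root(2)[OF root_system reduced, of a b] ab node_root not_neg by auto
      then have "real_of_int (cartan a b) \<le> 1" using ab node_root by (auto simp: cartan)
      then show ?thesis by simp
    qed
    show "cartan b a = 1 \<and> cartan a b \<ge> 2"
      if ab: "a \<in> N" "b \<in> N" "long a" "\<not> long b" "cartan a b \<noteq> 0" for a b
    proof -
      have R: "a \<in> R" "b \<in> R" using ab node_root by auto
      have lt: "norm b < norm a" using highest_root_long[OF R(2)] ab by simp
      then have "b \<noteq> a" "b \<noteq> - a" by auto
      then have "b \<bullet> coroot a \<in> {-1, 0, 1}"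
        using cartan_integer_of_longer_root(2)[OF root_system reduced R(2,1)] lt by simp
      then have "real_of_int (cartan b a) \<in> {-1, 0, 1}" using cartan[OF R(2,1)] by auto
      then have "cartan b a \<in> {-1, 0, 1}" by auto
      moreover have "cartan b a \<ge> 0" using cartan_nonneg[OF ab(2,1) \<open>b \<noteq> a\<close>] .
      moreover have "cartan b a \<noteq> 0"
        using ab(5) cartan_eq_0_iff[OF R] cartan_eq_0_iff[OF R(2,1)] by (simp add: inner_commute)
      ultimately have ba: "cartan b a = 1" by auto
      have "of_int (cartan a b) * (b \<bullet> b) = a \<bullet> a"
        using inner_cartan[OF R] inner_cartan[OF R(2,1)] ba by (simp add: inner_commute)
      moreover have "b \<bullet> b < a \<bullet> a" using lt by (simp add: norm_lt)
      moreover have "b \<bullet> b > 0" using root_nonzero[OF R(2)] by simp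
      ultimately have "real_of_int (cartan a b) > 1"
        by (metis mult_less_cancel_right_pos mult_1)
      then show ?thesis using ba by simp
    qed
    show "\<exists>l\<in>N - {- \<theta>}. long l" unfolding simple by (rule long_simple_exists)
  qed (use finite_nodes comark_highest comark_pos cartan_nonneg comark_balance in \<open>auto simp: nodes_eq\<close>)
qed

lemma cartan_gram: "a \<in> R \<Longrightarrow> b \<in> R \<Longrightarrow> a \<bullet> b = - of_int (cartan a b) * (b \<bullet> b) / 2"
  using inner_cartan[of a b] by simp

lemma cartan_norm_ratio:
  "a \<in> R \<Longrightarrow> b \<in> R \<Longrightarrow> of_int (cartan a b) * (b \<bullet> b) = of_int (cartan b a) * (a \<bullet> a)"
  using inner_cartan[of a b] inner_cartan[of b a] by (simp add: inner_commute)

text \<open>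
  The multiplier \<open>s\<close> is 1 for type B and 2 for type C. Dividing the last root by \<open>s\<close> leads to the Gram
  matrix of type B in both cases.
\<close>

lemma chain_coordinates:
  assumes diagram: "labelled_diagram N (- \<theta>) comark cartan long"
    and ch: "labelled_diagram.chain N (- \<theta>) cartan n \<alpha> P s" and n: "n \<ge> 2" and Ps: "P * s = 2" "s > 0"
  obtains \<epsilon> where "bij_betw \<alpha> {1..n} S" "coordinate_frame n \<epsilon>"
    "\<forall>i\<in>{1..<n}. \<alpha> i = \<epsilon> i - \<epsilon> (i + 1)" "\<alpha> n = of_int s *\<^sub>R \<epsilon> n"
proof -
  interpret labelled_diagram N "- \<theta>" comark cartan long by (rule diagram)
  have "N - {- \<theta>} = S" using highest_root_not_simple by (auto simp: nodes_eq)
  then have bij: "bij_betw \<alpha> {1..n} S" using ch by (simp add: chain_def)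
  have \<alpha>R: "\<alpha> i \<in> R" if "1 \<le> i" "i \<le> n" for i
    using bij_betwE[OF bij] that simple_rootD(1) by auto
  have last: "cartan (\<alpha> (n - 1)) (\<alpha> n) = P" "cartan (\<alpha> n) (\<alpha> (n - 1)) = s"
    and mid: "\<And>i. 1 \<le> i \<Longrightarrow> Suc i < n \<Longrightarrow> cartan (\<alpha> i) (\<alpha> (Suc i)) = 1 \<and> cartan (\<alpha> (Suc i)) (\<alpha> i) = 1"
    using ch by (auto simp: chain_def)
  define q where "q = \<alpha> n \<bullet> \<alpha> n"
  define c where "c = q / (of_int s)\<^sup>2"
  have q: "q = c * (of_int s)\<^sup>2" "c > 0"
    using root_nonzero[OF \<alpha>R[of n]] n Ps by (simp_all add: c_def q_def)
  have "real_of_int (P * s) = 2" using Ps(1) by simp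
  then have Ps': "real_of_int P * of_int s = 2" by simp
  have "of_int s * (\<alpha> (n - 1) \<bullet> \<alpha> (n - 1)) = of_int P * q"
    using cartan_norm_ratio[of "\<alpha> (n - 1)" "\<alpha> n"] last \<alpha>R[of "n - 1"] \<alpha>R[of n] n by (simp add: q_def)
  also have "\<dots> = of_int s * (c * (of_int P * of_int s))" by (simp add: q power2_eq_square)
  finally have n1: "\<alpha> (n - 1) \<bullet> \<alpha> (n - 1) = 2 * c" using Ps(2) Ps' by simp
  have sq: "\<alpha> i \<bullet> \<alpha> i = 2 * c" if "1 \<le> i" "i \<le> n - 1" for i
    using that(2,1)
  proof (induction i rule: inc_induct)
    case (step i)
    then show ?case
      using cartan_norm_ratio[of "\<alpha> i" "\<alpha> (Suc i)"] mid[of i] \<alpha>R[of i] \<alpha>R[of "Suc i"] by simp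
  qed (use n1 in simp)
  define \<beta> where "\<beta> i = (if i = n then (1 / of_int s) *\<^sub>R \<alpha> n else \<alpha> i)" for i
  have \<beta>: "\<beta> n = (1 / of_int s) *\<^sub>R \<alpha> n" "\<And>i. i < n \<Longrightarrow> \<beta> i = \<alpha> i" by (auto simp: \<beta>_def)
  obtain \<epsilon> where \<epsilon>: "coordinate_frame n \<epsilon>" "\<And>i. i \<in> {1..<n} \<Longrightarrow> \<beta> i = \<epsilon> i - \<epsilon> (i + 1)" "\<beta> n = \<epsilon> n"
  proof (rule coordinate_frame_of_gram[OF q(2)])
    show "\<beta> i \<bullet> \<beta> i = 2 * c" if "1 \<le> i" "i < n" for i
      using sq that by (simp add: \<beta>)
    show "\<beta> n \<bullet> \<beta> n = c" using Ps(2) by (simp add: \<beta>(1) q_def[symmetric] q(1) power2_eq_square)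
    show "\<beta> i \<bullet> \<beta> (Suc i) = - c" if i: "1 \<le> i" "i < n" for i
    proof (cases "Suc i = n")
      case True
      then have "i = n - 1" by simp
      then have "\<alpha> i \<bullet> \<alpha> n = - of_int P * q / 2"
        using cartan_gram[of "\<alpha> i" "\<alpha> n"] last(1) \<alpha>R[of i] \<alpha>R[of n] i by (simp add: q_def)
      also have "\<dots> = - (of_int P * of_int s) * of_int s * c / 2" by (simp add: q power2_eq_square)
      finally have "\<alpha> i \<bullet> \<alpha> n = - of_int s * c" unfolding Ps' by simp
      then show ?thesis using True i Ps(2) by (simp add: \<beta>)
    next
      case False
      then show ?thesis
        using cartan_gram[of "\<alpha> i" "\<alpha> (Suc i)"] mid[of i] \<alpha>R[of i] \<alpha>R[of "Suc i"] sq[of "Suc i"] i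
        by (simp add: \<beta>)
    qed
    show "\<beta> i \<bullet> \<beta> k = 0" if "1 \<le> i" "k \<le> n" "Suc i < k" for i k
    proof -
      have "cartan (\<alpha> i) (\<alpha> k) = 0" using ch that by (auto simp: chain_def)
      then have "\<alpha> i \<bullet> \<alpha> k = 0" using cartan_eq_0_iff[of "\<alpha> i" "\<alpha> k"] \<alpha>R that by auto
      then show ?thesis using that by (auto simp: \<beta>_def)
    qed
  qed blast
  have "\<alpha> n = of_int s *\<^sub>R \<epsilon> n" unfolding \<epsilon>(3)[symmetric] \<beta>(1) using Ps(2) by simp
  then show ?thesis using that[of \<epsilon>] bij \<epsilon>(1,2) \<beta>(2) by auto
qed

text \<open>
  In type B and type G2 there is only one short simple root, in type C all short simple roots belong to
  the list, and in type F4 the comark of \<open>\<alpha> 3\<close> is 2.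
\<close>

lemma short_node_of_comark_one:
  assumes j: "j \<in> S" "\<not> long j" "comark j = 1"
  shows "(\<exists>n \<alpha>. type_B R \<aa> n \<alpha> \<and> j = \<alpha> n) \<or>
    (\<exists>n \<alpha>. type_C R \<aa> n \<alpha> \<and> (\<exists>i\<in>{1..<n}. j = \<alpha> i)) \<or>
    (\<exists>\<alpha>. type_F4 R \<aa> \<alpha> \<and> j = \<alpha> 4) \<or> (\<exists>\<alpha>. type_G2 R \<aa> \<alpha> \<and> j = \<alpha> 2)"
proof -
  note diagram = labelled_diagram_nodes[OF j(1,2)]
  interpret labelled_diagram N "- \<theta>" comark cartan long by (rule diagram)
  have simple: "N - {- \<theta>} = S" using highest_root_not_simple by (auto simp: nodes_eq)
  have long_sq: "a \<bullet> a = \<theta> \<bullet> \<theta>" if "long a" for a using that by (simp add: dot_square_norm)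
  show ?thesis
  proof (cases "\<exists>y\<in>N. \<not> long y \<and> cartan (- \<theta>) y \<noteq> 0")
    case True
    then obtain n \<alpha> where n: "n \<ge> 2" and ch: "chain n \<alpha> 1 2" and lg: "\<And>i. i \<in> {1..n} \<Longrightarrow> long (\<alpha> i) \<longleftrightarrow> i = n"
      using classify_short_neighbour by blast
    obtain \<epsilon> where bij: "bij_betw \<alpha> {1..n} S" and \<epsilon>: "coordinate_frame n \<epsilon>"
      "\<forall>i\<in>{1..<n}. \<alpha> i = \<epsilon> i - \<epsilon> (i + 1)" "\<alpha> n = 2 *\<^sub>R \<epsilon> n"
      using chain_coordinates[OF diagram ch n] by auto
    then have "type_C R \<aa> n \<alpha>" unfolding type_C_def using n by blast
    moreover obtain i where i: "i \<in> {1..n}" "j = \<alpha> i" using bij j(1) by (metis bij_betw_imp_surj_on imageE)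
    then have "i \<in> {1..<n}" using lg[of i] lg[of n] j(2) n by fastforce
    ultimately show ?thesis using i(2) by blast
  next
    case False
    then have "j \<in> N" "\<forall>y\<in>N. \<not> long y \<longrightarrow> cartan (- \<theta>) y = 0" using j(1) by (auto simp: nodes_eq)
    from classify_long_neighbour[OF this(1) j(2) this(2)] show ?thesis
    proof (elim disjE exE conjE)
      fix n \<alpha> assume n: "3 \<le> n" and ch: "chain n \<alpha> 2 1" and lg: "\<forall>i\<in>{1..n}. long (\<alpha> i) \<longleftrightarrow> i \<noteq> n"
      obtain \<epsilon> where bij: "bij_betw \<alpha> {1..n} S" and \<epsilon>: "coordinate_frame n \<epsilon>"
        "\<forall>i\<in>{1..<n}. \<alpha> i = \<epsilon> i - \<epsilon> (i + 1)" "\<alpha> n = \<epsilon> n"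
        using chain_coordinates[OF diagram ch] n by auto
      then have "type_B R \<aa> n \<alpha>" unfolding type_B_def using n by auto
      moreover obtain i where i: "i \<in> {1..n}" "j = \<alpha> i" using bij j(1) by (metis bij_betw_imp_surj_on imageE)
      then have "i = n" using lg j(2) by blast
      ultimately show ?thesis using i(2) by blast
    next
      fix x1 x2 x3 x4
      assume dist: "distinct [x1, x2, x3, x4]" and set: "N - {- \<theta>} = {x1, x2, x3, x4}"
        and lg: "long x1" "long x2" "\<not> long x3" "\<not> long x4" and m3: "comark x3 = 2"
        and ca: "cartan x1 x2 = 1" "cartan x2 x3 = 2" "cartan x3 x4 = 1" "cartan x4 x3 = 1"
          "cartan x1 x3 = 0" "cartan x1 x4 = 0" "cartan x2 x4 = 0"
      have S_eq: "S = {x1, x2, x3, x4}" using set simple by simp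
      then have xR: "x1 \<in> R" "x2 \<in> R" "x3 \<in> R" "x4 \<in> R" using simple_rootD(1) by auto
      define c where "c = x3 \<bullet> x3"
      have c: "c > 0" using root_nonzero xR by (simp add: c_def)
      have "cartan x3 x2 = 1"
        using long_short[of x2 x3] lg ca(2) S_eq nodes_eq by auto
      then have sq2: "x2 \<bullet> x2 = 2 * c" using cartan_norm_ratio[OF xR(2,3)] ca by (simp add: c_def)
      have sq1: "x1 \<bullet> x1 = 2 * c" using long_sq[OF lg(1)] long_sq[OF lg(2)] sq2 by simp
      have sq4: "x4 \<bullet> x4 = c" using cartan_norm_ratio[OF xR(3,4)] ca by (simp add: c_def)
      have g: "x1 \<bullet> x2 = - c" "x2 \<bullet> x3 = - c" "x3 \<bullet> x4 = - c / 2"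
        "x1 \<bullet> x3 = 0" "x1 \<bullet> x4 = 0" "x2 \<bullet> x4 = 0"
        using cartan_gram[OF xR(1,2)] cartan_gram[OF xR(2,3)] cartan_gram[OF xR(3,4)]
          cartan_gram[OF xR(1,3)] cartan_gram[OF xR(1,4)] cartan_gram[OF xR(2,4)] ca sq2 sq4
        by (auto simp: c_def)
      note gram = g g[unfolded inner_commute[of x1] inner_commute[of x2 x3] inner_commute[of x2 x4] inner_commute[of x3 x4]]
        sq1 sq2 sq4 c_def[symmetric]
      define \<alpha> where "\<alpha> i = (if i = 1 then x1 else if i = 2 then x2 else if i = 3 then x3 else x4)" for i :: nat
      \<comment> \<open>The solution of the equations in \<open>type_F4\<close> for the coordinate vectors.\<close>
      define \<epsilon> where "\<epsilon> i = (if i = 1 then x1 + 2 *\<^sub>R x2 + 3 *\<^sub>R x3 + 2 *\<^sub>R x4 else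
        if i = 2 then x1 + x2 + x3 else if i = 3 then x2 + x3 else x3)" for i :: nat
      have four: "{1..4::nat} = {1, 2, 3, 4}" by auto
      have "coordinate_frame 4 \<epsilon>"
        unfolding coordinate_frame_def four
        by (rule exI[of _ c]) (simp add: \<epsilon>_def c inner_add_left inner_add_right gram)
      moreover have "bij_betw \<alpha> {1..4} S"
        unfolding bij_betw_def four S_eq using dist by (auto simp: \<alpha>_def inj_on_def)
      moreover have "\<alpha> 4 = (1/2) *\<^sub>R (\<epsilon> 1 - \<epsilon> 2 - \<epsilon> 3 - \<epsilon> 4)"
      proof -
        have "3 *\<^sub>R x3 = x3 + 2 *\<^sub>R x3" using scaleR_left_distrib[of 1 2 x3] by simp
        then have "\<epsilon> 1 - \<epsilon> 2 - \<epsilon> 3 - \<epsilon> 4 = 2 *\<^sub>R x4"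
          by (simp add: \<epsilon>_def scaleR_2)
        then show ?thesis by (simp add: \<alpha>_def)
      qed
      ultimately have "type_F4 R \<aa> \<alpha>"
        unfolding type_F4_def by (intro conjI exI[of _ \<epsilon>]) (auto simp: \<alpha>_def \<epsilon>_def)
      moreover have "j = x4" using j lg m3 S_eq by auto
      then have "j = \<alpha> 4" by (simp add: \<alpha>_def)
      ultimately show ?thesis by blast
    next
      fix x1 x2
      assume ne: "x1 \<noteq> x2" and set: "N - {- \<theta>} = {x1, x2}" and lg: "long x1" "\<not> long x2"
        and ca: "cartan x1 x2 = 3" "cartan x2 x1 = 1"
      have S_eq: "S = {x1, x2}" using set simple by simp
      then have xR: "x1 \<in> R" "x2 \<in> R" using simple_rootD(1) by auto
      define \<alpha> where "\<alpha> i = (if i = 1 then x1 else x2)" for i :: nat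
      have two: "{1..2::nat} = {1, 2}" by auto
      have "bij_betw \<alpha> {1..2} S"
        unfolding bij_betw_def two S_eq using ne by (auto simp: \<alpha>_def inj_on_def)
      then have "type_G2 R \<aa> \<alpha>"
        unfolding type_G2_def using cartan[OF xR] cartan[OF xR(2,1)] ca by (auto simp: \<alpha>_def)
      moreover have "j = \<alpha> 2" using j(1,2) lg S_eq by (auto simp: \<alpha>_def)
      ultimately show ?thesis by blast
    qed
  qed
qed

section \<open>Comarks of the listed nodes\<close>

lemma highest_coroot_expansion: "coroot \<theta> = (\<Sum>b\<in>S. of_int (comark b) *\<^sub>R coroot b)"
proof -
  have "(\<Sum>b\<in>S. of_int (comark b) *\<^sub>R coroot b) = (\<Sum>b\<in>S. (\<eta> b \<bullet> coroot \<theta>) *\<^sub>R coroot b)"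
    by (intro sum.cong) (auto simp: comark_simple)
  then show ?thesis by (simp add: coroot_expansion)
qed

lemma highest_coroot_short:
  assumes "a \<in> R" shows "coroot \<theta> \<bullet> coroot \<theta> \<le> 4 / (a \<bullet> a)"
  using highest_root_long[OF assms] root_nonzero[OF assms] highest_root(2)
  by (simp add: coroot_inner_coroot norm_le frac_le)

text \<open>
  The coroot of \<open>\<theta>\<close> is among the shortest coroots, and its coordinates are integers, so that only
  few of them are nonzero.
\<close>

lemma highest_coroot_coordinates:
  fixes \<epsilon> :: "nat \<Rightarrow> 'v"
  assumes frame: "\<forall>i\<in>{1..n}. \<forall>j\<in>{1..n}. \<epsilon> i \<bullet> \<epsilon> j = (if i = j then c else 0)" and c: "c > 0"
    and I: "I \<subseteq> {1..n}" and a: "a \<in> R"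
    and int: "\<And>i b. i \<in> I \<Longrightarrow> b \<in> S \<Longrightarrow> \<epsilon> i \<bullet> coroot b \<in> \<int>"
  shows "(\<Sum>i\<in>I. \<epsilon> i \<bullet> coroot \<theta>) \<le> 4 * c / (a \<bullet> a)"
proof -
  have "\<epsilon> i \<bullet> coroot \<theta> \<le> (\<epsilon> i \<bullet> coroot \<theta>)\<^sup>2" if "i \<in> I" for i
  proof -
    have "\<epsilon> i \<bullet> coroot \<theta> \<in> \<int>"
      unfolding highest_coroot_expansion inner_sum_right inner_scaleR_right
      using int[OF that] by (intro Ints_sum Ints_mult) auto
    then obtain k :: int where k: "\<epsilon> i \<bullet> coroot \<theta> = of_int k" using Ints_cases by blast
    have "k \<le> k\<^sup>2" by (cases "k \<ge> 1") (auto simp: power2_eq_square mult_le_cancel_left1 intro: order_trans[of _ 0])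
    then show ?thesis unfolding k by (metis of_int_le_iff of_int_power)
  qed
  then have "(\<Sum>i\<in>I. \<epsilon> i \<bullet> coroot \<theta>) \<le> (\<Sum>i\<in>I. (\<epsilon> i \<bullet> coroot \<theta>)\<^sup>2)" by (intro sum_mono)
  also have "\<dots> \<le> c * (coroot \<theta> \<bullet> coroot \<theta>)" by (rule coordinate_frame_bessel[OF frame c I])
  also have "\<dots> \<le> c * (4 / (a \<bullet> a))" using highest_coroot_short[OF a] c by (intro mult_left_mono) auto
  finally show ?thesis by (simp add: mult.commute)
qed

lemma inner_highest_coroot:
  fixes \<alpha> :: "nat \<Rightarrow> 'v"
  assumes bij: "bij_betw \<alpha> {1..n} S"
    and zero: "\<And>k. k \<in> {1..n} \<Longrightarrow> k \<noteq> j \<Longrightarrow> e \<bullet> coroot (\<alpha> k) = 0" and j: "j \<in> {1..n}"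
  shows "e \<bullet> coroot \<theta> = of_int (comark (\<alpha> j)) * (e \<bullet> coroot (\<alpha> j))"
proof -
  have "e \<bullet> coroot \<theta> = (\<Sum>b\<in>S. of_int (comark b) * (e \<bullet> coroot b))"
    by (simp add: highest_coroot_expansion inner_sum_right)
  also have "\<dots> = (\<Sum>k\<in>{1..n}. of_int (comark (\<alpha> k)) * (e \<bullet> coroot (\<alpha> k)))"
    by (rule sum.reindex_bij_betw[OF bij, symmetric])
  also have "\<dots> = (\<Sum>k\<in>{1..n}. if k = j then of_int (comark (\<alpha> j)) * (e \<bullet> coroot (\<alpha> j)) else 0)"
    using zero by (intro sum.cong) auto
  finally show ?thesis using j by simp
qed

text \<open>
  Types B and C at once, with \<open>s\<close> equal to 1 and 2. The sum of the first \<open>j\<close> coordinates vanishes on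
  all simple coroots but the one of \<open>\<alpha> j\<close>, so that it picks out the comark of \<open>\<alpha> j\<close> from the coroot
  of \<open>\<theta>\<close>.
\<close>

lemma comark_coordinate_bound:
  fixes \<alpha> \<epsilon> :: "nat \<Rightarrow> 'v" and s :: real
  assumes bij: "bij_betw \<alpha> {1..n} S" and c: "c > 0"
    and frame: "\<forall>i\<in>{1..n}. \<forall>j\<in>{1..n}. \<epsilon> i \<bullet> \<epsilon> j = (if i = j then c else 0)"
    and \<alpha>: "\<forall>i\<in>{1..<n}. \<alpha> i = \<epsilon> i - \<epsilon> (i + 1)" "\<alpha> n = s *\<^sub>R \<epsilon> n"
    and s: "s = 1 \<or> s = 2" and j: "j \<in> {1..n}" and a: "a \<in> R"
  shows "of_int (comark (\<alpha> j)) * (if j = n then 2 / s else 1) \<le> 4 * c / (a \<bullet> a)"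
proof -
  have fr: "\<epsilon> i \<bullet> \<epsilon> j = (if i = j then c else 0)" if "1 \<le> i" "i \<le> n" "1 \<le> j" "j \<le> n" for i j
    using frame that by simp
  have sq: "\<alpha> k \<bullet> \<alpha> k = (if k = n then s * s * c else 2 * c)" if "1 \<le> k" "k \<le> n" for k
    using \<alpha> that by (auto simp: inner_diff_left inner_diff_right fr)
  have cor: "\<epsilon> i \<bullet> coroot (\<alpha> k) = (if k = n then (if i = n then 2 / s else 0) else
      (if i = k then 1 else 0) - (if i = k + 1 then 1 else 0))"
    if "1 \<le> i" "i \<le> n" "1 \<le> k" "k \<le> n" for i k
    unfolding coroot_def inner_scaleR_right sq[OF that(3,4)]
    using \<alpha> that c s by (auto simp: inner_diff_right fr)
  have int: "\<epsilon> i \<bullet> coroot b \<in> \<int>" if i: "i \<in> {1..n}" and b: "b \<in> S" for i b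
  proof -
    obtain k where "k \<in> {1..n}" "b = \<alpha> k" using bij b by (metis bij_betw_imp_surj_on imageE)
    then show ?thesis using i s by (auto simp: cor)
  qed
  define e where "e = (\<Sum>i=1..j. \<epsilon> i)"
  have e: "e \<bullet> coroot (\<alpha> k) = (if k = j then (if j = n then 2 / s else 1) else 0)" if "k \<in> {1..n}" for k
  proof -
    have "e \<bullet> coroot (\<alpha> k) = (\<Sum>i=1..j. if k = n then (if i = n then 2 / s else 0) else
      (if i = k then 1 else 0) - (if i = k + 1 then 1 else 0))"
      unfolding e_def inner_sum_left using that j by (intro sum.cong) (auto simp: cor)
    then show ?thesis using that j by (cases "k = n") (auto simp: sum_subtractf)
  qed
  have "(\<Sum>i=1..j. \<epsilon> i \<bullet> coroot \<theta>) \<le> 4 * c / (a \<bullet> a)"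
    using int j by (intro highest_coroot_coordinates[OF frame c _ a]) auto
  also have "(\<Sum>i=1..j. \<epsilon> i \<bullet> coroot \<theta>) = of_int (comark (\<alpha> j)) * (if j = n then 2 / s else 1)"
    using inner_highest_coroot[OF bij, of j e] e j by (auto simp: e_def inner_sum_left)
  finally show ?thesis .
qed

lemma comark_type_B:
  assumes "type_B R \<aa> n \<alpha>" shows "\<alpha> n \<in> S" "comark (\<alpha> n) = 1"
proof -
  obtain \<epsilon> c where n: "n \<ge> 2" and bij: "bij_betw \<alpha> {1..n} S" and c: "c > 0"
    and frame: "\<forall>i\<in>{1..n}. \<forall>j\<in>{1..n}. \<epsilon> i \<bullet> \<epsilon> j = (if i = j then c else 0)"
    and \<alpha>: "\<forall>i\<in>{1..<n}. \<alpha> i = \<epsilon> i - \<epsilon> (i + 1)" "\<alpha> n = \<epsilon> n"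
    using assms unfolding type_B_def coordinate_frame_def by blast
  show "\<alpha> n \<in> S" using bij_betwE[OF bij] n by auto
  have "\<alpha> 1 \<in> R" using bij_betwE[OF bij] n simple_rootD(1) by auto
  moreover have "\<alpha> 1 \<bullet> \<alpha> 1 = 2 * c"
    using \<alpha>(1) frame n by (auto simp: inner_diff_left inner_diff_right)
  ultimately have "of_int (comark (\<alpha> n)) * 2 \<le> 4 * c / (2 * c)"
    using comark_coordinate_bound[OF bij c frame \<alpha>(1), of 1 n "\<alpha> 1"] \<alpha>(2) n by simp
  then show "comark (\<alpha> n) = 1" using comark_pos[of "\<alpha> n"] c by simp
qed

lemma comark_type_C:
  assumes "type_C R \<aa> n \<alpha>" and j: "j \<in> {1..<n}" shows "\<alpha> j \<in> S" "comark (\<alpha> j) = 1"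
proof -
  obtain \<epsilon> c where n: "n \<ge> 2" and bij: "bij_betw \<alpha> {1..n} S" and c: "c > 0"
    and frame: "\<forall>i\<in>{1..n}. \<forall>j\<in>{1..n}. \<epsilon> i \<bullet> \<epsilon> j = (if i = j then c else 0)"
    and \<alpha>: "\<forall>i\<in>{1..<n}. \<alpha> i = \<epsilon> i - \<epsilon> (i + 1)" "\<alpha> n = 2 *\<^sub>R \<epsilon> n"
    using assms unfolding type_C_def coordinate_frame_def by blast
  show "\<alpha> j \<in> S" using bij_betwE[OF bij] j by auto
  have "\<alpha> n \<in> R" using bij_betwE[OF bij] n simple_rootD(1) by auto
  moreover have "\<alpha> n \<bullet> \<alpha> n = 4 * c" using \<alpha>(2) frame n by simp
  ultimately have "of_int (comark (\<alpha> j)) \<le> 4 * c / (4 * c)"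
    using comark_coordinate_bound[OF bij c frame \<alpha>, of j "\<alpha> n"] j by simp
  then show "comark (\<alpha> j) = 1" using comark_pos[of "\<alpha> j"] c by simp
qed

lemma comark_type_F4:
  assumes "type_F4 R \<aa> \<alpha>" shows "\<alpha> 4 \<in> S" "comark (\<alpha> 4) = 1"
proof -
  obtain \<epsilon> c where bij: "bij_betw \<alpha> {1..4} S" and c: "c > 0"
    and frame: "\<forall>i\<in>{1..4::nat}. \<forall>j\<in>{1..4}. \<epsilon> i \<bullet> \<epsilon> j = (if i = j then c else 0)"
    and \<alpha>: "\<alpha> 1 = \<epsilon> 2 - \<epsilon> 3" "\<alpha> 2 = \<epsilon> 3 - \<epsilon> 4" "\<alpha> 3 = \<epsilon> 4"
      "\<alpha> 4 = (1/2) *\<^sub>R (\<epsilon> 1 - \<epsilon> 2 - \<epsilon> 3 - \<epsilon> 4)"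
    using assms unfolding type_F4_def coordinate_frame_def by blast
  have fr: "\<epsilon> i \<bullet> \<epsilon> j = (if i = j then c else 0)" if "1 \<le> i" "i \<le> 4" "1 \<le> j" "j \<le> 4" for i j
    using frame that by simp
  show "\<alpha> 4 \<in> S" using bij_betwE[OF bij] by auto
  have "\<alpha> 4 \<bullet> \<alpha> 4 = c" "\<alpha> 1 \<bullet> \<alpha> 1 = 2 * c"
    unfolding \<alpha> by (auto simp: inner_diff_left inner_diff_right fr)
  moreover have "\<epsilon> 1 \<bullet> \<alpha> 4 = c / 2" "\<epsilon> 1 \<bullet> \<alpha> 1 = 0" "\<epsilon> 1 \<bullet> \<alpha> 2 = 0" "\<epsilon> 1 \<bullet> \<alpha> 3 = 0"
    unfolding \<alpha> by (simp_all add: inner_diff_right fr del: One_nat_def)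
  ultimately have cor: "\<epsilon> 1 \<bullet> coroot (\<alpha> 4) = 1" "\<epsilon> 1 \<bullet> coroot (\<alpha> 1) = 0"
    "\<epsilon> 1 \<bullet> coroot (\<alpha> 2) = 0" "\<epsilon> 1 \<bullet> coroot (\<alpha> 3) = 0"
    using c by (simp_all add: coroot_def del: One_nat_def)
  have "\<epsilon> 1 \<bullet> coroot (\<alpha> k) = 0" if "k \<in> {1..4}" "k \<noteq> 4" for k
  proof -
    have "k = 1 \<or> k = 2 \<or> k = 3" using that by auto
    then show ?thesis using cor by auto
  qed
  then have "\<epsilon> 1 \<bullet> coroot \<theta> = of_int (comark (\<alpha> 4))"
    using inner_highest_coroot[OF bij, of 4 "\<epsilon> 1"] cor by simp
  then have "(of_int (comark (\<alpha> 4)))\<^sup>2 \<le> c * (coroot \<theta> \<bullet> coroot \<theta>)"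
    using coordinate_frame_bessel[OF frame c, of "{1}" "coroot \<theta>"] by simp
  also have "\<dots> \<le> c * (4 / (\<alpha> 1 \<bullet> \<alpha> 1))"
    using highest_coroot_short[of "\<alpha> 1"] bij_betwE[OF bij] simple_rootD(1) c by (intro mult_left_mono) auto
  also have "\<dots> = 2" using \<open>\<alpha> 1 \<bullet> \<alpha> 1 = 2 * c\<close> c by simp
  finally have "real_of_int ((comark (\<alpha> 4))\<^sup>2) \<le> of_int 2" by simp
  then have le: "(comark (\<alpha> 4))\<^sup>2 \<le> 2" by (simp only: of_int_le_iff)
  have "comark (\<alpha> 4) < 2"
  proof (rule ccontr)
    assume "\<not> comark (\<alpha> 4) < 2"
    then have "2\<^sup>2 \<le> (comark (\<alpha> 4))\<^sup>2" by (intro power_mono) auto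
    then show False using le by simp
  qed
  then show "comark (\<alpha> 4) = 1" using comark_pos[of "\<alpha> 4"] by simp
qed

lemma comark_type_G2:
  assumes "type_G2 R \<aa> \<alpha>" shows "\<alpha> 2 \<in> S" "comark (\<alpha> 2) = 1"
proof -
  have bij: "bij_betw \<alpha> {1..2} S" and ca: "\<alpha> 1 \<bullet> coroot (\<alpha> 2) = -3" "\<alpha> 2 \<bullet> coroot (\<alpha> 1) = -1"
    using assms by (auto simp: type_G2_def)
  show "\<alpha> 2 \<in> S" using bij_betwE[OF bij] by auto
  have R: "\<alpha> 1 \<in> R" "\<alpha> 2 \<in> R" using bij_betwE[OF bij] simple_rootD(1) by auto
  have two: "{1..2::nat} = {1, 2}" by auto
  define q where "q = \<alpha> 2 \<bullet> \<alpha> 2"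
  have q: "q > 0" using root_nonzero[OF R(2)] by (simp add: q_def)
  have sq: "\<alpha> 1 \<bullet> \<alpha> 1 = 3 * q" "2 * (\<alpha> 1 \<bullet> \<alpha> 2) = - 3 * q"
    using inner_coroot_commute[of "\<alpha> 1" "\<alpha> 2"] inner_coroot_commute[of "\<alpha> 2" "\<alpha> 1"] ca
    by (simp_all add: q_def inner_commute)
  have cc: "coroot (\<alpha> 1) \<bullet> coroot (\<alpha> 1) = 4 / (3 * q)" "coroot (\<alpha> 2) \<bullet> coroot (\<alpha> 2) = 4 / q"
    "coroot (\<alpha> 1) \<bullet> coroot (\<alpha> 2) = - 2 / q"
    using root_nonzero[OF R(1)] root_nonzero[OF R(2)] sq ca(1) q
    by (simp_all add: coroot_inner_coroot q_def[symmetric], simp add: coroot_def q_def[symmetric] field_simps)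
  define m where "m k = comark (\<alpha> k)" for k
  have "coroot \<theta> = (\<Sum>k\<in>{1..2}. of_int (m k) *\<^sub>R coroot (\<alpha> k))"
    unfolding highest_coroot_expansion m_def by (rule sum.reindex_bij_betw[OF bij, symmetric])
  then have "coroot \<theta> = of_int (m 1) *\<^sub>R coroot (\<alpha> 1) + of_int (m 2) *\<^sub>R coroot (\<alpha> 2)"
    unfolding two by simp
  then have "coroot \<theta> \<bullet> coroot \<theta> = (of_int (m 1))\<^sup>2 * (4 / (3 * q)) + (of_int (m 2))\<^sup>2 * (4 / q)
      + 2 * of_int (m 1) * of_int (m 2) * (- 2 / q)"
    by (simp add: inner_add_left inner_add_right cc inner_commute[of "coroot (\<alpha> 2)" "coroot (\<alpha> 1)"]
        power2_eq_square algebra_simps del: One_nat_def)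
  also have "\<dots> = of_int ((m 1)\<^sup>2 + 3 * (m 2)\<^sup>2 - 3 * m 1 * m 2) * (4 / (3 * q))"
    using q by (simp add: field_simps)
  finally have "of_int ((m 1)\<^sup>2 + 3 * (m 2)\<^sup>2 - 3 * m 1 * m 2) * (4 / (3 * q)) \<le> 1 * (4 / (3 * q))"
    using highest_coroot_short[OF R(1)] sq(1) by simp
  then have "real_of_int ((m 1)\<^sup>2 + 3 * (m 2)\<^sup>2 - 3 * m 1 * m 2) \<le> 1"
    using q mult_le_cancel_right_pos[of "4 / (3 * q)"] by (metis divide_pos_pos mult_pos_pos zero_less_numeral)
  then have "real_of_int ((m 1)\<^sup>2 + 3 * (m 2)\<^sup>2 - 3 * m 1 * m 2) \<le> of_int 1" by (simp only: of_int_1)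
  then have "(m 1)\<^sup>2 + 3 * (m 2)\<^sup>2 - 3 * m 1 * m 2 \<le> 1" by (simp only: of_int_le_iff)
  \<comment> \<open>Complete the square in the quadratic form of the coroot lattice.\<close>
  then have "4 * ((m 1)\<^sup>2 + 3 * (m 2)\<^sup>2 - 3 * m 1 * m 2) \<le> 4 * 1" by (intro mult_left_mono) auto
  also have "4 * ((m 1)\<^sup>2 + 3 * (m 2)\<^sup>2 - 3 * m 1 * m 2) = (2 * m 1 - 3 * m 2)\<^sup>2 + 3 * (m 2)\<^sup>2"
    by (simp add: power2_eq_square algebra_simps)
  finally have "(2 * m 1 - 3 * m 2)\<^sup>2 + 3 * (m 2)\<^sup>2 \<le> 4" by simp
  moreover have "3 * (m 2)\<^sup>2 \<le> (2 * m 1 - 3 * m 2)\<^sup>2 + 3 * (m 2)\<^sup>2" by simp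
  ultimately have le: "3 * (m 2)\<^sup>2 \<le> 4" by (rule order_trans[rotated])
  have "m 2 < 2"
  proof (rule ccontr)
    assume "\<not> m 2 < 2"
    then have "2\<^sup>2 \<le> (m 2)\<^sup>2" by (intro power_mono) auto
    then show False using le by simp
  qed
  then show "comark (\<alpha> 2) = 1" using comark_pos[of "\<alpha> 2"] by (simp add: m_def)
qed

section \<open>Special nodes\<close>

text \<open>
  The vertex of a simple root \<open>j\<close> is the multiple of the fundamental coweight at which \<open>\<theta>\<close> is 1, so
  that the node is special if and only if \<open>j\<close> has coefficient 1 in \<open>\<theta>\<close>; this coefficient is
  the comark times the ratio of the square lengths of \<open>\<theta>\<close> and \<open>j\<close>.
\<close>

lemma comark_coefficient:
  assumes "j \<in> S" shows "of_int (comark j) * (\<theta> \<bullet> \<theta>) = (\<omega> j \<bullet> \<theta>) * (j \<bullet> j)"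
  using highest_root(2) by (simp add: comark_simple[OF assms] coroot_coefficient_root)

lemma special_node_comark:
  assumes "special_node R \<aa> b" shows "b \<in> N" "comark b = 1"
proof -
  show "b \<in> N" using assms by (simp add: special_node_def)
  obtain v where v: "\<And>c. c \<in> N - {b} \<Longrightarrow> v \<bullet> c + node_const R \<aa> c = 0" "\<And>a. a \<in> R \<Longrightarrow> v \<bullet> a \<in> \<int>"
    using assms unfolding special_node_def by blast
  show "comark b = 1"
  proof (cases "b \<in> S")
    case False
    then show ?thesis by (simp add: comark_def)
  next
    case True
    have zero: "v \<bullet> c = 0" if "c \<in> S" "c \<noteq> b" for c
      using v(1)[of c] that by (simp add: nodes_eq node_const_def)
    have "v \<bullet> \<theta> = 1"
      using v(1)[of "- \<theta>"] highest_root_not_simple True by (auto simp: nodes_eq node_const_def)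
    also have "v \<bullet> \<theta> = (\<Sum>c\<in>S. (\<omega> c \<bullet> \<theta>) * (c \<bullet> v))" by (subst inner_commute) (rule inner_expansion)
    also have "\<dots> = (\<Sum>c\<in>S. if c = b then (\<omega> b \<bullet> \<theta>) * (b \<bullet> v) else 0)"
      using zero by (intro sum.cong) (auto simp: inner_commute)
    also have "\<dots> = (\<omega> b \<bullet> \<theta>) * (b \<bullet> v)" using True finite_simple by simp
    finally have prod: "(\<omega> b \<bullet> \<theta>) * (b \<bullet> v) = 1" .
    obtain k l :: int where kl: "\<omega> b \<bullet> \<theta> = of_int k" "b \<bullet> v = of_int l"
      using coefficient_integral[OF highest_root(1) True] v(2)[OF simple_rootD(1)[OF True]]
      by (metis Ints_cases inner_commute)
    have "k * l = 1" using prod unfolding kl by (metis of_int_1 of_int_eq_iff of_int_mult)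
    then have "k = 1" using highest_root_coefficient_pos[OF True] kl(1) by (auto simp: zmult_eq_1_iff)
    then have "of_int (comark b) * (\<theta> \<bullet> \<theta>) = b \<bullet> b" using comark_coefficient[OF True] kl by simp
    moreover have "b \<bullet> b \<le> \<theta> \<bullet> \<theta>"
      using highest_root_long[OF simple_rootD(1)[OF True]] by (simp add: norm_le)
    moreover have "\<theta> \<bullet> \<theta> > 0" using highest_root(2) by simp
    ultimately have "real_of_int (comark b) \<le> 1" by (metis mult_le_cancel_right_pos mult_1)
    then show ?thesis using comark_pos[of b] by simp
  qed
qed

lemma special_node_highest: "special_node R \<aa> (- \<theta>)"
  unfolding special_node_def using highest_root_not_simple
  by (auto simp: nodes_eq node_const_def intro!: exI[of _ 0])

lemma special_node_long:
  assumes j: "j \<in> S" "comark j = 1" "long j" shows "special_node R \<aa> j"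
proof -
  have "j \<bullet> j = \<theta> \<bullet> \<theta>" using j(3) by (simp add: dot_square_norm)
  then have "\<omega> j \<bullet> \<theta> = 1"
    using comark_coefficient[OF j(1)] j(2) highest_root(2) by simp
  then show ?thesis
    unfolding special_node_def using j(1) highest_root_not_simple coefficient_integral[OF _ j(1)]
    by (intro conjI exI[of _ "\<omega> j"]) (auto simp: nodes_eq node_const_def fundamental_coweight)
qed

lemma comark_one_iff:
  "(\<exists>j\<in>N. comark j = 1 \<and> K = N - {j}) \<longleftrightarrow>
    maximal_special R \<aa> K \<or>
    (\<exists>n \<alpha>. type_B R \<aa> n \<alpha> \<and> K = affine_nodes R \<aa> - {\<alpha> n}) \<or>
    (\<exists>n \<alpha>. type_C R \<aa> n \<alpha> \<and> (\<exists>j\<in>{1..<n}. K = affine_nodes R \<aa> - {\<alpha> j})) \<or>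
    (\<exists>\<alpha>. type_F4 R \<aa> \<alpha> \<and> K = affine_nodes R \<aa> - {\<alpha> 4}) \<or>
    (\<exists>\<alpha>. type_G2 R \<aa> \<alpha> \<and> K = affine_nodes R \<aa> - {\<alpha> 2})" (is "?L \<longleftrightarrow> ?R")
proof
  assume ?L
  then obtain j where j: "j \<in> N" "comark j = 1" "K = N - {j}" by blast
  show ?R
  proof (cases "j \<in> S \<and> \<not> long j")
    case True
    then show ?thesis using short_node_of_comark_one[of j] j(2) unfolding j(3) by blast
  next
    case False
    then have "special_node R \<aa> j"
      using j special_node_highest special_node_long by (auto simp: nodes_eq)
    then have "maximal_special R \<aa> K"
      unfolding maximal_special_def by (intro exI[of _ j] conjI j(3))
    then show ?thesis by (rule disjI1)
  qed
next
  assume ?R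
  moreover have "?L" if "j \<in> S" "comark j = 1" "K = N - {j}" for j
    using that by (auto simp: nodes_eq)
  moreover have "maximal_special R \<aa> K \<Longrightarrow> ?L"
    unfolding maximal_special_def using special_node_comark by blast
  ultimately show ?L
    using comark_type_B comark_type_C comark_type_F4 comark_type_G2 by (elim disjE exE conjE bexE) blast+
qed

end

section \<open>The groups of sets of affine nodes\<close>

lemma aff_refl_diff: "aff_refl a m x - aff_refl a m y = root_refl a (x - y)"
  by (simp add: aff_refl_def inner_diff_left algebra_simps)

lemma simple_reflection_involution: "t \<in> simple_reflection R \<aa> ` K \<Longrightarrow> t \<circ> t = id"
  using aff_refl_involution unfolding simple_reflection_def by blast

lemma W_K_id: "id \<in> W_K R \<aa> K"
  using generate.one[of "BijGroup UNIV"] by (simp add: W_K_def BijGroup_UNIV_simps)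

lemma W_K_reflection: "b \<in> K \<Longrightarrow> simple_reflection R \<aa> b \<in> W_K R \<aa> K"
  by (simp add: W_K_def generate.incl)

lemma W_K_comp: "g \<in> W_K R \<aa> K \<Longrightarrow> h \<in> W_K R \<aa> K \<Longrightarrow> g \<circ> h \<in> W_K R \<aa> K"
  unfolding W_K_def
  by (rule generate_comp, assumption, assumption, rule bij_involution, rule simple_reflection_involution)

text \<open>Taking linear parts is multiplicative on affine maps.\<close>

lemma W_pr_eq: "W_pr R \<aa> K = reflection_group K"
proof
  have pr_step: "pr (simple_reflection R \<aa> b \<circ> h) = root_refl b \<circ> pr h" for b h
    by (rule ext) (simp add: pr_def simple_reflection_def aff_refl_diff)
  have pr_id: "pr id = id" by (rule ext) (simp add: pr_def)
  have "pr g \<in> reflection_group K" if "g \<in> W_K R \<aa> K" for g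
    using that unfolding W_K_def
  proof (induction rule: generate_involutions_induct)
    case (step t h)
    then obtain b where "b \<in> K" "t = simple_reflection R \<aa> b" by blast
    then show ?case
      using reflection_group_comp[OF reflection_group_refl step.IH] by (simp only: pr_step)
  next
    case one
    show ?case unfolding pr_id by (rule reflection_group_id)
  qed (rule simple_reflection_involution)
  then show "W_pr R \<aa> K \<subseteq> reflection_group K" by (auto simp: W_pr_def)
  show "reflection_group K \<subseteq> W_pr R \<aa> K"
  proof
    fix w assume "w \<in> reflection_group K"
    then have "\<exists>g\<in>W_K R \<aa> K. w = pr g"
    proof (induction rule: reflection_group_induct)
      case one
      show ?case using W_K_id pr_id[symmetric] by blast
    next
      case (step b h)
      then obtain g where g: "g \<in> W_K R \<aa> K" "h = pr g" by blast
      have "simple_reflection R \<aa> b \<circ> g \<in> W_K R \<aa> K"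
        using g(1) step.hyps by (intro W_K_comp W_K_reflection)
      moreover have "root_refl b \<circ> h = pr (simple_reflection R \<aa> b \<circ> g)"
        by (simp only: pr_step g(2))
      ultimately show ?case by blast
    qed
    then show "w \<in> W_pr R \<aa> K" by (auto simp: W_pr_def)
  qed
qed

lemma reflection_group_bij: "g \<in> reflection_group A \<Longrightarrow> bij g"
  by (erule reflection_group_inverse) (rule o_bij)

lemma reflection_group_set_mult:
  "reflection_group A <#>\<^bsub>BijGroup UNIV\<^esub> reflection_group B =
    {w \<circ> s |w s. w \<in> reflection_group A \<and> s \<in> reflection_group B}"
proof -
  have "w \<otimes>\<^bsub>BijGroup UNIV\<^esub> s = w \<circ> s" if "w \<in> reflection_group A" "s \<in> reflection_group B" for w s
    using that reflection_group_bij BijGroup_UNIV_simps(3) by metis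
  then show ?thesis unfolding set_mult_def by fastforce
qed

context irreducible_chamber
begin

text \<open>
  The reflections in the two parallel hyperplanes where \<open>\<theta>\<close> is 0 and 1 compose to a translation.
\<close>

lemma spherical_proper:
  assumes "spherical R \<aa> K" shows "K \<subseteq> N" "K \<noteq> N"
proof -
  show "K \<subseteq> N" using assms by (simp add: spherical_def)
  show "K \<noteq> N"
  proof
    assume K: "K = N"
    have node: "simple_reflection R \<aa> b \<in> W_K R \<aa> K" if "b \<in> N" for b
      using that K by (intro W_K_reflection) simp
    have W0: "w \<in> W_K R \<aa> K" if "w \<in> reflection_group S" for w
      using that
    proof (induction rule: reflection_group_induct)
      case (step b h)
      have "root_refl b \<in> W_K R \<aa> K"
        using node[of b] step.hyps by (simp add: nodes_eq simple_reflection_def node_const_def)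
      then show ?case using step.IH by (rule W_K_comp)
    qed (rule W_K_id)
    have "root_refl \<theta> \<in> W_K R \<aa> K"
      using W0 reflection_group_refl[OF highest_root(1)] by (simp add: reflection_group_simple)
    moreover have "aff_refl (- \<theta>) 1 \<in> W_K R \<aa> K"
      using node[of "- \<theta>"] highest_root_not_simple by (simp add: nodes_eq simple_reflection_def node_const_def)
    ultimately have "aff_refl (- \<theta>) 1 \<circ> root_refl \<theta> \<in> W_K R \<aa> K" by (intro W_K_comp)
    moreover have "aff_refl (- \<theta>) 1 \<circ> root_refl \<theta> = (\<lambda>v. v + coroot \<theta>)"
    proof
      fix v
      have "aff_refl (- \<theta>) 1 w = root_refl \<theta> w + coroot \<theta>" for w
        by (simp add: aff_refl_def coroot_uminus algebra_simps)
      moreover have "root_refl \<theta> (root_refl \<theta> v) = v"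
        using aff_refl_involution[of \<theta> 0] by (simp add: fun_eq_iff)
      ultimately show "(aff_refl (- \<theta>) 1 \<circ> root_refl \<theta>) v = v + coroot \<theta>" by simp
    qed
    ultimately have T: "(\<lambda>v. v + coroot \<theta>) \<in> W_K R \<aa> K" by simp
    have shift: "(\<lambda>v. v + real n *\<^sub>R coroot \<theta>) \<in> W_K R \<aa> K" for n
    proof (induction n)
      case 0
      then show ?case using W_K_id by (simp add: id_def)
    next
      case (Suc n)
      have "(\<lambda>v. v + real (Suc n) *\<^sub>R coroot \<theta>) = (\<lambda>v. v + coroot \<theta>) \<circ> (\<lambda>v. v + real n *\<^sub>R coroot \<theta>)"
        by (simp add: fun_eq_iff algebra_simps)
      then show ?case using W_K_comp[OF T Suc] by metis
    qed
    have "inj (\<lambda>n v. v + real n *\<^sub>R coroot \<theta>)"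
    proof (rule injI)
      fix x y :: nat assume "(\<lambda>v. v + real x *\<^sub>R coroot \<theta>) = (\<lambda>v. v + real y *\<^sub>R coroot \<theta>)"
      then have "0 + real x *\<^sub>R coroot \<theta> = 0 + real y *\<^sub>R coroot \<theta>" by (rule fun_cong)
      then show "x = y" using highest_root(2) by simp
    qed
    then have "infinite (range (\<lambda>n v. v + real n *\<^sub>R coroot \<theta>))" by (rule range_inj_infinite)
    moreover have "range (\<lambda>n v. v + real n *\<^sub>R coroot \<theta>) \<subseteq> W_K R \<aa> K" using shift by blast
    ultimately show False using assms finite_subset by (auto simp: spherical_def)
  qed
qed

lemma factorization_iff:
  assumes K: "K \<subseteq> N" "K \<noteq> N"
  shows "weyl_group R = W_pr R \<aa> K <#>\<^bsub>BijGroup UNIV\<^esub> W_short R \<aa> \<longleftrightarrow>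
    (\<exists>j\<in>N. comark j = 1 \<and> K = N - {j})"
proof -
  have groups: "weyl_group R = reflection_group R" "W_short R \<aa> = reflection_group S_short"
    by (simp_all add: weyl_group_def W_short_def reflection_group_def)
  have sub: "reflection_group K \<subseteq> reflection_group R" "reflection_group S_short \<subseteq> reflection_group R"
    using K(1) node_root simple_rootD(1) by (auto intro!: reflection_group_subset reflection_group_refl)
  have "weyl_group R = W_pr R \<aa> K <#>\<^bsub>BijGroup UNIV\<^esub> W_short R \<aa> \<longleftrightarrow>
      (\<forall>g\<in>reflection_group R. \<exists>w\<in>reflection_group K. \<exists>s\<in>reflection_group S_short. g = w \<circ> s)"
    unfolding groups W_pr_eq reflection_group_set_mult
  proof (intro iffI equalityI subsetI)
    fix g assume "g \<in> {w \<circ> s |w s. w \<in> reflection_group K \<and> s \<in> reflection_group S_short}"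
    then obtain w s where "g = w \<circ> s" "w \<in> reflection_group R" "s \<in> reflection_group R"
      using sub by blast
    then show "g \<in> reflection_group R" using reflection_group_comp by metis
  qed blast+
  also have "\<dots> \<longleftrightarrow> (\<exists>j\<in>N. comark j = 1 \<and> K = N - {j})"
  proof
    assume "\<forall>g\<in>reflection_group R. \<exists>w\<in>reflection_group K. \<exists>s\<in>reflection_group S_short. g = w \<circ> s"
    then obtain j where "j \<in> N" "comark j = 1" "K = N - {j}"
      using factorization_necessary[OF K] by blast
    then show "\<exists>j\<in>N. comark j = 1 \<and> K = N - {j}" by blast
  next
    assume "\<exists>j\<in>N. comark j = 1 \<and> K = N - {j}"
    then obtain j where j: "j \<in> N" "comark j = 1" "K = N - {j}" by blast
    show "\<forall>g\<in>reflection_group R. \<exists>w\<in>reflection_group K. \<exists>s\<in>reflection_group S_short. g = w \<circ> s"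
      unfolding j(3) using factorization_sufficient[OF j(1,2)] by (rule ballI)
  qed
  finally show ?thesis .
qed

end

section \<open>The relative root system of a quasi-simple group\<close>

context apartment
begin

abbreviation "F \<equiv> galois_fixed i \<rho>"

lemma fixed_subspace: "subspace F"
proof -
  have lin: "linear (\<rho> \<sigma>)" if "\<sigma> \<in> galois_group i" for \<sigma>
    using action_orthogonal[OF that] by (simp add: orthogonal_transformation_def)
  show ?thesis
    unfolding subspace_def galois_fixed_def
    by (auto simp: linear_0[OF lin] linear_add[OF lin] linear_scale[OF lin])
qed

text \<open>
  The fixed vectors are the orthogonal complement of the kernel of \<open>\<pi>\<close>. This gives the isomorphism
  between \<open>X\<^sub>*(S) \<otimes> \<real>\<close> and \<open>V\<close> through which roots are restricted.
\<close>

lemma fixed_iff_orthogonal: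
  "x \<in> F \<longleftrightarrow> (\<forall>y\<in>{\<rho> \<sigma> y - y |\<sigma> y. \<sigma> \<in> galois_group i}. orthogonal x y)"
proof
  assume x: "x \<in> F"
  have "x \<bullet> (\<rho> \<sigma> y - y) = 0" if \<sigma>: "\<sigma> \<in> galois_group i" for \<sigma> y
  proof -
    have "x \<bullet> \<rho> \<sigma> y = \<rho> \<sigma> x \<bullet> \<rho> \<sigma> y" using x \<sigma> by (simp add: galois_fixed_def)
    then show ?thesis
      using action_orthogonal[OF \<sigma>] by (simp add: orthogonal_transformation_def inner_diff_right)
  qed
  then show "\<forall>y\<in>{\<rho> \<sigma> y - y |\<sigma> y. \<sigma> \<in> galois_group i}. orthogonal x y" by (auto simp: orthogonal_def)
next
  assume orth: "\<forall>y\<in>{\<rho> \<sigma> y - y |\<sigma> y. \<sigma> \<in> galois_group i}. orthogonal x y"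
  have "\<rho> \<sigma> x = x" if \<sigma>: "\<sigma> \<in> galois_group i" for \<sigma>
  proof -
    have eq: "x \<bullet> \<rho> \<sigma> y = \<rho> \<sigma> x \<bullet> \<rho> \<sigma> y" for y
    proof -
      have "\<rho> \<sigma> y - y \<in> {\<rho> \<sigma> y - y |\<sigma> y. \<sigma> \<in> galois_group i}" using \<sigma> by blast
      then have "orthogonal x (\<rho> \<sigma> y - y)" using orth by (rule bspec[rotated])
      then show ?thesis
        using action_orthogonal[OF \<sigma>]
        by (simp add: orthogonal_def orthogonal_transformation_def inner_diff_right)
    qed
    obtain y where "\<rho> \<sigma> y = x - \<rho> \<sigma> x"
      using orthogonal_transformation_surj[OF action_orthogonal[OF \<sigma>]] by (metis surjD)
    then have "(x - \<rho> \<sigma> x) \<bullet> (x - \<rho> \<sigma> x) = 0" using eq[of y] by (simp add: inner_diff_left)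
    then show ?thesis by simp
  qed
  then show "x \<in> F" by (simp add: galois_fixed_def)
qed

lemma proj_fixed_surj: "\<exists>x\<in>F. \<pi> x = v"
proof -
  let ?A = "{\<rho> \<sigma> y - y |\<sigma> y. \<sigma> \<in> galois_group i}"
  obtain y where y: "\<pi> y = v" using proj_surj by (metis surjD)
  obtain a x where ax: "a \<in> span ?A" "\<And>w. w \<in> span ?A \<Longrightarrow> orthogonal x w" "y = a + x"
    using orthogonal_subspace_decomp_exists[of ?A y] by blast
  have "orthogonal x w" if "w \<in> ?A" for w
    using span_base[OF that] by (rule ax(2))
  then have "x \<in> F" unfolding fixed_iff_orthogonal by (rule ballI)
  moreover have "\<pi> a = 0" using ax(1) proj_kernel by blast
  then have "\<pi> x = v" using y ax(3) by (simp add: linear_add[OF proj_linear])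
  ultimately show ?thesis by blast
qed

text \<open>
  Restriction of absolute roots to the fixed vectors, seen in \<open>V\<close> through \<open>\<pi>\<close>. It is taken up to a factor,
  since \<open>R\<close> is given by the affine root hyperplanes, which determine the gradients of affine roots
  up to scaling only.
\<close>

definition restricts_to :: "'x \<Rightarrow> 'v \<Rightarrow> bool" where
  "restricts_to a r \<longleftrightarrow> (\<exists>k. k \<noteq> 0 \<and> (\<forall>x\<in>F. \<pi> x \<bullet> r = k * (x \<bullet> a)))"

text \<open>Two affine functions with the same zero locus have proportional gradients.\<close>

lemma restricts_to_if_same_hyperplane:
  assumes a: "a \<in> \<Phi>" and r: "r \<noteq> 0" and \<psi>: "\<And>x. x \<in> F \<Longrightarrow> \<psi> (\<pi> x) = x \<bullet> a + q"
    and hyp: "{v. \<psi> v = 0} = {v. v \<bullet> r = m}"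
  shows "restricts_to a r"
proof -
  have lin: "\<pi> (x + y) = \<pi> x + \<pi> y" "\<pi> (c *\<^sub>R x) = c *\<^sub>R \<pi> x" for x y c
    using proj_linear by (simp_all add: linear_add linear_scale)
  obtain x1 where x1: "x1 \<in> F" "x1 \<bullet> a \<noteq> 0" using centralizer[OF a] by blast
  have zero: "x \<bullet> a = - q \<longleftrightarrow> \<pi> x \<bullet> r = m" if "x \<in> F" for x
  proof -
    have "\<psi> (\<pi> x) = 0 \<longleftrightarrow> \<pi> x \<bullet> r = m" using hyp by (simp only: set_eq_iff mem_Collect_eq)
    then show ?thesis using \<psi>[OF that] by linarith
  qed
  define x0 where "x0 = (- q / (x1 \<bullet> a)) *\<^sub>R x1"
  have x0: "x0 \<in> F" "x0 \<bullet> a = - q"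
    using x1(2) subspace_scale[OF fixed_subspace x1(1), of "- q / (x1 \<bullet> a)"] by (simp_all add: x0_def)
  have ker: "\<pi> y \<bullet> r = 0" if "y \<in> F" "y \<bullet> a = 0" for y
  proof -
    have "x0 + y \<in> F" using subspace_add[OF fixed_subspace x0(1) that(1)] .
    then have "\<pi> (x0 + y) \<bullet> r = m" using zero[of "x0 + y"] that x0 by (simp add: inner_add_left)
    moreover have "\<pi> x0 \<bullet> r = m" using zero x0 by blast
    ultimately show ?thesis by (simp add: lin inner_add_left)
  qed
  define k where "k = (\<pi> x1 \<bullet> r) / (x1 \<bullet> a)"
  have k: "\<pi> x \<bullet> r = k * (x \<bullet> a)" if "x \<in> F" for x
  proof -
    let ?y = "x + (- (x \<bullet> a) / (x1 \<bullet> a)) *\<^sub>R x1"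
    have "?y \<in> F" using subspace_add[OF fixed_subspace that subspace_scale[OF fixed_subspace x1(1)]] .
    moreover have "?y \<bullet> a = 0" using x1(2) by (simp add: inner_diff_left)
    ultimately have "\<pi> ?y \<bullet> r = 0" by (rule ker)
    then show ?thesis unfolding lin inner_add_left inner_scaleR_left k_def by (simp add: field_simps)
  qed
  have "k \<noteq> 0"
  proof
    assume "k = 0"
    obtain x where "x \<in> F" "\<pi> x = r" using proj_fixed_surj by blast
    then show False using k[of x] \<open>k = 0\<close> r by simp
  qed
  then show ?thesis unfolding restricts_to_def using k by blast
qed

lemma R_nonzero: "r \<in> R \<Longrightarrow> r \<noteq> 0"
  using root_system_nonzero[OF root_system_R(1)] by blast

lemma restricts_to_exists:
  assumes "a \<in> \<Phi>" shows "\<exists>r\<in>R. restricts_to a r"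
proof -
  obtain \<psi> q where \<psi>: "\<psi> \<in> \<Psi>" "\<forall>x\<in>F. \<psi> (\<pi> x) = x \<bullet> a + q"
    using affine_root_exists[OF assms] by blast
  then have "{v. \<psi> v = 0} \<in> root_hyperplanes R" using affine_root_hyperplanes by blast
  then obtain r m where "r \<in> R" "{v. \<psi> v = 0} = {v. v \<bullet> r = - of_int m}"
    unfolding root_hyperplanes_def by blast
  then show ?thesis using restricts_to_if_same_hyperplane[OF assms, of r \<psi>] \<psi>(2) R_nonzero by blast
qed

lemma restricts_from_exists:
  assumes "r \<in> R" shows "\<exists>a\<in>\<Phi>. restricts_to a r"
proof -
  have "{v. v \<bullet> r = - of_int 0} \<in> root_hyperplanes R"
    unfolding root_hyperplanes_def using assms by blast
  then obtain \<psi> where \<psi>: "\<psi> \<in> \<Psi>" "{v. \<psi> v = 0} = {v. v \<bullet> r = - of_int 0}"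
    using affine_root_hyperplanes by (smt (verit, best) mem_Collect_eq)
  then obtain a q where "a \<in> \<Phi>" "\<forall>x\<in>F. \<psi> (\<pi> x) = x \<bullet> a + q"
    using affine_root_gradient by blast
  then show ?thesis using restricts_to_if_same_hyperplane[of a r \<psi>] \<psi>(2) R_nonzero[OF assms] by blast
qed

text \<open>Two such vectors are proportional.\<close>

lemma restricts_to_unique:
  assumes "restricts_to a r" "restricts_to a s" "s \<noteq> 0" shows "r \<bullet> s \<noteq> 0"
proof
  assume 0: "r \<bullet> s = 0"
  obtain k l where k: "k \<noteq> 0" "\<forall>x\<in>F. \<pi> x \<bullet> r = k * (x \<bullet> a)" and l: "l \<noteq> 0" "\<forall>x\<in>F. \<pi> x \<bullet> s = l * (x \<bullet> a)"
    using assms unfolding restricts_to_def by blast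
  obtain x where x: "x \<in> F" "\<pi> x = s" using proj_fixed_surj by blast
  have "k * (x \<bullet> a) = 0" using k(2) x 0 by (metis inner_commute)
  then have "s \<bullet> s = 0" using k(1) l(2) x by fastforce
  then show False using assms(3) by simp
qed

text \<open>
  If the inner product were positive, \<open>a - b\<close> would be a root, and its restriction would have nonzero
  components along both parts of \<open>R\<close>; but every relative root lies in one of the parts and is
  orthogonal to the other.
\<close>

lemma orthogonal_restrictions:
  assumes R': "R' \<subseteq> R" "\<And>r s. r \<in> R' \<Longrightarrow> s \<in> R - R' \<Longrightarrow> r \<bullet> s = 0"
    and a: "a \<in> \<Phi>" "restricts_to a r" "r \<in> R'" and b: "b \<in> \<Phi>" "restricts_to b s" "s \<in> R - R'"
  shows "\<not> a \<bullet> b > 0"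
proof
  assume pos: "a \<bullet> b > 0"
  have rs: "r \<bullet> s = 0" "r \<noteq> 0" "s \<noteq> 0" using R' a(3) b(3) R_nonzero by auto
  then have "a \<noteq> b" using restricts_to_unique a(2) b(2) by blast
  then have "a - b \<in> \<Phi>" using root_diff[OF abs_roots a(1) b(1)] pos by blast
  then obtain t where t: "t \<in> R" "restricts_to (a - b) t" using restricts_to_exists by blast
  obtain k l n where k: "k \<noteq> 0" "\<forall>x\<in>F. \<pi> x \<bullet> r = k * (x \<bullet> a)"
    and l: "l \<noteq> 0" "\<forall>x\<in>F. \<pi> x \<bullet> s = l * (x \<bullet> b)"
    and n: "n \<noteq> 0" "\<forall>x\<in>F. \<pi> x \<bullet> t = n * (x \<bullet> (a - b))"
    using a(2) b(2) t(2) unfolding restricts_to_def by blast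
  have t_eq: "v \<bullet> t = n * ((v \<bullet> r) / k - (v \<bullet> s) / l)" for v
  proof -
    obtain x where "x \<in> F" "\<pi> x = v" using proj_fixed_surj by blast
    then show ?thesis using k l n by (metis inner_diff_right nonzero_mult_div_cancel_left)
  qed
  have "r \<bullet> t \<noteq> 0" "s \<bullet> t \<noteq> 0"
    using t_eq[of r] t_eq[of s] rs k(1) l(1) n(1) by (auto simp: inner_commute)
  then show False
    using R'(2)[of r t] R'(2)[of t s] a(3) b(3) t(1) by (cases "t \<in> R'") (auto simp: inner_commute)
qed

text \<open>
  A decomposition of \<open>R\<close> lifts to the absolute roots. The lifted part is stable under the Galois group,
  as this does not change restrictions to fixed vectors; so it consists of all absolute roots.
\<close>

lemma relative_irreducible:
  assumes qs: "quasi_simple i \<Phi> \<rho>" and R': "R' \<subseteq> R" "R' \<noteq> {}"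
    and orth: "\<And>r s. r \<in> R' \<Longrightarrow> s \<in> R - R' \<Longrightarrow> r \<bullet> s = 0"
  shows "R' = R"
proof -
  let ?\<Phi>' = "{a\<in>\<Phi>. \<exists>r\<in>R'. restricts_to a r}"
  have component: "\<Phi>' = \<Phi>" if "\<Phi>' \<subseteq> \<Phi>" "\<Phi>' \<noteq> {}" "\<forall>\<sigma>\<in>galois_group i. \<rho> \<sigma> ` \<Phi>' = \<Phi>'"
    "\<forall>a\<in>\<Phi>'. \<forall>b\<in>\<Phi> - \<Phi>'. a \<bullet> b = 0" for \<Phi>'
    using qs that unfolding quasi_simple_def by simp
  have nonempty: "?\<Phi>' \<noteq> {}" using restricts_from_exists R' by blast
  have stable: "\<rho> \<sigma> ` ?\<Phi>' = ?\<Phi>'" if \<sigma>: "\<sigma> \<in> galois_group i" for \<sigma>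
  proof (rule endo_inj_surj)
    show "finite ?\<Phi>'" using root_system_finite[OF abs_roots(1)] by simp
    show "inj_on (\<rho> \<sigma>) ?\<Phi>'"
      using orthogonal_transformation_inj[OF action_orthogonal[OF \<sigma>]] inj_on_subset by blast
    have same: "x \<bullet> \<rho> \<sigma> a = x \<bullet> a" if "x \<in> F" for x a
    proof -
      have "x \<bullet> \<rho> \<sigma> a = \<rho> \<sigma> x \<bullet> \<rho> \<sigma> a" using that \<sigma> by (simp add: galois_fixed_def)
      then show ?thesis using action_orthogonal[OF \<sigma>] by (simp add: orthogonal_transformation_def)
    qed
    have "restricts_to (\<rho> \<sigma> a) r" if "restricts_to a r" for a r
      using that same unfolding restricts_to_def by simp
    then show "\<rho> \<sigma> ` ?\<Phi>' \<subseteq> ?\<Phi>'"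
      using action_roots[OF \<sigma>] by blast
  qed
  have orthogonal: "a \<bullet> b = 0" if a: "a \<in> ?\<Phi>'" and b: "b \<in> \<Phi> - ?\<Phi>'" for a b
  proof -
    obtain r where r: "r \<in> R'" "restricts_to a r" using a by blast
    obtain s where s: "s \<in> R" "restricts_to b s" using restricts_to_exists b by blast
    then have s': "s \<in> R - R'" using b by blast
    obtain k where "k \<noteq> 0" "\<forall>x\<in>F. \<pi> x \<bullet> s = k * (x \<bullet> b)" using s(2) unfolding restricts_to_def by blast
    then have "restricts_to (- b) s" unfolding restricts_to_def by (intro exI[of _ "- k"]) simp
    moreover have "- b \<in> \<Phi>" using b root_system_uminus[OF abs_roots(1)] by blast
    ultimately have "\<not> a \<bullet> b > 0" "\<not> a \<bullet> (- b) > 0"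
      using orthogonal_restrictions[OF R'(1) orth] a b r s s' by blast+
    then show ?thesis by simp
  qed
  have all: "?\<Phi>' = \<Phi>"
    by (intro component ballI nonempty stable orthogonal Collect_restrict)
  have "r \<in> R'" if r: "r \<in> R" for r
  proof (rule ccontr)
    assume "r \<notin> R'"
    obtain a where a: "a \<in> \<Phi>" "restricts_to a r" using restricts_from_exists[OF r] by blast
    then obtain r' where r': "r' \<in> R'" "restricts_to a r'" using all by blast
    then have "r' \<bullet> r \<noteq> 0" using restricts_to_unique a(2) R_nonzero[OF r] by blast
    then show False using orth r r'(1) \<open>r \<notin> R'\<close> by blast
  qed
  then show ?thesis using R'(1) by blast
qed

text \<open>
  A vector orthogonal to all relative roots lifts to a fixed vector orthogonal to all absolute roots.
\<close>

lemma relative_span: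
  assumes qs: "quasi_simple i \<Phi> \<rho>" shows "span R = UNIV"
proof (rule ccontr)
  assume "span R \<noteq> UNIV"
  then obtain u where u: "u \<noteq> 0" "\<forall>x\<in>span R. u \<bullet> x = 0" using span_not_UNIV_orthogonal by blast
  obtain x where x: "x \<in> F" "\<pi> x = u" using proj_fixed_surj by blast
  have "orthogonal x a" if a: "a \<in> \<Phi>" for a
  proof -
    obtain r where r: "r \<in> R" "restricts_to a r" using restricts_to_exists[OF a] by blast
    then obtain k where "k \<noteq> 0" "\<forall>x\<in>F. \<pi> x \<bullet> r = k * (x \<bullet> a)"
      unfolding restricts_to_def by blast
    moreover have "u \<bullet> r = 0" using u(2) span_base[OF r(1)] by blast
    ultimately show ?thesis using x by (auto simp: orthogonal_def)
  qed
  then have "orthogonal x x"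
    using orthogonal_to_span[of x \<Phi> x] qs by (auto simp: quasi_simple_def)
  then have "x = 0" by (simp add: orthogonal_def)
  then show False using x u(1) linear_0[OF proj_linear] by simp
qed

text \<open>
  The sign of a root is constant on the alcove, which is connected and avoids the root hyperplanes.
\<close>

lemma irreducible_chamber:
  assumes qs: "quasi_simple i \<Phi> \<rho>"
  obtains p where "irreducible_chamber R \<aa> p"
proof -
  obtain p where p: "p \<in> \<aa>" using in_components_nonempty[OF alcove] by blast
  have conn: "connected \<aa>" using in_components_connected[OF alcove] .
  have off: "v \<bullet> a \<noteq> 0" if "v \<in> \<aa>" "a \<in> R" for v a
  proof
    assume "v \<bullet> a = 0"
    then have "v \<in> {v. v \<bullet> a = - of_int 0}" by simp
    moreover have "{v. v \<bullet> a = - of_int 0} \<in> root_hyperplanes R"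
      unfolding root_hyperplanes_def using that by blast
    ultimately show False using in_components_subset[OF alcove] that(1) by blast
  qed
  have "irreducible_chamber R \<aa> p"
  proof
    show "R \<noteq> {}" using qs restricts_to_exists unfolding quasi_simple_def by blast
    show "p \<bullet> a \<noteq> 0" if "a \<in> R" for a using off p that by blast
    show "pos_roots R \<aa> = {a\<in>R. p \<bullet> a > 0}"
    proof (intro equalityI subsetI)
      fix a assume "a \<in> {a\<in>R. p \<bullet> a > 0}"
      then have a: "a \<in> R" "p \<bullet> a > 0" by auto
      have "v \<bullet> a > 0" if v: "v \<in> \<aa>" for v
      proof (rule ccontr)
        assume "\<not> v \<bullet> a > 0"
        then obtain z where "z \<in> \<aa>" "a \<bullet> z = 0"
          using connected_ivt_hyperplane[OF conn v p, of a 0] a(2) by (auto simp: inner_commute)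
        then show False using off[of z a] a(1) by (simp add: inner_commute)
      qed
      then show "a \<in> pos_roots R \<aa>" using a(1) by (simp add: pos_roots_def)
    qed (use p in \<open>auto simp: pos_roots_def\<close>)
  qed (use root_system_R relative_span[OF qs] relative_irreducible[OF qs] in blast)+
  then show ?thesis using that by blast
qed

end

theorem proposition1p5:
  fixes i :: "'k::alg_closed_field fls \<Rightarrow> 's::field"
    and X \<Phi> :: "'x::euclidean_space set"
    and \<rho> :: "('s \<Rightarrow> 's) \<Rightarrow> 'x \<Rightarrow> 'x"
    and \<pi> :: "'x \<Rightarrow> 'v::euclidean_space"
    and \<Psi> :: "('v \<Rightarrow> real) set"
    and R \<aa> K :: "'v set"
    and \<mu> :: 'x
  assumes "apartment i X \<Phi> \<rho> \<pi> \<Psi> R \<aa>"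
    and "quasi_simple i \<Phi> \<rho>"
    and "\<mu> \<in> X" and "dominant i \<Phi> \<rho> \<pi> \<aa> \<mu>" and "\<not> central \<Phi> \<mu>"
    and "spherical R \<aa> K"
  shows "weyl_group R = W_pr R \<aa> K <#>\<^bsub>BijGroup UNIV\<^esub> W_short R \<aa> \<longleftrightarrow>
    maximal_special R \<aa> K \<or>
    (\<exists>n \<alpha>. type_B R \<aa> n \<alpha> \<and> K = affine_nodes R \<aa> - {\<alpha> n}) \<or>
    (\<exists>n \<alpha>. type_C R \<aa> n \<alpha> \<and> (\<exists>j\<in>{1..<n}. K = affine_nodes R \<aa> - {\<alpha> j})) \<or>
    (\<exists>\<alpha>. type_F4 R \<aa> \<alpha> \<and> K = affine_nodes R \<aa> - {\<alpha> 4}) \<or>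
    (\<exists>\<alpha>. type_G2 R \<aa> \<alpha> \<and> K = affine_nodes R \<aa> - {\<alpha> 2})"
proof -
  obtain p where "irreducible_chamber R \<aa> p"
    using apartment.irreducible_chamber[OF assms(1,2)] by blast
  then interpret irreducible_chamber R \<aa> p .
  show ?thesis
    using factorization_iff[OF spherical_proper[OF assms(6)]] by (simp only: comark_one_iff)
qed

end
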